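(* Let $(X_i)_{i\in\mathbb Z}$ be a strictly stationary sequence of random variables, defined on a probability space $(\Omega,\mathcal T,\mathbb P)$, with values in a Polish space $E$, and let $\mu$ be the common law of the $X_i$. Assume that $\lim_{n\to\infty}\beta_{\infty,1}(n)=0$. Let $(A_k)_{k>0}$ be a sequence of Borel sets in $E$ with $\mu(A_1)>0$ and $\sum_{k>0}\mu(A_k)=+\infty$. Set $B_k=\{X_k\in A_k\}$ for every $k>0$. (i) If $\mu(\limsup_n A_n)>0$, then $(B_k)_{k>0}$ is a Borel-Cantelli sequence. (ii) Set $E_n=\sum_{k=1}^n\mu(A_k)$ and $H_n=E_n^{-1}\sum_{k=1}^n\mathbf 1_{A_k}$. If $(H_n)_{n>0}$ is a uniformly integrable sequence in $(E,\mathcal B(E),\mu)$, then $(B_k)_{k>0}$ is an $L^1$ Borel-Cantelli sequence. (iii) Let $Q_{H_n}$ be the cadlag inverse of the tail function $t\mapsto\mu(H_n>t)$, and set $$Q^*(0)=0\quad\text{and}\quad Q^*(u)=u^{-1}\sup_{n>0}\int_0^u Q_{H_n}(s)\,ds\ \text{ for } u\in(0,1].$$ If $$\sum_{j>0}j^{-1}\beta_{\infty,1}(j)\,Q^*(\beta_{\infty,1}(j))<\infty,$$ then $(B_k)_{k>0}$ is a strongly Borel-Cantelli sequence.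
   Context: For events $(B_k)_{k>0}$ in $(\Omega,\mathcal T,\mathbb P)$, write $S_n=\sum_{k=1}^n\mathbf 1_{B_k}$ and $E_n=\mathbb E(S_n)$. The sequence $(B_k)_{k>0}$ is a Borel-Cantelli sequence if $\mathbb P(\limsup_k B_k)=1$, i.e. $\sum_{k>0}\mathbf 1_{B_k}=\infty$ a.s.; it is an $L^1$ Borel-Cantelli sequence if $\sum_k\mathbb P(B_k)=\infty$ and $\lim_n\|S_n/E_n-1\|_1=0$; it is a strongly Borel-Cantelli sequence if $\sum_k\mathbb P(B_k)=\infty$ and $\lim_n S_n/E_n=1$ a.s. $\limsup_n A_n=\bigcap_N\bigcup_{n\ge N}A_n$. $\beta$-mixing coefficients: for $\sigma$-fields $\mathcal A$, $\mathcal B$ generated by random variables with values in Polish spaces, $\beta(\mathcal A,\mathcal B)=\mathbb E\bigl(\sup_{B\in\mathcal B}|\mathbb P(B\mid\mathcal A)-\mathbb P(B)|\bigr)$, where $\mathbb P(\cdot\mid\mathcal A)$ is a regular version of the conditional probability. With $\mathcal F_m=\sigma(X_k:k\le m)$, set $\beta_{\infty,1}(n)=\beta(\mathcal F_{-n},\sigma(X_0))$ for $n>0$. The cadlag inverse of the tail function of a nonnegative random variable $Z$ is $Q_Z(u)=\inf\{t\ge 0: \mathbb P(Z>t)\le u\}$. A family $(Z_i)_{i\in I}$ of nonnegative random variables is uniformly integrable if $\lim_{M\to\infty}\sup_{i\in I}\mathbb E(Z_i\mathbf 1_{Z_i>M})=0$. *)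

theory Defs
  imports "HOL-Probability.Probability"
begin

section \<open>Borel-Cantelli sequences\<close>

text \<open>
  Sequences indexed by the positive integers are functions on \<open>nat\<close> whose value at \<open>0\<close> is never
  used; \<open>limsup B\<close> is the library's \<open>\<Inter>N. \<Union>n\<ge>N. B n\<close>, which does not depend on \<open>B 0\<close> either.
\<close>

definition hits :: "(nat \<Rightarrow> 'a set) \<Rightarrow> nat \<Rightarrow> 'a \<Rightarrow> real" where
  "hits B n \<omega> = (\<Sum>k=1..n. indicator (B k) \<omega>)"

definition expected_hits :: "'a measure \<Rightarrow> (nat \<Rightarrow> 'a set) \<Rightarrow> nat \<Rightarrow> real" where
  "expected_hits M B n = (\<integral>\<omega>. hits B n \<omega> \<partial>M)"

definition borel_cantelli_seq :: "'a measure \<Rightarrow> (nat \<Rightarrow> 'a set) \<Rightarrow> bool" where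
  "borel_cantelli_seq M B \<longleftrightarrow> measure M (limsup B) = 1"

definition L1_borel_cantelli_seq :: "'a measure \<Rightarrow> (nat \<Rightarrow> 'a set) \<Rightarrow> bool" where
  "L1_borel_cantelli_seq M B \<longleftrightarrow>
     (\<Sum>k. emeasure M (B (Suc k))) = \<infinity> \<and>
     (\<lambda>n. \<integral>\<omega>. \<bar>hits B n \<omega> / expected_hits M B n - 1\<bar> \<partial>M) \<longlonglongrightarrow> 0"

definition strongly_borel_cantelli_seq :: "'a measure \<Rightarrow> (nat \<Rightarrow> 'a set) \<Rightarrow> bool" where
  "strongly_borel_cantelli_seq M B \<longleftrightarrow>
     (\<Sum>k. emeasure M (B (Suc k))) = \<infinity> \<and>
     (AE \<omega> in M. (\<lambda>n. hits B n \<omega> / expected_hits M B n) \<longlonglongrightarrow> 1)"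

section \<open>Stationary sequences and beta-mixing coefficients\<close>

definition strictly_stationary ::
    "'a measure \<Rightarrow> 'e measure \<Rightarrow> (int \<Rightarrow> 'a \<Rightarrow> 'e) \<Rightarrow> bool" where
  "strictly_stationary M N X \<longleftrightarrow>
     (\<forall>h. distr M (\<Pi>\<^sub>M i\<in>UNIV. N) (\<lambda>\<omega> i. X (i + h) \<omega>) = distr M (\<Pi>\<^sub>M i\<in>UNIV. N) (\<lambda>\<omega> i. X i \<omega>))"

definition past_algebra ::
    "'a measure \<Rightarrow> 'e measure \<Rightarrow> (int \<Rightarrow> 'a \<Rightarrow> 'e) \<Rightarrow> int \<Rightarrow> 'a measure" where
  "past_algebra M N X m =
     sigma (space M) {X k -` C \<inter> space M | k C. k \<le> m \<and> C \<in> sets N}"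

text \<open>
  \<open>\<kappa> \<omega> C\<close> is a regular version of the conditional probability of \<open>{Y \<in> C}\<close> given the sub-sigma-field
  \<open>F\<close>. The kernel lives on the state space of \<open>Y\<close>: if that space is Polish such a kernel always
  exists, whereas a kernel of measures on \<open>\<sigma>(Y)\<close> need not exist when the range of \<open>Y\<close> is not
  measurable.
\<close>

definition regular_cond_distr ::
    "'a measure \<Rightarrow> 'a measure \<Rightarrow> 'e measure \<Rightarrow> ('a \<Rightarrow> 'e) \<Rightarrow> ('a \<Rightarrow> 'e measure) \<Rightarrow> bool" where
  "regular_cond_distr M F N Y \<kappa> \<longleftrightarrow>
     \<kappa> \<in> F \<rightarrow>\<^sub>M prob_algebra N \<and>
     (\<forall>C\<in>sets N. AE \<omega> in M.
        measure (\<kappa> \<omega>) C = real_cond_exp M F (indicator (Y -` C \<inter> space M)) \<omega>)"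

text \<open>
  \<open>beta_coeff M F N Y\<close> is \<open>\<beta>(F, \<sigma>(Y))\<close>; the elements of \<open>\<sigma>(Y)\<close> are the events \<open>{Y \<in> C}\<close>, \<open>C \<in> sets N\<close>.
  When \<open>N\<close> is the Borel space of a Polish space, two regular versions agree almost surely on all
  \<open>C\<close> simultaneously, so the value does not depend on the choice.
\<close>

definition beta_coeff ::
    "'a measure \<Rightarrow> 'a measure \<Rightarrow> 'e measure \<Rightarrow> ('a \<Rightarrow> 'e) \<Rightarrow> real" where
  "beta_coeff M F N Y =
     (let \<kappa> = (SOME \<kappa>. regular_cond_distr M F N Y \<kappa>)
      in \<integral>\<omega>. (SUP C\<in>sets N. \<bar>measure (\<kappa> \<omega>) C - measure M (Y -` C \<inter> space M)\<bar>) \<partial>M)"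

definition beta_inf_1 ::
    "'a measure \<Rightarrow> (int \<Rightarrow> 'a \<Rightarrow> 'e::topological_space) \<Rightarrow> nat \<Rightarrow> real" where
  "beta_inf_1 M X n = beta_coeff M (past_algebra M borel X (- int n)) borel (X 0)"

section \<open>Uniform integrability and quantile functions\<close>

definition uniformly_integrable ::
    "'e measure \<Rightarrow> 'i set \<Rightarrow> ('i \<Rightarrow> 'e \<Rightarrow> real) \<Rightarrow> bool" where
  "uniformly_integrable N I Z \<longleftrightarrow>
     ((\<lambda>c. SUP i\<in>I. \<integral>\<^sup>+x. ennreal (Z i x) * indicator {x. Z i x > c} x \<partial>N) \<longlongrightarrow> 0) at_top"

text \<open>
  For a probability measure \<open>N\<close> the set below is nonempty for every \<open>u > 0\<close>, and also for \<open>u = 0\<close> when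
  \<open>Z\<close> is bounded.
\<close>

definition tail_quantile :: "'e measure \<Rightarrow> ('e \<Rightarrow> real) \<Rightarrow> real \<Rightarrow> real" where
  "tail_quantile N Z u = Inf {t. t \<ge> 0 \<and> measure N {x \<in> space N. Z x > t} \<le> u}"

definition Q_star :: "'e measure \<Rightarrow> (nat \<Rightarrow> 'e \<Rightarrow> real) \<Rightarrow> real \<Rightarrow> ennreal" where
  "Q_star N H u =
     (if u = 0 then 0
      else (SUP n\<in>{0<..}. \<integral>\<^sup>+s\<in>{0..u}. ennreal (tail_quantile N (H n) s) \<partial>lborel) / ennreal u)"

end

(*
  Fix a lag q and split the centred number of hits S_n - E_n into the sum U of the innovations
  1{B_k} - P(B_k | F_{k-q}) and the sum V of the biases P(B_k | F_{k-q}) - P(B_k).  Innovations at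
  distance at least q are orthogonal, so E(U^2) is at most 2 q E_n.  By stationarity each bias has at most
  the L1 norm that it has at time 0, where the conditional law of X_0 given F_{-q} is within total variation
  distance delta of mu and E(delta) = beta(q).  Splitting the state space according to whether the count
  h = 1{A_1} + ... + 1{A_n} exceeds c gives E|V| <= 2 c beta(q) + 2 int_{h > c} h dmu, for every c >= 0.

  For (i) this is applied to subsets of the A_k, made disjoint inside blocks of indices, whose count is
  bounded by a constant times its mean.  For (ii) uniform integrability controls the second term.  For
  (iii) the threshold is c = E_n Q_{H_n}(beta(q)), which makes E|V| / E_n at most 4 beta(q) Q*(beta(q)).
  The lags are chosen in dyadic blocks so that these bounds are summable, and the almost sure
  convergence along n_i with E_{n_i} close to r^i extends to all n by monotonicity, letting r tend to 1.
*)

theory Submission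
  imports Defs
begin

section \<open>Regular conditional distributions on Polish spaces\<close>

text \<open>The lag \<open>q\<close> balances two errors: the variance bound grows linearly in
  \<open>q\<close>, the bias is governed by beta(q). For (i) and (ii) the lag stays fixed while the
  expected number of hits becomes large; it only has to make beta(q) small. For (iii) it is tied to
  the level: about 2^j where E_n is at least 4^j, so that q / E_n decays like 2^-j.

  The obstacle is the bias. Estimating it index by index would cost n * beta(q). Summing over the
  indices inside the expectation and slicing by the values of the count leaves the factor c in place
  of n. This requires the conditional law of X_0 as one genuine measure for each outcome, good for
  all Borel sets at once, hence a regular version. Its existence is also what gives content to the
  \<open>SOME\<close> in \<open>beta_coeff\<close>. For this reason the proof begins by coding a
  Polish space into the real line, and it needs a countable family of sets that determines the total
  variation distance, since otherwise the supremum over all Borel sets is not visibly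
  measurable.\<close>

lemma dyadic_approx_below:
  fixes r :: real
  assumes "0 < r" "r \<le> 1"
  obtains q :: "nat \<Rightarrow> real" where "incseq q" "\<And>n. q n \<in> \<rat> \<inter> {0..1}" "\<And>n. q n < r"
    "\<And>x. x < r \<Longrightarrow> \<exists>n. x \<le> q n"
proof -
  \<comment> \<open>The largest integer strictly below \<open>r * 2 ^ n\<close>. Strictness keeps
    \<open>q n < r\<close> even for dyadic \<open>r\<close>, and maximality gives
    \<open>2 * a n \<le> a (Suc n)\<close>, hence monotonicity.\<close>
  define a :: "nat \<Rightarrow> int" where "a n = \<lceil>r * 2 ^ n\<rceil> - 1" for n
  define q :: "nat \<Rightarrow> real" where "q n = a n / 2 ^ n" for n
  have a_less: "a n < r * 2 ^ n" and a_ge: "r * 2 ^ n - 1 \<le> a n" for n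
    unfolding a_def by linarith+
  have a0: "0 \<le> a n" for n
  proof -
    have "0 < r * 2 ^ n" using assms by simp
    then show ?thesis unfolding a_def by linarith
  qed
  have less: "q n < r" for n
    using a_less[of n] by (simp add: q_def field_simps)
  show ?thesis
  proof
    show "incseq q"
    proof (rule incseq_SucI)
      fix n
      have "real_of_int (2 * a n) < r * 2 ^ Suc n"
        using a_less[of n] by simp
      then have "2 * a n \<le> a (Suc n)"
        unfolding a_def[of "Suc n"] by linarith
      then have "2 * real_of_int (a n) \<le> real_of_int (a (Suc n))"
        by linarith
      then show "q n \<le> q (Suc n)"
        by (simp add: q_def field_simps)
    qed
    show "q n \<in> \<rat> \<inter> {0..1}" for n
      using a0[of n] less[of n] assms by (auto simp: q_def simp del: divide_le_eq_1_pos)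
    show "\<exists>n. x \<le> q n" if "x < r" for x
    proof -
      have "(\<lambda>n. (1/2::real) ^ n) \<longlonglongrightarrow> 0"
        by (rule LIMSEQ_realpow_zero) auto
      then have "eventually (\<lambda>n. (1/2::real) ^ n < r - x) sequentially"
        using that by (auto intro: order_tendstoD)
      then obtain n where n: "(1/2::real) ^ n < r - x"
        by (auto simp: eventually_sequentially)
      have "r - 1 / 2 ^ n \<le> q n"
        using divide_right_mono[OF a_ge[of n], of "2 ^ n"] by (simp add: q_def diff_divide_distrib)
      then show ?thesis using n by (intro exI[of _ n]) (simp add: power_one_over)
    qed
  qed (fact less)
qed

text \<open>The kernel is the law of the conditional quantile function under the uniform measure.\<close>

lemma (in prob_space) conditional_kernel_unit_interval:
  fixes Y :: "'a \<Rightarrow> real"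
  assumes F: "subalgebra M F" and Y[measurable]: "Y \<in> borel_measurable M"
    and Y01: "\<And>\<omega>. 0 \<le> Y \<omega> \<and> Y \<omega> \<le> 1"
  obtains \<kappa> where "\<kappa> \<in> F \<rightarrow>\<^sub>M prob_algebra borel"
    "\<And>A C. A \<in> sets F \<Longrightarrow> C \<in> sets borel \<Longrightarrow>
       (\<integral>\<^sup>+\<omega>. emeasure (\<kappa> \<omega>) C * indicator A \<omega> \<partial>M) = emeasure M (A \<inter> Y -` C)"
proof -
  interpret finite_measure_subalgebra M F
    by standard (rule F)
  have [simp]: "space F = space M" and sub: "sets F \<subseteq> sets M"
    using F by (auto simp: subalgebra_def)
  define D :: "real set" where "D = \<rat> \<inter> {0..1}"
  define G where "G q = real_cond_exp M F (indicator (Y -` {..q} \<inter> space M))" for q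
  \<comment> \<open>The generalized inverse of the conditional distribution function. The default
    value 1 keeps the infimum in [0,1] for every \<open>\<omega>\<close>, even where
    \<open>G\<close> fails to be monotone, so \<open>\<kappa>\<close> is a kernel everywhere and not
    just off a null set.\<close>
  define f where "f \<omega> u = (INF q\<in>D. if u \<le> G q \<omega> then q else 1)" for \<omega> and u :: real
  define U :: "real measure" where "U = uniform_measure lborel {0..1}"
  define \<kappa> where "\<kappa> \<omega> = distr U borel (f \<omega>)" for \<omega>
  have D: "countable D" "D \<noteq> {}" "\<And>q. q \<in> D \<Longrightarrow> 0 \<le> q \<and> q \<le> 1"
    by (auto simp: D_def countable_rat intro!: exI[of _ 0])
  have [measurable]: "G q \<in> borel_measurable F" for q
    by (simp add: G_def)
  have G_M: "G q \<in> borel_measurable M" for q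
    by (simp add: G_def)
  have prob_U: "prob_space U"
    unfolding U_def by (rule prob_space_uniform_measure) auto
  have [measurable_cong, simp]: "sets U = sets borel" and [simp]: "space U = UNIV"
    by (auto simp: U_def)
  have f_meas: "(\<lambda>(\<omega>, u). f \<omega> u) \<in> borel_measurable (F \<Otimes>\<^sub>M U)"
    unfolding f_def case_prod_beta by (rule borel_measurable_cINF_real) (use D in \<open>auto intro!: measurable_If\<close>)
  have f_less: "f \<omega> u < r \<longleftrightarrow> (\<exists>q\<in>D. (if u \<le> G q \<omega> then q else 1) < r)" for \<omega> u r
  proof -
    have "bdd_below ((\<lambda>q. if u \<le> G q \<omega> then q else 1) ` D)"
      using D(3) by (intro bdd_belowI[of _ 0]) auto
    then show ?thesis unfolding f_def using D(2) by (subst cINF_less_iff) auto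
  qed
  have \<kappa>_meas: "\<kappa> \<in> F \<rightarrow>\<^sub>M prob_algebra borel"
    unfolding \<kappa>_def
    by (rule measurable_distr_prob_space2[OF _ f_meas]) (auto simp: space_prob_algebra prob_U)
  have emeasure_meas: "(\<lambda>\<omega>. emeasure (\<kappa> \<omega>) C) \<in> borel_measurable F" if "C \<in> sets borel" for C
    using measurable_prob_algebraD[OF \<kappa>_meas] that
    by (rule measurable_compose[OF _ measurable_emeasure_subprob_algebra])
  have emeasure_meas_M: "(\<lambda>\<omega>. emeasure (\<kappa> \<omega>) C) \<in> borel_measurable M" if "C \<in> sets borel" for C
    using emeasure_meas[OF that] by (rule measurable_from_subalg[OF F])
  have \<kappa>_prob: "prob_space (\<kappa> \<omega>)" "sets (\<kappa> \<omega>) = sets borel" if "\<omega> \<in> space M" for \<omega>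
    using measurable_space[OF \<kappa>_meas] that by (auto simp: space_prob_algebra)
  have int: "integrable M (indicator (Y -` {..q} \<inter> space M) :: _ \<Rightarrow> real)" for q
    by (auto simp: emeasure_eq_measure intro!: integrable_real_indicator)
  have G_mono: "AE \<omega> in M. G q \<omega> \<le> G q' \<omega>" if "q \<le> q'" for q q'
    unfolding G_def by (rule real_cond_exp_mono) (use that int in \<open>auto simp: indicator_def intro!: AE_I2\<close>)
  have G_0: "AE \<omega> in M. 0 \<le> G q \<omega>" for q
    unfolding G_def by (rule real_cond_exp_pos) auto
  have G_1: "AE \<omega> in M. G q \<omega> \<le> 1" for q
  proof -
    have "AE \<omega> in M. real_cond_exp M F (\<lambda>_. 1) \<omega> = 1"
      by (rule real_cond_exp_F_meas) auto
    moreover have "AE \<omega> in M. G q \<omega> \<le> real_cond_exp M F (\<lambda>_. 1) \<omega>"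
      unfolding G_def by (rule real_cond_exp_mono) (use int in \<open>auto simp: indicator_def intro!: AE_I2\<close>)
    ultimately show ?thesis by eventually_elim simp
  qed
  have good: "AE \<omega> in M. \<forall>q\<in>D. 0 \<le> G q \<omega> \<and> G q \<omega> \<le> 1 \<and> (\<forall>q'\<in>D. q \<le> q' \<longrightarrow> G q \<omega> \<le> G q' \<omega>)"
    using D G_mono G_0 G_1 by (auto simp: AE_ball_countable)
  \<comment> \<open>Open half lines are tested because a strict bound on an infimum is an
    existential statement: \<open>f \<omega> u < r\<close> asks for one index of \<open>D\<close>,
    which turns the event into an increasing countable union.\<close>
  have base: "(\<integral>\<^sup>+\<omega>. emeasure (\<kappa> \<omega>) {..<r} * indicator A \<omega> \<partial>M) = emeasure M (A \<inter> Y -` {..<r})"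
    if A: "A \<in> sets F" for A r
  proof -
    have A'[measurable]: "A \<in> sets M" using A sub by auto
    have AM: "A \<subseteq> space M" using sets.sets_into_space[OF A'] .
    have \<kappa>_eq: "emeasure (\<kappa> \<omega>) {..<r} = emeasure U {u. f \<omega> u < r}" if "\<omega> \<in> space M" for \<omega>
    proof -
      have [measurable]: "f \<omega> \<in> borel_measurable borel"
        using measurable_Pair2[OF f_meas, of \<omega>] that by simp
      show ?thesis unfolding \<kappa>_def by (subst emeasure_distr) (auto simp: vimage_def)
    qed
    consider "r \<le> 0" | "1 < r" | "0 < r" "r \<le> 1" by linarith
    then show ?thesis
    proof cases
      case 1
      have "emeasure (\<kappa> \<omega>) {..<r} = 0" if "\<omega> \<in> space M" for \<omega>
      proof -
        have "{u. f \<omega> u < r} = {}" using 1 D(3) by (auto simp: f_less split: if_splits) (smt (verit))+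
        then show ?thesis using \<kappa>_eq[OF that] by simp
      qed
      moreover have "Y -` {..<r} = {}" using 1 Y01 by (auto simp: not_less) (meson dual_order.trans not_less)
      ultimately show ?thesis by (simp cong: nn_integral_cong_simp)
    next
      case 2
      have "emeasure (\<kappa> \<omega>) {..<r} = 1" if "\<omega> \<in> space M" for \<omega>
      proof -
        obtain q where "q \<in> D" using D(2) by auto
        then have "{u. f \<omega> u < r} = space U" using 2 D(3)[of q] by (auto simp: f_less intro!: bexI[of _ q])
        then show ?thesis using \<kappa>_eq[OF that] prob_space.emeasure_space_1[OF prob_U] by simp
      qed
      moreover have "Y -` {..<r} = UNIV" using 2 Y01 by (auto) (meson le_less_trans)
      ultimately show ?thesis by (simp cong: nn_integral_cong_simp)
    next
      case 3
      obtain q where q: "incseq q" "\<And>n. q n \<in> D" "\<And>n. q n < r" "\<And>x. x < r \<Longrightarrow> \<exists>n. x \<le> q n"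
        using dyadic_approx_below[OF 3] unfolding D_def by metis
      have "AE \<omega> in M. emeasure (\<kappa> \<omega>) {..<r} * indicator A \<omega> = (SUP n. ennreal (G (q n) \<omega>) * indicator A \<omega>)"
        using good AE_space
      proof eventually_elim
        case (elim \<omega>)
        \<comment> \<open>Since \<open>r \<le> 1\<close>, the default value 1 cannot witness
          \<open>f \<omega> u < r\<close>. A genuine witness \<open>p < r\<close> may be raised to
          some \<open>q n\<close> because \<open>G\<close> is monotone on \<open>D\<close> at this
          \<open>\<omega>\<close>.\<close>
        have "{0..1} \<inter> {u. f \<omega> u < r} = (\<Union>n. {0..G (q n) \<omega>})"
        proof (intro set_eqI iffI)
          fix u assume u: "u \<in> {0..1} \<inter> {u. f \<omega> u < r}"
          then obtain p where p: "p \<in> D" "(if u \<le> G p \<omega> then p else 1) < r"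
            by (auto simp: f_less)
          then have "u \<le> G p \<omega>" "p < r" using 3 by (auto split: if_splits)
          moreover obtain n where "p \<le> q n" using q(4)[OF \<open>p < r\<close>] by auto
          ultimately have "u \<le> G (q n) \<omega>" using elim(1) p(1) q(2) by (meson order_trans)
          then show "u \<in> (\<Union>n. {0..G (q n) \<omega>})" using u by auto
        next
          fix u assume "u \<in> (\<Union>n. {0..G (q n) \<omega>})"
          then obtain n where "0 \<le> u" "u \<le> G (q n) \<omega>" by auto
          moreover have "G (q n) \<omega> \<le> 1" using elim(1) q(2) by auto
          ultimately show "u \<in> {0..1} \<inter> {u. f \<omega> u < r}"
            using q(2,3) by (auto simp: f_less intro!: bexI[of _ "q n"])
        qed
        then have "emeasure (\<kappa> \<omega>) {..<r} = emeasure lborel (\<Union>n. {0..G (q n) \<omega>})"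
        proof -
          have [measurable]: "f \<omega> \<in> borel_measurable borel"
            using measurable_Pair2[OF f_meas, of \<omega>] elim(2) by simp
          have [measurable]: "{u. f \<omega> u < r} \<in> sets borel" by measurable
          assume "{0..1} \<inter> {u. f \<omega> u < r} = (\<Union>n. {0..G (q n) \<omega>})"
          then show ?thesis unfolding \<kappa>_eq[OF elim(2)] U_def
            by (subst emeasure_uniform_measure) (auto simp: divide_ennreal_def)
        qed
        also have "\<dots> = (SUP n. emeasure lborel {0..G (q n) \<omega>})"
        proof (rule SUP_emeasure_incseq[symmetric])
          show "incseq (\<lambda>n. {0..G (q n) \<omega>})"
            using q(1,2) elim(1) by (fastforce simp: incseq_def)
        qed auto
        also have "\<dots> = (SUP n. ennreal (G (q n) \<omega>))"
          using elim(1) q(2) by auto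
        finally show ?case by (simp add: SUP_mult_right_ennreal)
      qed
      then have "(\<integral>\<^sup>+\<omega>. emeasure (\<kappa> \<omega>) {..<r} * indicator A \<omega> \<partial>M)
          = (\<integral>\<^sup>+\<omega>. (SUP n. ennreal (G (q n) \<omega>) * indicator A \<omega>) \<partial>M)"
        by (rule nn_integral_cong_AE)
      also have "\<dots> = (SUP n. \<integral>\<^sup>+\<omega>. ennreal (G (q n) \<omega>) * indicator A \<omega> \<partial>M)"
      proof (rule nn_integral_monotone_convergence_SUP_AE)
        show "AE x in M. ennreal (G (q i) x) * indicator A x \<le> ennreal (G (q (Suc i)) x) * indicator A x" for i
          using G_mono[OF incseq_SucD[OF q(1), of i]]
          by eventually_elim (auto intro!: mult_right_mono ennreal_leI)
        show "(\<lambda>\<omega>. ennreal (G (q i) \<omega>) * indicator A \<omega>) \<in> borel_measurable M" for i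
          by (intro borel_measurable_times_ennreal measurable_compose[OF G_M measurable_ennreal]
              borel_measurable_indicator A')
      qed
      also have "\<dots> = (SUP n. emeasure M (A \<inter> Y -` {..q n}))"
      proof (rule SUP_cong[OF refl])
        fix n
        have intG: "integrable M (\<lambda>\<omega>. G (q n) \<omega> * indicator A \<omega>)"
          using integrable_mult_indicator[OF A' real_cond_exp_int(1)[OF int]] by (simp add: G_def mult.commute)
        have "(\<integral>\<^sup>+\<omega>. ennreal (G (q n) \<omega>) * indicator A \<omega> \<partial>M) = (\<integral>\<^sup>+\<omega>. ennreal (G (q n) \<omega> * indicator A \<omega>) \<partial>M)"
          by (intro nn_integral_cong) (auto split: split_indicator)
        also have "\<dots> = ennreal (\<integral>\<omega>. G (q n) \<omega> * indicator A \<omega> \<partial>M)"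
          using G_0[of "q n"] by (intro nn_integral_eq_integral intG) (auto split: split_indicator)
        also have "(\<integral>\<omega>. G (q n) \<omega> * indicator A \<omega> \<partial>M) = (\<integral>\<omega>. indicator (Y -` {..q n} \<inter> space M) \<omega> * indicator A \<omega> \<partial>M)"
          using real_cond_exp_intA[OF int A] by (simp add: set_lebesgue_integral_def G_def mult.commute)
        also have "\<dots> = measure M (A \<inter> Y -` {..q n})"
          using AM by (subst indicator_inter_arith[symmetric]) (auto simp: Int_ac intro!: arg_cong[where f="measure M"])
        finally show "(\<integral>\<^sup>+\<omega>. ennreal (G (q n) \<omega>) * indicator A \<omega> \<partial>M) = emeasure M (A \<inter> Y -` {..q n})"
          by (simp add: emeasure_eq_measure)
      qed
      also have "\<dots> = emeasure M (\<Union>n. A \<inter> Y -` {..q n})"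
      proof (rule SUP_emeasure_incseq)
        have "A \<inter> Y -` {..q n} = A \<inter> (Y -` {..q n} \<inter> space M)" for n
          using AM by auto
        then show "range (\<lambda>n. A \<inter> Y -` {..q n}) \<subseteq> sets M" by auto
        show "incseq (\<lambda>n. A \<inter> Y -` {..q n})"
          using q(1) by (fastforce simp: incseq_def)
      qed
      also have "(\<Union>n. A \<inter> Y -` {..q n}) = A \<inter> Y -` {..<r}"
        using q(3,4) by (auto intro: le_less_trans)
      finally show ?thesis .
    qed
  qed
  have "(\<integral>\<^sup>+\<omega>. emeasure (\<kappa> \<omega>) C * indicator A \<omega> \<partial>M) = emeasure M (A \<inter> Y -` C)"
    if A: "A \<in> sets F" and C: "C \<in> sets borel" for A C
  proof -
    have A'[measurable]: "A \<in> sets M" using A sub by auto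
    have AM: "A \<subseteq> space M" using sets.sets_into_space[OF A'] .
    have AY: "A \<inter> Y -` C \<in> sets M" if "C \<in> sets borel" for C
    proof -
      have "A \<inter> Y -` C = A \<inter> (Y -` C \<inter> space M)" using AM by auto
      then show ?thesis using that by auto
    qed
    have bor: "sigma_sets UNIV (range (\<lambda>a::real. {..<a})) = sets borel"
      by (subst borel_eq_lessThan) (simp add: eucl_lessThan lessThan_def)
    have C': "C \<in> sigma_sets UNIV (range (\<lambda>a::real. {..<a}))" using C bor by simp
    show ?thesis
    \<comment> \<open>Both sides are finite measures in \<open>C\<close>, so agreement on the
      intersection-stable half lines suffices. For complements the finite value at \<open>B\<close>
      is added to both sides and cancelled.\<close>
    proof (rule sigma_sets_induct_disjoint[OF _ _ C'])
      show "Int_stable (range (\<lambda>a::real. {..<a}))"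
      proof (rule Int_stableI, clarify)
        fix a b :: real
        have "{..<a} \<inter> {..<b} = {..<min a b}" by auto
        then show "{..<a} \<inter> {..<b} \<in> range lessThan" by simp
      qed
      fix B assume "B \<in> range (\<lambda>a::real. {..<a})"
      then show "(\<integral>\<^sup>+\<omega>. emeasure (\<kappa> \<omega>) B * indicator A \<omega> \<partial>M) = emeasure M (A \<inter> Y -` B)"
        using base[OF A] by auto
    next
      fix B assume B: "B \<in> sigma_sets UNIV (range (\<lambda>a::real. {..<a}))"
        and IH: "(\<integral>\<^sup>+\<omega>. emeasure (\<kappa> \<omega>) B * indicator A \<omega> \<partial>M) = emeasure M (A \<inter> Y -` B)"
      have B': "B \<in> sets borel" using B bor by simp
      note [measurable] = emeasure_meas_M[OF B'] emeasure_meas_M[of "UNIV - B"]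
      have "(\<integral>\<^sup>+\<omega>. emeasure (\<kappa> \<omega>) (UNIV - B) * indicator A \<omega> \<partial>M) + emeasure M (A \<inter> Y -` B)
          = (\<integral>\<^sup>+\<omega>. emeasure (\<kappa> \<omega>) (UNIV - B) * indicator A \<omega> + emeasure (\<kappa> \<omega>) B * indicator A \<omega> \<partial>M)"
        using B' by (subst nn_integral_add) (auto simp: IH)
      also have "\<dots> = (\<integral>\<^sup>+\<omega>. indicator A \<omega> \<partial>M)"
      proof (rule nn_integral_cong)
        fix \<omega> assume \<omega>: "\<omega> \<in> space M"
        interpret K: prob_space "\<kappa> \<omega>" by (rule \<kappa>_prob[OF \<omega>])
        have "space (\<kappa> \<omega>) = UNIV" using sets_eq_imp_space_eq[OF \<kappa>_prob(2)[OF \<omega>]] by simp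
        moreover have "emeasure (\<kappa> \<omega>) ((UNIV - B) \<union> B) = emeasure (\<kappa> \<omega>) (UNIV - B) + emeasure (\<kappa> \<omega>) B"
          using B' \<kappa>_prob(2)[OF \<omega>] by (intro plus_emeasure[symmetric]) auto
        ultimately have "emeasure (\<kappa> \<omega>) (UNIV - B) + emeasure (\<kappa> \<omega>) B = 1"
          using K.emeasure_space_1 by (simp add: Un_commute)
        then show "emeasure (\<kappa> \<omega>) (UNIV - B) * indicator A \<omega> + emeasure (\<kappa> \<omega>) B * indicator A \<omega> = indicator A \<omega>"
          by (auto split: split_indicator)
      qed
      also have "\<dots> = emeasure M (A \<inter> Y -` (UNIV - B)) + emeasure M (A \<inter> Y -` B)"
        using B' AY[OF B'] AY[of "UNIV - B"] by (subst plus_emeasure) (auto intro!: arg_cong[where f="emeasure M"])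
      finally show "(\<integral>\<^sup>+\<omega>. emeasure (\<kappa> \<omega>) (UNIV - B) * indicator A \<omega> \<partial>M) = emeasure M (A \<inter> Y -` (UNIV - B))"
        by (simp add: emeasure_eq_measure)
    next
      fix B :: "nat \<Rightarrow> real set" assume B: "disjoint_family B" "range B \<subseteq> sigma_sets UNIV (range (\<lambda>a::real. {..<a}))"
        and IH: "\<And>i. (\<integral>\<^sup>+\<omega>. emeasure (\<kappa> \<omega>) (B i) * indicator A \<omega> \<partial>M) = emeasure M (A \<inter> Y -` B i)"
      have B': "B i \<in> sets borel" for i using B bor by auto
      note [measurable] = emeasure_meas_M[OF B']
      have "(\<integral>\<^sup>+\<omega>. emeasure (\<kappa> \<omega>) (\<Union>i. B i) * indicator A \<omega> \<partial>M)
          = (\<integral>\<^sup>+\<omega>. (\<Sum>i. emeasure (\<kappa> \<omega>) (B i) * indicator A \<omega>) \<partial>M)"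
      proof (rule nn_integral_cong)
        fix \<omega> assume \<omega>: "\<omega> \<in> space M"
        have "emeasure (\<kappa> \<omega>) (\<Union>i. B i) = (\<Sum>i. emeasure (\<kappa> \<omega>) (B i))"
          using B' B(1) \<kappa>_prob(2)[OF \<omega>] by (intro suminf_emeasure[symmetric]) auto
        then show "emeasure (\<kappa> \<omega>) (\<Union>i. B i) * indicator A \<omega> = (\<Sum>i. emeasure (\<kappa> \<omega>) (B i) * indicator A \<omega>)"
          by simp
      qed
      also have "\<dots> = (\<Sum>i. emeasure M (A \<inter> Y -` B i))"
        by (subst nn_integral_suminf) (auto simp: IH)
      also have "\<dots> = emeasure M (\<Union>i. A \<inter> Y -` B i)"
      proof (rule suminf_emeasure)
        show "disjoint_family (\<lambda>i. A \<inter> Y -` B i)"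
          using B(1) unfolding disjoint_family_on_def by blast
      qed (use AY B' in auto)
      also have "(\<Union>i. A \<inter> Y -` B i) = A \<inter> Y -` (\<Union>i. B i)" by auto
      finally show "(\<integral>\<^sup>+\<omega>. emeasure (\<kappa> \<omega>) (\<Union>i. B i) * indicator A \<omega> \<partial>M) = emeasure M (A \<inter> Y -` (\<Union>i. B i))" .
    qed auto
  qed
  with \<kappa>_meas show ?thesis by (rule that)
qed

section \<open>Bit sequences as base 4 expansions\<close>

lemma base4_series_bounds:
  fixes b :: "nat \<Rightarrow> bool"
  shows "summable (\<lambda>j. of_bool (b j) / 4 ^ Suc j :: real)"
    and "0 \<le> (\<Sum>j. of_bool (b j) / 4 ^ Suc j :: real)"
    and "(\<Sum>j. of_bool (b j) / 4 ^ Suc j :: real) < 1"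
proof -
  \<comment> \<open>All digits equal to 1 give the total 1/3, so tails stay strictly below 1 and
    never produce a carry; in base 2 they could reach 1.\<close>
  have geo: "(\<lambda>j. (1/4) * (1/4::real) ^ j) sums ((1/4) * (1 / (1 - 1/4)))"
    by (intro sums_mult geometric_sums) simp
  have le: "of_bool (b j) / 4 ^ Suc j \<le> (1/4) * (1/4::real) ^ j" for j
    by (simp add: power_one_over field_simps)
  show summ: "summable (\<lambda>j. of_bool (b j) / 4 ^ Suc j :: real)"
    using le by (intro summable_comparison_test'[OF sums_summable[OF geo]]) (simp add: power_one_over field_simps)
  show "0 \<le> (\<Sum>j. of_bool (b j) / 4 ^ Suc j :: real)"
    by (intro suminf_nonneg summ) simp
  have "(\<Sum>j. of_bool (b j) / 4 ^ Suc j :: real) \<le> (\<Sum>j. (1/4) * (1/4::real) ^ j)"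
    by (intro suminf_le le summ sums_summable[OF geo])
  also have "\<dots> < 1" using sums_unique[OF geo] by simp
  finally show "(\<Sum>j. of_bool (b j) / 4 ^ Suc j :: real) < 1" .
qed

text \<open>Multiplication by 4 moves the leading bit in front of the point and leaves a remainder
  of the same kind in [0,1). In the induction step the leading bit contributes a multiple of
  \<open>4 ^ Suc k\<close>, which is even and does not affect the parity.\<close>

lemma base4_digit:
  fixes b :: "nat \<Rightarrow> bool"
  shows "odd \<lfloor>4 ^ Suc k * (\<Sum>j. of_bool (b j) / 4 ^ Suc j :: real)\<rfloor> \<longleftrightarrow> b k"
proof (induction k arbitrary: b)
  define y :: "(nat \<Rightarrow> bool) \<Rightarrow> real" where "y b = (\<Sum>j. of_bool (b j) / 4 ^ Suc j)" for b
  have shift: "4 * y b = of_bool (b 0) + y (\<lambda>j. b (Suc j))" for b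
  proof -
    have "y b = of_bool (b 0) / 4 + (\<Sum>j. of_bool (b (Suc j)) / 4 ^ Suc (Suc j))"
      unfolding y_def using suminf_split_head[OF base4_series_bounds(1)[of b]] by simp
    also have "(\<Sum>j. of_bool (b (Suc j)) / 4 ^ Suc (Suc j)) = (\<Sum>j. (1/4) * (of_bool (b (Suc j)) / 4 ^ Suc j :: real))"
      by simp
    also have "\<dots> = (1/4) * y (\<lambda>j. b (Suc j))"
      unfolding y_def by (rule suminf_mult[OF base4_series_bounds(1)])
    finally show ?thesis by simp
  qed
  {
    case 0
    have "\<lfloor>4 * y b\<rfloor> = of_bool (b 0)"
      using base4_series_bounds(2,3)[of "\<lambda>j. b (Suc j)"]
      unfolding shift y_def[symmetric] by (intro floor_unique) auto
    then show ?case by (simp add: y_def)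
  next
    case (Suc k)
    have "4 ^ Suc (Suc k) * y b = 4 ^ Suc k * (4 * y b)" by simp
    also have "\<dots> = of_int (of_bool (b 0) * 4 ^ Suc k) + 4 ^ Suc k * y (\<lambda>j. b (Suc j))"
      unfolding shift by (simp add: algebra_simps)
    also have "\<lfloor>\<dots>\<rfloor> = of_bool (b 0) * 4 ^ Suc k + \<lfloor>4 ^ Suc k * y (\<lambda>j. b (Suc j))\<rfloor>"
      by (rule floor_add_int[symmetric, unfolded add.commute[of "floor _"] add.commute[of _ "of_int _"]])
    finally have "odd \<lfloor>4 ^ Suc (Suc k) * y b\<rfloor> \<longleftrightarrow> odd \<lfloor>4 ^ Suc k * y (\<lambda>j. b (Suc j))\<rfloor>"
      by simp
    then show ?case using Suc[of "\<lambda>j. b (Suc j)"] by (simp add: y_def)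
  }
qed

text \<open>
  A point is encoded by the bits telling which balls of radius \<open>1 / 2 ^ n\<close> around a dense sequence
  contain it; in base 4 with digits 0 and 1 the bits can be read off by the floor function.
\<close>

lemma polish_space_real_retract:
  obtains t :: "'e::polish_space \<Rightarrow> real" and g :: "real \<Rightarrow> 'e"
  where "t \<in> borel_measurable borel" "g \<in> borel_measurable borel"
    "\<And>x. 0 \<le> t x \<and> t x \<le> 1" "\<And>x. g (t x) = x"
proof -
  obtain D :: "'e set" where D: "countable D" "\<And>X. open X \<Longrightarrow> X \<noteq> {} \<Longrightarrow> \<exists>d\<in>D. d \<in> X"
    by (erule countable_dense_setE)
  have "D \<noteq> {}" using D(2)[of UNIV] by auto
  define s where "s = from_nat_into D"
  have dense: "\<exists>i. dist x (s i) < e" if "0 < e" for x e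
  proof -
    obtain d where "d \<in> D" "d \<in> ball x e" using D(2)[of "ball x e"] \<open>0 < e\<close> by auto
    moreover obtain i where "s i = d"
      using from_nat_into_surj[OF D(1) \<open>d \<in> D\<close>] by (auto simp: s_def)
    ultimately show ?thesis by auto
  qed
  define b where "b k x \<longleftrightarrow> (case prod_decode k of (i, n) \<Rightarrow> dist x (s i) < 1 / 2 ^ n)" for k x
  define t where "t x = (\<Sum>k. of_bool (b k x) / 4 ^ Suc k :: real)" for x
  \<comment> \<open>Decoding: for \<open>y = t x\<close> this is the first point of the dense
    sequence within \<open>1 / 2 ^ n\<close> of \<open>x\<close>, so it converges to
    \<open>x\<close>.\<close>
  define z where "z n y = s (LEAST i. odd \<lfloor>4 ^ Suc (prod_encode (i, n)) * y\<rfloor>)" for n and y :: real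
  \<comment> \<open>For a real number that codes no point, \<open>z\<close> need not converge.
    Replacing it there by a constant sequence makes the limit exist everywhere, so \<open>g\<close>
    is a pointwise limit of measurable maps.\<close>
  define w where "w n y = (if Cauchy (\<lambda>n. z n y) then z n y else s 0)" for n y
  define g where "g y = lim (\<lambda>n. w n y)" for y
  have z_meas[measurable]: "z n \<in> borel_measurable borel" for n
    unfolding z_def by measurable
  have w_meas: "w n \<in> borel_measurable borel" for n
    unfolding w_def by measurable
  have w_conv: "convergent (\<lambda>n. w n y)" for y
    by (cases "Cauchy (\<lambda>n. z n y)") (simp_all add: w_def Cauchy_convergent convergent_const)
  show ?thesis
  proof
    show "t \<in> borel_measurable borel"
      unfolding t_def b_def case_prod_beta by measurable
    show "g \<in> borel_measurable borel"
      using w_meas w_conv[unfolded convergent_LIMSEQ_iff] unfolding g_def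
      by (rule borel_measurable_LIMSEQ_metric)
    show "0 \<le> t x \<and> t x \<le> 1" for x
      using base4_series_bounds(2,3)[of "\<lambda>k. b k x"] by (simp add: t_def)
    show "g (t x) = x" for x
    proof -
      have bit: "odd \<lfloor>4 ^ Suc (prod_encode (i, n)) * t x\<rfloor> \<longleftrightarrow> dist x (s i) < 1 / 2 ^ n" for i n
        unfolding t_def base4_digit b_def by simp
      have "dist x (z n (t x)) < 1 / 2 ^ n" for n
        unfolding z_def bit by (rule LeastI_ex, rule dense) simp
      then have *: "norm (dist (z n (t x)) x) \<le> (1 / 2) ^ n" for n
        by (simp add: dist_commute power_one_over less_imp_le)
      have "(\<lambda>n. z n (t x)) \<longlonglongrightarrow> x"
        unfolding tendsto_dist_iff[of _ x]
        by (rule Lim_null_comparison[OF always_eventually[OF allI[OF *]] LIMSEQ_realpow_zero]) auto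
      then show ?thesis
        by (simp add: g_def w_def LIMSEQ_imp_Cauchy limI)
    qed
  qed
qed

text \<open>The kernel of the real variable \<open>t (Y \<omega>)\<close> is pushed forward by the
  left inverse \<open>g\<close>; as \<open>g (t (Y \<omega>)) = Y \<omega>\<close>, the event that
  \<open>t (Y \<omega>)\<close> lies in \<open>g -\<close> C\<open>is\<close>Y -\<open>C\<close>.
  Since \<open>g\<close> is total, it does not matter whether the kernel charges points outside the
  range of \<open>t\<close>.\<close>

lemma (in prob_space) regular_cond_distr_exists:
  fixes Y :: "'a \<Rightarrow> 'e::polish_space"
  assumes F: "subalgebra M F" and Y[measurable]: "Y \<in> borel_measurable M"
  shows "\<exists>\<kappa>. regular_cond_distr M F borel Y \<kappa>"
proof -
  interpret finite_measure_subalgebra M F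
    by standard (rule F)
  obtain t :: "'e \<Rightarrow> real" and g where [measurable]: "t \<in> borel_measurable borel" "g \<in> borel_measurable borel"
    and t01: "\<And>x. 0 \<le> t x \<and> t x \<le> 1" and gt: "\<And>x. g (t x) = x"
    by (erule polish_space_real_retract)
  obtain \<kappa> where \<kappa>: "\<kappa> \<in> F \<rightarrow>\<^sub>M prob_algebra borel"
    "\<And>A C. A \<in> sets F \<Longrightarrow> C \<in> sets borel \<Longrightarrow>
       (\<integral>\<^sup>+\<omega>. emeasure (\<kappa> \<omega>) C * indicator A \<omega> \<partial>M) = emeasure M (A \<inter> (\<lambda>\<omega>. t (Y \<omega>)) -` C)"
    by (rule conditional_kernel_unit_interval[OF F, of "\<lambda>\<omega>. t (Y \<omega>)"]) (use t01 in auto)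
  define \<kappa>' where "\<kappa>' \<omega> = distr (\<kappa> \<omega>) borel g" for \<omega>
  have \<kappa>': "\<kappa>' \<in> F \<rightarrow>\<^sub>M prob_algebra borel"
    unfolding \<kappa>'_def by (rule measurable_compose[OF \<kappa>(1) measurable_distr_prob_space]) simp
  have \<kappa>_prob: "prob_space (\<kappa> \<omega>)" "sets (\<kappa> \<omega>) = sets borel" if "\<omega> \<in> space M" for \<omega>
    using measurable_space[OF \<kappa>(1)] that F by (auto simp: space_prob_algebra subalgebra_def)
  have "AE \<omega> in M. measure (\<kappa>' \<omega>) C = real_cond_exp M F (indicator (Y -` C \<inter> space M)) \<omega>"
    if C[measurable]: "C \<in> sets borel" for C
  proof (rule AE_symmetric, rule real_cond_exp_charact)
    have mF: "(\<lambda>\<omega>. measure (\<kappa>' \<omega>) C) \<in> borel_measurable F"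
      by (rule measurable_compose[OF \<kappa>' measurable_measure_prob_algebra[OF C]])
    then show "(\<lambda>\<omega>. measure (\<kappa>' \<omega>) C) \<in> borel_measurable F" .
    have mM: "(\<lambda>\<omega>. measure (\<kappa>' \<omega>) C) \<in> borel_measurable M"
      using mF by (rule measurable_from_subalg[OF F])
    show "integrable M (indicator (Y -` C \<inter> space M) :: _ \<Rightarrow> real)"
      by (auto simp: emeasure_eq_measure intro!: integrable_real_indicator)
    have "measure (\<kappa>' \<omega>) C \<le> 1" if "\<omega> \<in> space M" for \<omega>
    proof -
      have "prob_space (\<kappa>' \<omega>)"
        using measurable_space[OF \<kappa>'] that F by (auto simp: space_prob_algebra subalgebra_def)
      then show ?thesis by (rule prob_space.prob_le_1)
    qed
    then show int: "integrable M (\<lambda>\<omega>. measure (\<kappa>' \<omega>) C)"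
      by (intro integrable_const_bound[of _ 1] mM) auto
    fix A assume A: "A \<in> sets F"
    then have A'[measurable]: "A \<in> sets M" using F by (auto simp: subalgebra_def)
    have AM: "A \<subseteq> space M" by (rule sets.sets_into_space[OF A'])
    have vim: "g -` C \<in> sets borel" using measurable_sets[of g borel borel C] by simp
    have int': "integrable M (\<lambda>\<omega>. measure (\<kappa>' \<omega>) C * indicator A \<omega>)"
      using integrable_mult_indicator[OF A' int] by (simp add: mult.commute)
    have "ennreal (\<integral>\<omega>. measure (\<kappa>' \<omega>) C * indicator A \<omega> \<partial>M) = (\<integral>\<^sup>+\<omega>. ennreal (measure (\<kappa>' \<omega>) C * indicator A \<omega>) \<partial>M)"
      by (intro nn_integral_eq_integral[symmetric] int') auto
    also have "\<dots> = (\<integral>\<^sup>+\<omega>. emeasure (\<kappa> \<omega>) (g -` C) * indicator A \<omega> \<partial>M)"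
    proof (rule nn_integral_cong)
      fix \<omega> assume \<omega>: "\<omega> \<in> space M"
      interpret K: prob_space "\<kappa> \<omega>" by (rule \<kappa>_prob[OF \<omega>])
      have sp: "space (\<kappa> \<omega>) = UNIV" using sets_eq_imp_space_eq[OF \<kappa>_prob(2)[OF \<omega>]] by simp
      have "g \<in> measurable (\<kappa> \<omega>) borel"
        by (subst measurable_cong_sets[OF \<kappa>_prob(2)[OF \<omega>] refl]) simp
      then have "measure (\<kappa>' \<omega>) C = measure (\<kappa> \<omega>) (g -` C)"
        unfolding \<kappa>'_def by (subst measure_distr) (auto simp: sp)
      then show "ennreal (measure (\<kappa>' \<omega>) C * indicator A \<omega>) = emeasure (\<kappa> \<omega>) (g -` C) * indicator A \<omega>"
        by (auto simp: K.emeasure_eq_measure split: split_indicator)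
    qed
    also have "\<dots> = ennreal (measure M (A \<inter> Y -` C))"
      unfolding \<kappa>(2)[OF A vim] by (simp add: emeasure_eq_measure vimage_def gt)
    finally have "(\<integral>\<omega>. measure (\<kappa>' \<omega>) C * indicator A \<omega> \<partial>M) = measure M (A \<inter> Y -` C)"
      by (subst (asm) ennreal_inj) (auto intro!: integral_nonneg_AE)
    moreover have "(\<integral>\<omega>. indicator A \<omega> * indicator (Y -` C \<inter> space M) \<omega> \<partial>M) = measure M (A \<inter> Y -` C)"
      using AM by (subst indicator_inter_arith[symmetric]) (auto simp: Int_ac intro!: arg_cong[where f="measure M"])
    ultimately show "(LINT x:A|M. indicator (Y -` C \<inter> space M) x) = (LINT x:A|M. measure (\<kappa>' x) C)"
      by (simp add: set_lebesgue_integral_def mult.commute)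
  qed
  with \<kappa>' show ?thesis unfolding regular_cond_distr_def by blast
qed

section \<open>Total variation distance and counting sums\<close>

lemma outer_regular_open:
  fixes \<nu> :: "'e::polish_space measure"
  assumes "finite_measure \<nu>" "sets \<nu> = sets borel" "C \<in> sets borel" "0 < e"
  obtains U where "open U" "C \<subseteq> U" "measure \<nu> U < measure \<nu> C + e"
proof -
  interpret finite_measure \<nu> by fact
  have "(INF U \<in> {U. C \<subseteq> U \<and> open U}. emeasure \<nu> U) = emeasure \<nu> C"
    using assms by (intro outer_regular[symmetric]) auto
  also have "\<dots> < ennreal (measure \<nu> C + e)"
    using assms(4) by (simp add: emeasure_eq_measure ennreal_less_iff)
  finally obtain U where "C \<subseteq> U" "open U" "emeasure \<nu> U < ennreal (measure \<nu> C + e)"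
    unfolding INF_less_iff by auto
  then show ?thesis using that by (auto simp: emeasure_eq_measure ennreal_less_iff)
qed

text \<open>The family consists of the finite unions of sets of a countable basis. Outer regularity
  replaces \<open>C\<close> by an open set, and an open set is an increasing union of members of the
  family, along which both measures converge.\<close>

lemma countable_tv_determining_family:
  obtains \<C> :: "'e::polish_space set set"
  where "countable \<C>" "\<C> \<subseteq> sets borel" "\<C> \<noteq> {}"
    "\<And>(\<kappa> :: 'e measure) \<mu> C e. prob_space \<kappa> \<Longrightarrow> sets \<kappa> = sets borel \<Longrightarrow> prob_space \<mu> \<Longrightarrow> sets \<mu> = sets borel \<Longrightarrow>
      C \<in> sets borel \<Longrightarrow> 0 < e \<Longrightarrow>
      \<exists>U\<in>\<C>. \<bar>measure \<kappa> C - measure \<mu> C\<bar> < \<bar>measure \<kappa> U - measure \<mu> U\<bar> + e"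
proof -
  obtain B :: "'e set set" where B: "countable B" "topological_basis B"
    using ex_countable_basis by blast
  define \<C> where "\<C> = \<Union> ` {F. finite F \<and> F \<subseteq> B}"
  have B_open: "open b" if "b \<in> B" for b
    using B(2) that by (rule topological_basis_open)
  show ?thesis
  proof
    show "countable \<C>"
      unfolding \<C>_def by (intro countable_image countable_Collect_finite_subset B(1))
    show "\<C> \<subseteq> sets borel" "\<C> \<noteq> {}"
      unfolding \<C>_def using B_open by (auto intro!: borel_open open_Union)
    fix \<kappa> \<mu> :: "'e measure" and C :: "'e set" and e :: real
    assume \<kappa>: "prob_space \<kappa>" "sets \<kappa> = sets borel" and \<mu>: "prob_space \<mu>" "sets \<mu> = sets borel"
      and C: "C \<in> sets borel" and e: "0 < e"
    interpret K: prob_space \<kappa> by fact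
    interpret N: prob_space \<mu> by fact
    have e2: "0 < e / 2" using e by simp
    obtain U1 where U1: "open U1" "C \<subseteq> U1" "measure \<kappa> U1 < measure \<kappa> C + e / 2"
      using outer_regular_open[OF K.finite_measure_axioms \<kappa>(2) C e2] .
    obtain U2 where U2: "open U2" "C \<subseteq> U2" "measure \<mu> U2 < measure \<mu> C + e / 2"
      using outer_regular_open[OF N.finite_measure_axioms \<mu>(2) C e2] .
    \<comment> \<open>The intersection approximates \<open>C\<close> within \<open>e / 2\<close> for
      both measures at once; the other \<open>e / 2\<close> pays for the finite union.\<close>
    define U where "U = U1 \<inter> U2"
    have U: "open U" "C \<subseteq> U" using U1 U2 by (auto simp: U_def)
    have "measure \<kappa> U \<le> measure \<kappa> U1" "measure \<mu> U \<le> measure \<mu> U2"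
      using U1(1) U2(1) \<kappa>(2) \<mu>(2) by (auto simp: U_def intro!: K.finite_measure_mono N.finite_measure_mono borel_open)
    moreover have "measure \<kappa> C \<le> measure \<kappa> U" "measure \<mu> C \<le> measure \<mu> U"
      using U \<kappa>(2) \<mu>(2) by (auto intro!: K.finite_measure_mono N.finite_measure_mono borel_open)
    ultimately have CU: "\<bar>measure \<kappa> C - measure \<mu> C\<bar> < \<bar>measure \<kappa> U - measure \<mu> U\<bar> + e / 2"
      using U1(3) U2(3) by linarith
    obtain B' where B': "B' \<subseteq> B" "\<Union>B' = U"
      using B(2) U(1) unfolding topological_basis_def by blast
    \<comment> \<open>The empty set is inserted so that there is something to enumerate even if
      \<open>B'\<close> is empty; the finite unions drop it again because it may not belong to
      \<open>B\<close>.\<close>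
    have "countable (insert {} B')" using B(1) B'(1) countable_subset by auto
    then obtain b :: "nat \<Rightarrow> 'e set" where b: "range b = insert {} B'"
      using range_from_nat_into[of "insert {} B'"] by (metis insert_not_empty)
    define V where "V n = \<Union>(b ` {..<n})" for n
    have V\<C>: "V n \<in> \<C>" for n
    proof -
      have "V n = \<Union>(b ` {..<n} - {{}})" by (auto simp: V_def)
      moreover have "finite (b ` {..<n} - {{}})" "b ` {..<n} - {{}} \<subseteq> B" using b B'(1) by auto
      ultimately show ?thesis unfolding \<C>_def by blast
    qed
    have "incseq V" by (force simp: V_def incseq_def)
    have "(\<Union>n. V n) = \<Union>(range b)" by (auto simp: V_def)
    then have VU: "(\<Union>n. V n) = U" using b B'(2) by simp
    have "V n \<in> sets borel" for n using V\<C> \<open>\<C> \<subseteq> sets borel\<close> by auto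
    then have "(\<lambda>n. measure \<kappa> (V n)) \<longlonglongrightarrow> measure \<kappa> U" "(\<lambda>n. measure \<mu> (V n)) \<longlonglongrightarrow> measure \<mu> U"
      using \<kappa>(2) \<mu>(2) \<open>incseq V\<close> K.finite_Lim_measure_incseq[of V] N.finite_Lim_measure_incseq[of V]
      unfolding VU by auto
    then have "(\<lambda>n. \<bar>measure \<kappa> (V n) - measure \<mu> (V n)\<bar>) \<longlonglongrightarrow> \<bar>measure \<kappa> U - measure \<mu> U\<bar>"
      by (intro tendsto_intros)
    then have "eventually (\<lambda>n. \<bar>measure \<kappa> U - measure \<mu> U\<bar> - e / 2 < \<bar>measure \<kappa> (V n) - measure \<mu> (V n)\<bar>) sequentially"
      using e by (auto intro: order_tendstoD)
    then obtain n where "\<bar>measure \<kappa> U - measure \<mu> U\<bar> - e / 2 < \<bar>measure \<kappa> (V n) - measure \<mu> (V n)\<bar>"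
      by (auto simp: eventually_sequentially)
    with CU V\<C> show "\<exists>U\<in>\<C>. \<bar>measure \<kappa> C - measure \<mu> C\<bar> < \<bar>measure \<kappa> U - measure \<mu> U\<bar> + e"
      by (intro bexI[of _ "V n"]) auto
  qed
qed

lemma tv_bdd_above:
  assumes "prob_space \<kappa>" "prob_space \<mu>"
  shows "bdd_above ((\<lambda>C. \<bar>measure \<kappa> C - measure \<mu> C\<bar>) ` S)"
proof (intro bdd_aboveI[of _ 1], clarify)
  fix C
  show "\<bar>measure \<kappa> C - measure \<mu> C\<bar> \<le> 1"
    using prob_space.prob_le_1[OF assms(1), of C] prob_space.prob_le_1[OF assms(2), of C]
      measure_nonneg[of \<kappa> C] measure_nonneg[of \<mu> C] by linarith
qed

text \<open>The supremum runs over an uncountable family. It agrees pointwise with the one over the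
  countable determining family, which is a countable supremum of measurable functions.\<close>

lemma borel_measurable_tv:
  fixes \<mu> :: "'e::polish_space measure"
  assumes \<kappa>: "\<kappa> \<in> F \<rightarrow>\<^sub>M prob_algebra borel" and \<mu>: "prob_space \<mu>" "sets \<mu> = sets borel"
  shows "(\<lambda>\<omega>. SUP C\<in>sets borel. \<bar>measure (\<kappa> \<omega>) C - measure \<mu> C\<bar>) \<in> borel_measurable F"
proof -
  obtain \<C> :: "'e set set" where \<C>: "countable \<C>" "\<C> \<subseteq> sets borel" "\<C> \<noteq> {}"
    "\<And>(\<kappa> :: 'e measure) \<mu> C e. prob_space \<kappa> \<Longrightarrow> sets \<kappa> = sets borel \<Longrightarrow> prob_space \<mu> \<Longrightarrow> sets \<mu> = sets borel \<Longrightarrow>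
      C \<in> sets borel \<Longrightarrow> 0 < e \<Longrightarrow>
      \<exists>U\<in>\<C>. \<bar>measure \<kappa> C - measure \<mu> C\<bar> < \<bar>measure \<kappa> U - measure \<mu> U\<bar> + e"
    by (rule countable_tv_determining_family) (rule that)
  have \<kappa>_prob: "prob_space (\<kappa> \<omega>)" "sets (\<kappa> \<omega>) = sets borel" if "\<omega> \<in> space F" for \<omega>
    using measurable_space[OF \<kappa>] that by (auto simp: space_prob_algebra)
  have eq: "(SUP C\<in>sets borel. \<bar>measure (\<kappa> \<omega>) C - measure \<mu> C\<bar>) = (SUP C\<in>\<C>. \<bar>measure (\<kappa> \<omega>) C - measure \<mu> C\<bar>)"
    if \<omega>: "\<omega> \<in> space F" for \<omega>
  proof (rule antisym)
    note bdd = tv_bdd_above[OF \<kappa>_prob(1)[OF \<omega>] \<mu>(1)]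
    show "(SUP C\<in>\<C>. \<bar>measure (\<kappa> \<omega>) C - measure \<mu> C\<bar>) \<le> (SUP C\<in>sets borel. \<bar>measure (\<kappa> \<omega>) C - measure \<mu> C\<bar>)"
      by (intro cSUP_subset_mono \<C> bdd) auto
    show "(SUP C\<in>sets borel. \<bar>measure (\<kappa> \<omega>) C - measure \<mu> C\<bar>) \<le> (SUP C\<in>\<C>. \<bar>measure (\<kappa> \<omega>) C - measure \<mu> C\<bar>)"
    proof (rule cSUP_least)
      fix C :: "'e set" assume C: "C \<in> sets borel"
      show "\<bar>measure (\<kappa> \<omega>) C - measure \<mu> C\<bar> \<le> (SUP C\<in>\<C>. \<bar>measure (\<kappa> \<omega>) C - measure \<mu> C\<bar>)"
      proof (rule field_le_epsilon)
        fix e :: real assume "0 < e"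
        with C obtain U where U: "U \<in> \<C>" "\<bar>measure (\<kappa> \<omega>) C - measure \<mu> C\<bar> < \<bar>measure (\<kappa> \<omega>) U - measure \<mu> U\<bar> + e"
          using \<C>(4)[OF \<kappa>_prob[OF \<omega>] \<mu>] by blast
        have "\<bar>measure (\<kappa> \<omega>) U - measure \<mu> U\<bar> \<le> (SUP C\<in>\<C>. \<bar>measure (\<kappa> \<omega>) C - measure \<mu> C\<bar>)"
          by (intro cSUP_upper U bdd)
        with U(2) show "\<bar>measure (\<kappa> \<omega>) C - measure \<mu> C\<bar> \<le> (SUP C\<in>\<C>. \<bar>measure (\<kappa> \<omega>) C - measure \<mu> C\<bar>) + e"
          by linarith
      qed
    qed auto
  qed
  have [measurable]: "(\<lambda>\<omega>. measure (\<kappa> \<omega>) C) \<in> borel_measurable F" if "C \<in> \<C>" for C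
    using \<C>(2) that by (intro measurable_compose[OF \<kappa> measurable_measure_prob_algebra]) auto
  have "(\<lambda>\<omega>. SUP C\<in>\<C>. \<bar>measure (\<kappa> \<omega>) C - measure \<mu> C\<bar>) \<in> borel_measurable F"
    by (rule borel_measurable_cSUP[OF \<C>(1)]) (auto intro!: tv_bdd_above \<kappa>_prob \<mu>)
  then show ?thesis
    by (subst measurable_cong[OF eq])
qed

text \<open>An integer count is the sum over \<open>j \<ge> 1\<close> of the indicators that it is
  at least \<open>j\<close>, and the bound stops this sum at \<open>m\<close>. The level sets do not
  depend on the measure, so two measures can be compared level by level, at the cost of one total
  variation distance per level.\<close>

lemma sum_measure_layer_cake:
  assumes "prob_space \<nu>" and "finite P" and A: "\<And>k. k \<in> P \<Longrightarrow> A k \<in> sets \<nu>" and L: "L \<in> sets \<nu>"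
    and bound: "\<And>x. x \<in> L \<Longrightarrow> card {k\<in>P. x \<in> A k} \<le> m"
  shows "(\<Sum>k\<in>P. measure \<nu> (A k \<inter> L)) = (\<Sum>j=1..m. measure \<nu> {x\<in>L. j \<le> card {k\<in>P. x \<in> A k}})"
    and "{x\<in>L. j \<le> card {k\<in>P. x \<in> A k}} \<in> sets \<nu>"
proof -
  interpret prob_space \<nu> by fact
  have card_eq: "real (card {k\<in>P. x \<in> A k}) = (\<Sum>k\<in>P. indicator (A k) x)" for x
  proof -
    have "(\<Sum>k\<in>P. indicator (A k) x :: real) = (\<Sum>k\<in>P. of_bool (x \<in> A k))"
      by (simp add: indicator_def of_bool_def)
    also have "\<dots> = card {k\<in>P. x \<in> A k}"
      using \<open>finite P\<close> by (simp add: Int_def flip: of_nat_sum)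
    finally show ?thesis ..
  qed
  have meas: "{x\<in>L. j \<le> card {k\<in>P. x \<in> A k}} \<in> sets \<nu>" for j
  proof -
    have "{x\<in>L. j \<le> card {k\<in>P. x \<in> A k}} = {x\<in>L. real j \<le> (\<Sum>k\<in>P. indicator (A k) x)}"
      by (simp flip: card_eq)
    also have "\<dots> = L \<inter> {x\<in>space \<nu>. real j \<le> (\<Sum>k\<in>P. indicator (A k) x)}"
      using sets.sets_into_space[OF L] by auto
    also have "\<dots> \<in> sets \<nu>"
      using A by (intro sets.Int L borel_measurable_le) auto
    finally show ?thesis .
  qed
  then show "{x\<in>L. j \<le> card {k\<in>P. x \<in> A k}} \<in> sets \<nu>" .
  have pt: "(\<Sum>k\<in>P. indicator (A k \<inter> L) x :: real) = (\<Sum>j=1..m. indicator {x\<in>L. j \<le> card {k\<in>P. x \<in> A k}} x)" for x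
  proof (cases "x \<in> L")
    case True
    have "(\<Sum>j=1..m. indicator {x\<in>L. j \<le> card {k\<in>P. x \<in> A k}} x :: real)
        = (\<Sum>j=1..m. of_bool (j \<le> card {k\<in>P. x \<in> A k}))"
      using True by (simp add: indicator_def of_bool_def)
    also have "\<dots> = card {j\<in>{1..m}. j \<le> card {k\<in>P. x \<in> A k}}"
      by (simp add: Int_def flip: of_nat_sum)
    also have "{j\<in>{1..m}. j \<le> card {k\<in>P. x \<in> A k}} = {1..card {k\<in>P. x \<in> A k}}"
      using bound[OF True] by auto
    also have "real (card \<dots>) = (\<Sum>k\<in>P. indicator (A k) x)"
      by (simp add: card_eq)
    finally show ?thesis using True by (simp add: indicator_def)
  qed simp
  have "(\<Sum>k\<in>P. measure \<nu> (A k \<inter> L)) = (\<integral>x. (\<Sum>k\<in>P. indicator (A k \<inter> L) x) \<partial>\<nu>)"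
    using A L by (subst Bochner_Integration.integral_sum) (auto simp: emeasure_eq_measure sets.sets_into_space Int_absorb2 intro!: sum.cong integrable_real_indicator)
  also have "\<dots> = (\<Sum>j=1..m. measure \<nu> {x\<in>L. j \<le> card {k\<in>P. x \<in> A k}})"
    unfolding pt using meas by (subst Bochner_Integration.integral_sum) (auto simp: emeasure_eq_measure intro!: sum.cong integrable_real_indicator arg_cong[where f="measure \<nu>"] dest: sets.sets_into_space)
  finally show "(\<Sum>k\<in>P. measure \<nu> (A k \<inter> L)) = (\<Sum>j=1..m. measure \<nu> {x\<in>L. j \<le> card {k\<in>P. x \<in> A k}})" .
qed

text \<open>
  On the set where the count of the \<open>A k\<close> is at most \<open>c\<close>, the layer cake formula bounds the
  difference of the two integrals of a partial count by \<open>c\<close> times the total variation distance.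
\<close>

lemma sum_abs_measure_diff_le:
  assumes \<kappa>: "prob_space \<kappa>" and \<mu>: "prob_space \<mu>" and sets: "sets \<kappa> = sets \<mu>"
    and I: "finite I" and A: "\<And>k. k \<in> I \<Longrightarrow> A k \<in> sets \<mu>"
    and tv: "\<And>C. C \<in> sets \<mu> \<Longrightarrow> \<bar>measure \<kappa> C - measure \<mu> C\<bar> \<le> d" and c: "0 \<le> c"
    and T: "T = {x \<in> space \<mu>. (\<Sum>k\<in>I. indicator (A k) x) > c}"
  shows "(\<Sum>k\<in>I. \<bar>measure \<kappa> (A k) - measure \<mu> (A k)\<bar>)
    \<le> 2 * c * d + (\<Sum>k\<in>I. measure \<kappa> (A k \<inter> T) + measure \<mu> (A k \<inter> T))"
proof -
  interpret K: prob_space \<kappa> by fact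
  interpret N: prob_space \<mu> by fact
  define L where "L = space \<mu> - T"
  have T_sets: "T \<in> sets \<mu>"
    unfolding T using A by (intro borel_measurable_less borel_measurable_sum borel_measurable_indicator) auto
  then have L_sets: "L \<in> sets \<mu>" by (auto simp: L_def)
  have d: "0 \<le> d" using tv[of "{}"] by auto
  have split: "measure \<nu> (A k) = measure \<nu> (A k \<inter> L) + measure \<nu> (A k \<inter> T)"
    if "k \<in> I" "prob_space \<nu>" "sets \<nu> = sets \<mu>" for k \<nu>
  proof -
    interpret prob_space \<nu> by fact
    have "A k = (A k \<inter> L) \<union> (A k \<inter> T)"
      using sets.sets_into_space[OF A[OF that(1)]] by (auto simp: L_def)
    then show ?thesis
      using A[OF that(1)] L_sets T_sets that(3) finite_measure_Union[of "A k \<inter> L" "A k \<inter> T"]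
      by (auto simp: L_def)
  qed
  \<comment> \<open>Without absolute values the sum over \<open>P\<close> is a difference of two
    integrals of one count. On \<open>L\<close> that count is an integer not exceeding
    \<open>c\<close>, so it has at most \<open>nat \<lfloor>c\<rfloor>\<close> levels.\<close>
  have part: "\<bar>\<Sum>k\<in>P. measure \<kappa> (A k \<inter> L) - measure \<mu> (A k \<inter> L)\<bar> \<le> c * d" if P: "P \<subseteq> I" for P
  proof -
    have fin: "finite P" using P I by (rule finite_subset)
    have AP: "A k \<in> sets \<mu>" "A k \<in> sets \<kappa>" if "k \<in> P" for k using that P A sets by auto
    define m where "m = nat \<lfloor>c\<rfloor>"
    have bound: "card {k\<in>P. x \<in> A k} \<le> m" if "x \<in> L" for x
    proof -
      have "real (card {k\<in>P. x \<in> A k}) = (\<Sum>k\<in>P. of_bool (x \<in> A k))"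
        using fin by (simp add: Int_def flip: of_nat_sum)
      also have "\<dots> \<le> (\<Sum>k\<in>I. indicator (A k) x)"
        using P I by (auto simp: indicator_def of_bool_def intro!: sum_mono2)
      also have "\<dots> \<le> c" using that by (auto simp: L_def T)
      finally show ?thesis using c by (simp add: m_def le_nat_floor)
    qed
    note lc = sum_measure_layer_cake[OF \<mu> fin AP(1) L_sets bound]
    have "\<bar>\<Sum>k\<in>P. measure \<kappa> (A k \<inter> L) - measure \<mu> (A k \<inter> L)\<bar>
        = \<bar>\<Sum>j=1..m. measure \<kappa> {x\<in>L. j \<le> card {k\<in>P. x \<in> A k}} - measure \<mu> {x\<in>L. j \<le> card {k\<in>P. x \<in> A k}}\<bar>"
      using sum_measure_layer_cake(1)[OF \<kappa> fin AP(2) _ bound, of L] L_sets sets lc(1)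
      by (simp add: sum_subtractf)
    also have "\<dots> \<le> (\<Sum>j=1..m. d)"
      using lc(2) by (intro order_trans[OF sum_abs] sum_mono tv)
    also have "\<dots> = real m * d" by simp
    also have "\<dots> \<le> c * d" using c d by (intro mult_right_mono) (auto simp: m_def)
    finally show ?thesis .
  qed
  define u where "u k = measure \<kappa> (A k \<inter> L) - measure \<mu> (A k \<inter> L)" for k
  \<comment> \<open>Absolute values are recovered by splitting the indices according to sign; the
    two subfamilies account for the factor 2 in \<open>2 * c * d\<close>.\<close>
  define P where "P = {k\<in>I. 0 \<le> u k}"
  have "(\<Sum>k\<in>I. \<bar>u k\<bar>) = (\<Sum>k\<in>P. u k) + (\<Sum>k\<in>I-P. - u k)"
    using I by (subst sum.subset_diff[of P I]) (auto simp: P_def intro!: sum.cong)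
  also have "\<dots> \<le> c * d + c * d"
    using part[of P] part[of "I - P"] unfolding u_def[symmetric] by (auto simp: P_def sum_negf)
  finally have "(\<Sum>k\<in>I. \<bar>u k\<bar>) \<le> 2 * c * d" by simp
  moreover have "(\<Sum>k\<in>I. \<bar>measure \<kappa> (A k) - measure \<mu> (A k)\<bar>)
      \<le> (\<Sum>k\<in>I. \<bar>u k\<bar> + (measure \<kappa> (A k \<inter> T) + measure \<mu> (A k \<inter> T)))"
    using split[OF _ \<kappa> sets] split[OF _ \<mu> refl]
    by (intro sum_mono) (smt (verit, best) u_def measure_nonneg)
  ultimately show ?thesis by (simp add: sum.distrib)
qed

section \<open>Stationary processes\<close>

locale stationary_process = prob_space M for M :: "'a measure" +
  fixes X :: "int \<Rightarrow> 'a \<Rightarrow> 'e::polish_space" and \<mu> :: "'e measure"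
  assumes X_measurable[measurable]: "\<And>i. X i \<in> borel_measurable M"
    and stationary: "strictly_stationary M borel X"
    and law: "\<And>i. distr M borel (X i) = \<mu>"
begin

section \<open>Conditioning on the past and shifting in time\<close>

abbreviation "past \<equiv> past_algebra M borel X"

definition past_prob :: "int \<Rightarrow> int \<Rightarrow> 'e set \<Rightarrow> 'a \<Rightarrow> real" where
  "past_prob j m C = real_cond_exp M (past m) (indicator (X j -` C \<inter> space M))"

lemma sets_law[simp, measurable_cong]: "sets \<mu> = sets borel" and space_law[simp]: "space \<mu> = UNIV"
  and prob_space_law: "prob_space \<mu>"
  using law[of 0] prob_space_distr[OF X_measurable[of 0]] by auto

lemma measure_vimage: "C \<in> sets borel \<Longrightarrow> measure M (X i -` C \<inter> space M) = measure \<mu> C"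
  using measure_distr[OF X_measurable[of i], of C] by (simp add: law)

lemma space_past[simp]: "space (past m) = space M"
  by (simp add: past_algebra_def space_measure_of_conv)

lemma sets_past: "sets (past m) = sigma_sets (space M) {X k -` C \<inter> space M | k C. k \<le> m \<and> C \<in> sets borel}"
  unfolding past_algebra_def by (rule sets_measure_of) auto

lemma subalgebra_past: "subalgebra M (past m)"
  unfolding subalgebra_def sets_past by (auto intro!: sets.sigma_sets_subset)

lemma past_mono: "m \<le> m' \<Longrightarrow> sets (past m) \<subseteq> sets (past m')"
  unfolding sets_past by (rule sigma_sets_mono') force

lemma measurable_X_past: "k \<le> m \<Longrightarrow> X k \<in> borel_measurable (past m)"
  by (rule measurableI) (auto simp: sets_past intro!: sigma_sets.Basic)

lemma finite_measure_subalgebra_past: "finite_measure_subalgebra M (past m)"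
  by standard (rule subalgebra_past)

lemma integrable_indicator_vimage[simp]:
  "C \<in> sets borel \<Longrightarrow> integrable M (indicator (X j -` C \<inter> space M) :: _ \<Rightarrow> real)"
  by (auto simp: emeasure_eq_measure intro!: integrable_real_indicator)

lemma
  shows borel_measurable_past_prob: "past_prob j m C \<in> borel_measurable (past m)"
    and borel_measurable_past_prob'[measurable]: "past_prob j m C \<in> borel_measurable M"
  unfolding past_prob_def by auto

lemma
  assumes "C \<in> sets borel"
  shows integrable_past_prob[simp]: "integrable M (past_prob j m C)"
    and integral_past_prob: "(\<integral>\<omega>. past_prob j m C \<omega> \<partial>M) = measure \<mu> C"
proof -
  interpret finite_measure_subalgebra M "past m" by (rule finite_measure_subalgebra_past)
  show "integrable M (past_prob j m C)" "(\<integral>\<omega>. past_prob j m C \<omega> \<partial>M) = measure \<mu> C"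
    using real_cond_exp_int[OF integrable_indicator_vimage[OF assms]] assms
    by (simp_all add: past_prob_def measure_vimage Int_assoc)
qed

lemma AE_past_prob_bounds:
  assumes "C \<in> sets borel"
  shows "AE \<omega> in M. 0 \<le> past_prob j m C \<omega> \<and> past_prob j m C \<omega> \<le> 1"
proof -
  interpret finite_measure_subalgebra M "past m" by (rule finite_measure_subalgebra_past)
  have "AE \<omega> in M. 0 \<le> past_prob j m C \<omega>"
    unfolding past_prob_def by (rule real_cond_exp_pos) (use assms in auto)
  moreover have "AE \<omega> in M. past_prob j m C \<omega> \<le> 1"
    unfolding past_prob_def by (rule real_cond_exp_le_c) (use assms in \<open>auto simp: indicator_def intro!: AE_I2\<close>)
  ultimately show ?thesis by eventually_elim auto
qed

lemma set_integral_past_prob: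
  assumes "C \<in> sets borel" "D \<in> sets (past m)"
  shows "(\<integral>\<omega>. indicator D \<omega> * past_prob j m C \<omega> \<partial>M) = measure M (X j -` C \<inter> D)"
proof -
  interpret finite_measure_subalgebra M "past m" by (rule finite_measure_subalgebra_past)
  have "D \<subseteq> space M" using sets.sets_into_space[OF assms(2)] by simp
  have "(\<integral>\<omega>. indicator D \<omega> * past_prob j m C \<omega> \<partial>M) = (\<integral>\<omega>. indicator D \<omega> * indicator (X j -` C \<inter> space M) \<omega> \<partial>M)"
    using real_cond_exp_intA[OF integrable_indicator_vimage[OF assms(1)] assms(2)]
    by (simp add: set_lebesgue_integral_def past_prob_def)
  also have "\<dots> = measure M (X j -` C \<inter> D)"
    using \<open>D \<subseteq> space M\<close>
    by (subst indicator_inter_arith[symmetric]) (auto simp: Int_ac intro!: arg_cong[where f="measure M"])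
  finally show ?thesis .
qed

text \<open>A past event constrains the trajectory through a measurable set of trajectories.
  Evaluating that set on the shifted process moves the event to an earlier past and
  \<open>X k\<close> to \<open>X 0\<close>, and stationarity preserves the joint
  probability.\<close>

lemma past_event_shift:
  assumes "D \<in> sets (past m)"
  obtains D' where "D' \<in> sets (past (m - k))"
    "\<And>C. C \<in> sets borel \<Longrightarrow> measure M (X k -` C \<inter> D) = measure M (X 0 -` C \<inter> D')"
proof -
  let ?P = "\<Pi>\<^sub>M i\<in>(UNIV::int set). (borel :: 'e measure)"
  have proc[measurable]: "(\<lambda>\<omega> i. X (i + h) \<omega>) \<in> M \<rightarrow>\<^sub>M ?P" for h
    by (rule measurable_PiM_single') auto
  have proc0[measurable]: "(\<lambda>\<omega> i. X i \<omega>) \<in> M \<rightarrow>\<^sub>M ?P"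
    using proc[of 0] by simp
  \<comment> \<open>The same \<open>D'\<close> must describe the event and all its shifts, so the
    induction carries the past-measurability for every \<open>h\<close> along with the
    representation.\<close>
  have "\<exists>D'\<in>sets ?P. D = {\<omega>\<in>space M. (\<lambda>i. X i \<omega>) \<in> D'} \<and>
      (\<forall>h. {\<omega>\<in>space M. (\<lambda>i. X (i + h) \<omega>) \<in> D'} \<in> sets (past (m + h)))"
    using assms unfolding sets_past[of m]
  proof induction
    case (Basic a)
    then obtain k C where k: "a = X k -` C \<inter> space M" "k \<le> m" "C \<in> sets borel" by auto
    have "{x\<in>space ?P. x k \<in> C} \<in> sets ?P"
      using k(3) by measurable
    moreover have "{\<omega>\<in>space M. X (k + h) \<omega> \<in> C} \<in> sets (past (m + h))" for h
      using measurable_sets[OF measurable_X_past[of "k + h" "m + h"] k(3)] k(2)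
      by (simp add: vimage_def Int_def conj_commute)
    ultimately show ?case
      using k by (intro bexI[of _ "{x\<in>space ?P. x k \<in> C}"]) (auto simp: space_PiM PiE_def extensional_def)
  next
    case Empty
    show ?case by (intro bexI[of _ "{}"]) auto
  next
    case (Compl a)
    then obtain D' where D': "D' \<in> sets ?P" "a = {\<omega>\<in>space M. (\<lambda>i. X i \<omega>) \<in> D'}"
      "\<And>h. {\<omega>\<in>space M. (\<lambda>i. X (i + h) \<omega>) \<in> D'} \<in> sets (past (m + h))" by auto
    have eq: "{\<omega>\<in>space M. (\<lambda>i. X (i + h) \<omega>) \<in> space ?P - D'} = space (past (m + h)) - {\<omega>\<in>space M. (\<lambda>i. X (i + h) \<omega>) \<in> D'}" for h
      by (auto simp: space_PiM)
    have "{\<omega>\<in>space M. (\<lambda>i. X (i + h) \<omega>) \<in> space ?P - D'} \<in> sets (past (m + h))" for h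
      unfolding eq by (rule sets.compl_sets[OF D'(3)])
    moreover have "space M - a = {\<omega>\<in>space M. (\<lambda>i. X i \<omega>) \<in> space ?P - D'}"
      by (auto simp: D'(2) space_PiM)
    ultimately show ?case
      using sets.compl_sets[OF D'(1)] by blast
  next
    case (Union a)
    then have "\<forall>i. \<exists>D'. D' \<in> sets ?P \<and> a i = {\<omega>\<in>space M. (\<lambda>i. X i \<omega>) \<in> D'} \<and>
      (\<forall>h. {\<omega>\<in>space M. (\<lambda>i. X (i + h) \<omega>) \<in> D'} \<in> sets (past (m + h)))"
      unfolding Bex_def by (intro allI)
    from choice[OF this] obtain D' where D': "\<And>i. D' i \<in> sets ?P" "\<And>i. a i = {\<omega>\<in>space M. (\<lambda>i. X i \<omega>) \<in> D' i}"
      "\<And>i h. {\<omega>\<in>space M. (\<lambda>i. X (i + h) \<omega>) \<in> D' i} \<in> sets (past (m + h))" by blast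
    have "{\<omega>\<in>space M. (\<lambda>i. X (i + h) \<omega>) \<in> (\<Union>i. D' i)} = (\<Union>i. {\<omega>\<in>space M. (\<lambda>i. X (i + h) \<omega>) \<in> D' i})" for h
      by auto
    then have "{\<omega>\<in>space M. (\<lambda>i. X (i + h) \<omega>) \<in> (\<Union>i. D' i)} \<in> sets (past (m + h))" for h
      using D'(3)[of h] by (simp add: sets.countable_UN)
    then show ?case
      using D'(1,2) by (intro bexI[of _ "\<Union>i. D' i"]) auto
  qed
  then obtain D' where D': "D' \<in> sets ?P" "D = {\<omega>\<in>space M. (\<lambda>i. X i \<omega>) \<in> D'}"
      "\<And>h. {\<omega>\<in>space M. (\<lambda>i. X (i + h) \<omega>) \<in> D'} \<in> sets (past (m + h))" by auto
  show ?thesis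
  proof
    show "{\<omega>\<in>space M. (\<lambda>i. X (i + (- k)) \<omega>) \<in> D'} \<in> sets (past (m - k))"
      using D'(3)[of "- k"] by simp
    fix C :: "'e set" assume C[measurable]: "C \<in> sets borel"
    define R where "R = {x\<in>space ?P. x k \<in> C} \<inter> D'"
    have "{x\<in>space ?P. x k \<in> C} \<in> sets ?P" by measurable
    then have R: "R \<in> sets ?P" using D'(1) by (auto simp: R_def)
    have "measure M (X k -` C \<inter> D) = measure (distr M ?P (\<lambda>\<omega> i. X i \<omega>)) R"
      unfolding measure_distr[OF proc0 R]
      by (intro arg_cong[where f="measure M"]) (auto simp: R_def D'(2) space_PiM)
    also have "\<dots> = measure (distr M ?P (\<lambda>\<omega> i. X (i + (- k)) \<omega>)) R"
      using stationary unfolding strictly_stationary_def by metis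
    also have "\<dots> = measure M (X 0 -` C \<inter> {\<omega>\<in>space M. (\<lambda>i. X (i + (- k)) \<omega>) \<in> D'})"
      unfolding measure_distr[OF proc R]
      by (intro arg_cong[where f="measure M"]) (auto simp: R_def space_PiM)
    finally show "measure M (X k -` C \<inter> D) = measure M (X 0 -` C \<inter> {\<omega>\<in>space M. (\<lambda>i. X (i + (- k)) \<omega>) \<in> D'})" .
  qed
qed

text \<open>
  The centred conditional probability has integral zero, so its \<open>L\<^sup>1\<close> norm is twice its integral over
  the past event where it is nonnegative, and that event can be shifted.
\<close>

lemma L1_past_prob_shift_le:
  assumes C: "C \<in> sets borel"
  shows "(\<integral>\<omega>. \<bar>past_prob k (k - q) C \<omega> - measure \<mu> C\<bar> \<partial>M) \<le> (\<integral>\<omega>. \<bar>past_prob 0 (- q) C \<omega> - measure \<mu> C\<bar> \<partial>M)"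
proof -
  define a where "a = measure \<mu> C"
  define D where "D = {\<omega>\<in>space (past (k - q)). a \<le> past_prob k (k - q) C \<omega>}"
  have D: "D \<in> sets (past (k - q))"
    unfolding D_def by (intro borel_measurable_le borel_measurable_past_prob) auto
  obtain D' where D': "D' \<in> sets (past (k - q - k))"
    "\<And>C. C \<in> sets borel \<Longrightarrow> measure M (X k -` C \<inter> D) = measure M (X 0 -` C \<inter> D')"
    by (rule past_event_shift[OF D, where k = k]) (rule that)
  have DM: "D \<in> sets M" and D'M: "D' \<in> sets M"
    using D D'(1) subalgebra_past by (auto simp: subalgebra_def)
  have int: "integrable M (\<lambda>\<omega>. past_prob j m C \<omega> - a)" for j m
    using C by simp
  have int0: "(\<integral>\<omega>. past_prob j m C \<omega> - a \<partial>M) = 0" for j m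
    using C by (simp add: integral_past_prob a_def prob_space)
  have intD: "integrable M (\<lambda>\<omega>. indicator E \<omega> * (past_prob j m C \<omega> - a))" if "E \<in> sets M" for E j m
    using integrable_mult_indicator[OF that int] by simp
  have set_int: "(\<integral>\<omega>. indicator E \<omega> * (past_prob j m C \<omega> - a) \<partial>M) = measure M (X j -` C \<inter> E) - a * measure M E"
    if E: "E \<in> sets (past m)" for E j m
  proof -
    have EM: "E \<in> sets M" using E subalgebra_past by (auto simp: subalgebra_def)
    have "(\<integral>\<omega>. indicator E \<omega> * (past_prob j m C \<omega> - a) \<partial>M)
        = (\<integral>\<omega>. indicator E \<omega> * past_prob j m C \<omega> - a * indicator E \<omega> \<partial>M)"
      by (simp add: algebra_simps)
    also have "\<dots> = (\<integral>\<omega>. indicator E \<omega> * past_prob j m C \<omega> \<partial>M) - (\<integral>\<omega>. a * indicator E \<omega> \<partial>M)"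
      using integrable_mult_indicator[OF EM integrable_past_prob[OF C]] EM
      by (intro Bochner_Integration.integral_diff integrable_mult_right integrable_real_indicator) (auto simp: emeasure_eq_measure)
    also have "\<dots> = measure M (X j -` C \<inter> E) - a * measure M E"
      using set_integral_past_prob[OF C E] sets.sets_into_space[OF EM] by (simp add: Int_absorb2)
    finally show ?thesis .
  qed
  have "(\<integral>\<omega>. \<bar>past_prob k (k - q) C \<omega> - a\<bar> \<partial>M)
      = (\<integral>\<omega>. 2 * (indicator D \<omega> * (past_prob k (k - q) C \<omega> - a)) - (past_prob k (k - q) C \<omega> - a) \<partial>M)"
    by (intro Bochner_Integration.integral_cong) (auto simp: D_def indicator_def)
  also have "\<dots> = 2 * (\<integral>\<omega>. indicator D \<omega> * (past_prob k (k - q) C \<omega> - a) \<partial>M)"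
    using int intD[OF DM] int0 by (subst Bochner_Integration.integral_diff) auto
  also have "\<dots> = 2 * (\<integral>\<omega>. indicator D' \<omega> * (past_prob 0 (- q) C \<omega> - a) \<partial>M)"
  proof -
    \<comment> \<open>The shift identity for \<open>C = UNIV\<close> shows that the shifted event
      has the same probability.\<close>
    have "measure M D = measure M D'" using D'(2)[of UNIV] by simp
    then show ?thesis using set_int[OF D, of k] set_int[of D' "- q" 0] D' C by simp
  qed
  also have "\<dots> = (\<integral>\<omega>. 2 * (indicator D' \<omega> * (past_prob 0 (- q) C \<omega> - a)) - (past_prob 0 (- q) C \<omega> - a) \<partial>M)"
    using int intD[OF D'M] int0 by (subst Bochner_Integration.integral_diff) auto
  \<comment> \<open>At time 0 the event \<open>D'\<close> need not be the one where the centred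
    probability is nonnegative, but the integrand is that quantity up to sign, so it is at most its
    absolute value.\<close>
  also have "\<dots> \<le> (\<integral>\<omega>. \<bar>past_prob 0 (- q) C \<omega> - a\<bar> \<partial>M)"
    using int intD[OF D'M] by (intro integral_mono) (auto simp: indicator_def)
  finally show ?thesis by (simp add: a_def)
qed

text \<open>Existence of a regular version is used here: it makes the kernel chosen by
  \<open>SOME\<close> an actual conditional law.\<close>

lemma beta_kernel:
  obtains \<kappa> where "regular_cond_distr M (past (- int q)) borel (X 0) \<kappa>"
    "beta_inf_1 M X q = (\<integral>\<omega>. (SUP C\<in>sets borel. \<bar>measure (\<kappa> \<omega>) C - measure \<mu> C\<bar>) \<partial>M)"
proof
  let ?\<kappa> = "SOME \<kappa>. regular_cond_distr M (past (- int q)) borel (X 0) \<kappa>"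
  show "regular_cond_distr M (past (- int q)) borel (X 0) ?\<kappa>"
    using regular_cond_distr_exists[OF subalgebra_past X_measurable] by (rule someI_ex)
  show "beta_inf_1 M X q = (\<integral>\<omega>. (SUP C\<in>sets borel. \<bar>measure (?\<kappa> \<omega>) C - measure \<mu> C\<bar>) \<partial>M)"
    unfolding beta_inf_1_def beta_coeff_def Let_def
    by (intro Bochner_Integration.integral_cong refl SUP_cong) (simp add: measure_vimage)
qed

text \<open>Once all terms are moved to time 0, a single kernel serves every \<open>k\<close>, and
  the deterministic comparison of two measures applies for almost every outcome. Integrating it
  turns the distance into beta and the conditional mass of \<open>A k \<inter> T\<close> into its
  unconditional mass, whence the factor 2 of the last sum.\<close>

lemma sum_L1_past_prob_le:
  assumes I: "finite I" and A: "\<And>k. k \<in> I \<Longrightarrow> A k \<in> sets borel" and c: "0 \<le> c"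
    and T: "T = {x. (\<Sum>k\<in>I. indicator (A k) x) > c}"
  shows "(\<Sum>k\<in>I. \<integral>\<omega>. \<bar>past_prob (j k) (j k - int q) (A k) \<omega> - measure \<mu> (A k)\<bar> \<partial>M)
    \<le> 2 * c * beta_inf_1 M X q + 2 * (\<Sum>k\<in>I. measure \<mu> (A k \<inter> T))"
proof -
  obtain \<kappa> where \<kappa>: "regular_cond_distr M (past (- int q)) borel (X 0) \<kappa>"
    "beta_inf_1 M X q = (\<integral>\<omega>. (SUP C\<in>sets borel. \<bar>measure (\<kappa> \<omega>) C - measure \<mu> C\<bar>) \<partial>M)"
    by (rule beta_kernel)
  define d where "d \<omega> = (SUP C\<in>sets borel. \<bar>measure (\<kappa> \<omega>) C - measure \<mu> C\<bar>)" for \<omega>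
  have \<kappa>_meas: "\<kappa> \<in> past (- int q) \<rightarrow>\<^sub>M prob_algebra borel"
    using \<kappa>(1) by (simp add: regular_cond_distr_def)
  have \<kappa>_prob: "prob_space (\<kappa> \<omega>)" "sets (\<kappa> \<omega>) = sets borel" if "\<omega> \<in> space M" for \<omega>
    using measurable_space[OF \<kappa>_meas] that by (auto simp: space_prob_algebra)
  have \<kappa>_eq: "AE \<omega> in M. measure (\<kappa> \<omega>) C = past_prob 0 (- int q) C \<omega>" if "C \<in> sets borel" for C
    using \<kappa>(1) that by (simp add: regular_cond_distr_def past_prob_def)
  have "T = {x\<in>space \<mu>. (\<Sum>k\<in>I. indicator (A k) x) > c}" by (simp add: T)
  moreover have "\<dots> \<in> sets \<mu>"
    using A by (intro borel_measurable_less borel_measurable_sum borel_measurable_indicator) auto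
  ultimately have T': "T = {x\<in>space \<mu>. (\<Sum>k\<in>I. indicator (A k) x) > c}" "T \<in> sets borel" by auto
  have AT: "A k \<inter> T \<in> sets borel" if "k \<in> I" for k using that A T'(2) by auto
  have d_bdd: "\<bar>measure (\<kappa> \<omega>) C - measure \<mu> C\<bar> \<le> d \<omega>" if "\<omega> \<in> space M" "C \<in> sets borel" for \<omega> C
    unfolding d_def using that by (intro cSUP_upper tv_bdd_above \<kappa>_prob prob_space_law)
  have d_le: "d \<omega> \<le> 1" "0 \<le> d \<omega>" if "\<omega> \<in> space M" for \<omega>
  proof -
    interpret K: prob_space "\<kappa> \<omega>" by (rule \<kappa>_prob[OF that])
    interpret N: prob_space \<mu> by (rule prob_space_law)
    show "d \<omega> \<le> 1" unfolding d_def
    proof (rule cSUP_least)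
      show "\<bar>measure (\<kappa> \<omega>) C - measure \<mu> C\<bar> \<le> 1" for C
        using K.prob_le_1[of C] N.prob_le_1[of C] measure_nonneg[of "\<kappa> \<omega>" C] measure_nonneg[of \<mu> C] by linarith
    qed auto
    show "0 \<le> d \<omega>" using d_bdd[OF that, of "{}"] by simp
  qed
  have d_meas: "d \<in> borel_measurable M"
    unfolding d_def using borel_measurable_tv[OF \<kappa>_meas prob_space_law sets_law]
    by (rule measurable_from_subalg[OF subalgebra_past])
  have d_int: "integrable M d"
    using d_le d_meas by (intro integrable_const_bound[of _ 1]) auto
  have "(\<Sum>k\<in>I. \<integral>\<omega>. \<bar>past_prob (j k) (j k - int q) (A k) \<omega> - measure \<mu> (A k)\<bar> \<partial>M)
      \<le> (\<Sum>k\<in>I. \<integral>\<omega>. \<bar>past_prob 0 (- int q) (A k) \<omega> - measure \<mu> (A k)\<bar> \<partial>M)"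
    using A by (intro sum_mono L1_past_prob_shift_le)
  also have "\<dots> = (\<integral>\<omega>. (\<Sum>k\<in>I. \<bar>past_prob 0 (- int q) (A k) \<omega> - measure \<mu> (A k)\<bar>) \<partial>M)"
    using A by (subst Bochner_Integration.integral_sum) auto
  also have "\<dots> \<le> (\<integral>\<omega>. 2 * c * d \<omega> + (\<Sum>k\<in>I. past_prob 0 (- int q) (A k \<inter> T) \<omega> + measure \<mu> (A k \<inter> T)) \<partial>M)"
  proof (rule integral_mono_AE)
    show "integrable M (\<lambda>\<omega>. \<Sum>k\<in>I. \<bar>past_prob 0 (- int q) (A k) \<omega> - measure \<mu> (A k)\<bar>)"
      using A by auto
    show "integrable M (\<lambda>\<omega>. 2 * c * d \<omega> + (\<Sum>k\<in>I. past_prob 0 (- int q) (A k \<inter> T) \<omega> + measure \<mu> (A k \<inter> T)))"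
      using AT d_int by auto
    \<comment> \<open>Only the finitely many sets \<open>A k\<close> and
      \<open>A k \<inter> T\<close> enter, so one null set covers all these versions.\<close>
    have "AE \<omega> in M. \<forall>k\<in>I. measure (\<kappa> \<omega>) (A k) = past_prob 0 (- int q) (A k) \<omega> \<and>
        measure (\<kappa> \<omega>) (A k \<inter> T) = past_prob 0 (- int q) (A k \<inter> T) \<omega>"
      using \<kappa>_eq A AT I by (auto simp: AE_ball_countable countable_finite)
    then show "AE \<omega> in M. (\<Sum>k\<in>I. \<bar>past_prob 0 (- int q) (A k) \<omega> - measure \<mu> (A k)\<bar>)
        \<le> 2 * c * d \<omega> + (\<Sum>k\<in>I. past_prob 0 (- int q) (A k \<inter> T) \<omega> + measure \<mu> (A k \<inter> T))"
      using AE_space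
    proof eventually_elim
      case (elim \<omega>)
      have "(\<Sum>k\<in>I. \<bar>measure (\<kappa> \<omega>) (A k) - measure \<mu> (A k)\<bar>)
          \<le> 2 * c * d \<omega> + (\<Sum>k\<in>I. measure (\<kappa> \<omega>) (A k \<inter> T) + measure \<mu> (A k \<inter> T))"
        using elim(2) A by (intro sum_abs_measure_diff_le[OF \<kappa>_prob(1) prob_space_law _ I _ _ c T'(1)])
          (auto simp: \<kappa>_prob(2) d_bdd)
      then show ?case using elim(1) by simp
    qed
  qed
  also have "\<dots> = 2 * c * beta_inf_1 M X q + 2 * (\<Sum>k\<in>I. measure \<mu> (A k \<inter> T))"
    using AT d_int by (simp add: integral_past_prob sum.distrib prob_space \<kappa>(2) flip: d_def)
  finally show ?thesis .
qed

lemma beta_nonneg: "0 \<le> beta_inf_1 M X q"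
  \<comment> \<open>With no index and threshold 1 the inequality reads 0 \<le> 2 * beta.\<close>
  using sum_L1_past_prob_le[of "{}" "\<lambda>_. {}" 1 "{}" "\<lambda>_. 0" q] by simp

end

section \<open>Variance and bias of the number of hits\<close>

lemma (in prob_space) L1_le_sqrt_L2:
  fixes f :: "'a \<Rightarrow> real"
  assumes "integrable M f" "integrable M (\<lambda>x. (f x)\<^sup>2)"
  shows "(\<integral>x. \<bar>f x\<bar> \<partial>M) \<le> sqrt (\<integral>x. (f x)\<^sup>2 \<partial>M)"
proof (rule real_le_rsqrt)
  have "0 \<le> variance (\<lambda>x. \<bar>f x\<bar>)" by (rule variance_positive)
  also have "\<dots> = (\<integral>x. (f x)\<^sup>2 \<partial>M) - (\<integral>x. \<bar>f x\<bar> \<partial>M)\<^sup>2"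
    using variance_eq[of "\<lambda>x. \<bar>f x\<bar>"] assms by simp
  finally show "(\<integral>x. \<bar>f x\<bar> \<partial>M)\<^sup>2 \<le> (\<integral>x. (f x)\<^sup>2 \<partial>M)" by simp
qed

lemma card_near_le: "card {l\<in>{1..n}. k < l + q \<and> l < k + q} \<le> 2 * (q::nat)"
proof -
  have "card {l\<in>{1..n}. k < l + q \<and> l < k + q} \<le> card {Suc k - q..<k + q}"
    by (intro card_mono) auto
  then show ?thesis by simp
qed

section \<open>Innovations, biases and their norms\<close>

context stationary_process
begin

definition innovation :: "nat \<Rightarrow> (nat \<Rightarrow> 'e set) \<Rightarrow> nat \<Rightarrow> 'a \<Rightarrow> real" where
  "innovation q C k \<omega> =
     indicator (X (int k) -` C k \<inter> space M) \<omega> - past_prob (int k) (int k - int q) (C k) \<omega>"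

lemma AE_innovation_le_1:
  assumes "C k \<in> sets borel"
  shows "AE \<omega> in M. \<bar>innovation q C k \<omega>\<bar> \<le> 1"
  using AE_past_prob_bounds[OF assms, of "int k" "int k - int q"]
  by eventually_elim (auto simp: innovation_def indicator_def)

lemma borel_measurable_innovation_past:
  assumes "C k \<in> sets borel"
  shows "innovation q C k \<in> borel_measurable (past (int k))"
proof -
  have "X (int k) -` C k \<inter> space M \<in> sets (past (int k))"
    using measurable_sets[OF measurable_X_past[OF order_refl] assms] by simp
  moreover have "past_prob (int k) (int k - int q) (C k) \<in> borel_measurable (past (int k))"
    by (rule measurable_from_subalg[OF _ borel_measurable_past_prob])
      (use past_mono[of "int k - int q" "int k"] in \<open>auto simp: subalgebra_def\<close>)
  ultimately show ?thesis
    unfolding innovation_def[abs_def] by (intro borel_measurable_diff borel_measurable_indicator)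
qed

lemma borel_measurable_innovation:
  assumes "C k \<in> sets borel"
  shows "innovation q C k \<in> borel_measurable M"
  using borel_measurable_innovation_past[of C k q, OF assms] by (rule measurable_from_subalg[OF subalgebra_past])

lemma integrable_innovation_mult:
  assumes "C k \<in> sets borel" "C l \<in> sets borel"
  shows "integrable M (\<lambda>\<omega>. innovation q C k \<omega> * innovation q C l \<omega>)"
proof (rule integrable_const_bound[of _ 1])
  show "AE \<omega> in M. norm (innovation q C k \<omega> * innovation q C l \<omega>) \<le> 1"
    using AE_innovation_le_1[of C k q, OF assms(1)] AE_innovation_le_1[of C l q, OF assms(2)]
    by eventually_elim (auto simp: abs_mult intro!: mult_le_one)
qed (intro borel_measurable_times borel_measurable_innovation assms)

text \<open>For \<open>l + q \<le> k\<close> the earlier innovation is already known at time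
  \<open>k - q\<close>, and the later one has conditional mean zero given the past up to that
  time.\<close>

lemma innovation_orthogonal:
  assumes C: "C k \<in> sets borel" "C l \<in> sets borel" and kl: "l + q \<le> k"
  shows "(\<integral>\<omega>. innovation q C k \<omega> * innovation q C l \<omega> \<partial>M) = 0"
proof -
  interpret finite_measure_subalgebra M "past (int k - int q)" by (rule finite_measure_subalgebra_past)
  let ?B = "indicator (X (int k) -` C k \<inter> space M) :: 'a \<Rightarrow> real"
  let ?P = "past_prob (int k) (int k - int q) (C k)"
  have Yl: "innovation q C l \<in> borel_measurable (past (int k - int q))"
    by (rule measurable_from_subalg[OF _ borel_measurable_innovation_past[of C l q, OF C(2)]])
      (use kl past_mono[of "int l" "int k - int q"] in \<open>auto simp: subalgebra_def\<close>)
  have int: "integrable M (\<lambda>\<omega>. innovation q C l \<omega> * ?B \<omega>)"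
    using AE_innovation_le_1[of C l q, OF C(2)] C borel_measurable_innovation[of C l q, OF C(2)]
    by (intro integrable_const_bound[of _ 1]) (auto simp: indicator_def)
  have B: "?B \<in> borel_measurable M" using C by measurable
  note eq = real_cond_exp_intg[OF int Yl B, folded past_prob_def]
  have "(\<integral>\<omega>. innovation q C k \<omega> * innovation q C l \<omega> \<partial>M)
      = (\<integral>\<omega>. innovation q C l \<omega> * ?B \<omega> - innovation q C l \<omega> * ?P \<omega> \<partial>M)"
    by (simp add: innovation_def[of q C k] algebra_simps)
  also have "\<dots> = 0"
    using eq int by (subst Bochner_Integration.integral_diff) auto
  finally show ?thesis .
qed

text \<open>Conditional expectation is a projection: the indicator and its projection have the same
  inner product with the projection, so the second moment is the probability minus a square
  norm.\<close>

lemma innovation_variance_le: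
  assumes C: "C k \<in> sets borel"
  shows "(\<integral>\<omega>. (innovation q C k \<omega>)\<^sup>2 \<partial>M) \<le> measure \<mu> (C k)"
proof -
  interpret finite_measure_subalgebra M "past (int k - int q)" by (rule finite_measure_subalgebra_past)
  let ?B = "indicator (X (int k) -` C k \<inter> space M) :: 'a \<Rightarrow> real"
  let ?P = "past_prob (int k) (int k - int q) (C k)"
  have B: "?B \<in> borel_measurable M" using C by measurable
  have int: "integrable M (\<lambda>\<omega>. ?P \<omega> * ?B \<omega>)"
    using AE_past_prob_bounds[OF C, of "int k" "int k - int q"] C B
    by (intro integrable_const_bound[of _ 1]) (auto simp: indicator_def)
  note eq = real_cond_exp_intg[OF int borel_measurable_past_prob B, folded past_prob_def]
  have "(\<integral>\<omega>. (innovation q C k \<omega>)\<^sup>2 \<partial>M) = (\<integral>\<omega>. (?B \<omega> - 2 * (?P \<omega> * ?B \<omega>)) + ?P \<omega> * ?P \<omega> \<partial>M)"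
    by (intro Bochner_Integration.integral_cong)
      (auto simp: innovation_def power2_eq_square indicator_def algebra_simps)
  also have "\<dots> = measure \<mu> (C k) - (\<integral>\<omega>. ?P \<omega> * ?P \<omega> \<partial>M)"
    using eq int C by (simp add: measure_vimage Int_assoc)
  also have "\<dots> \<le> measure \<mu> (C k)" by simp
  finally show ?thesis .
qed

text \<open>Only pairs at distance less than \<open>q\<close> contribute. The inequality 2ab \<le>
  a^2 + b^2 bounds their covariance by terms depending on a single index; each index has at most
  \<open>2 * q\<close> neighbours, and by symmetry the two halves of the double sum are
  equal.\<close>

lemma sum_innovation_variance_le:
  assumes C: "\<And>k. 1 \<le> k \<Longrightarrow> C k \<in> sets borel"
  shows "integrable M (\<lambda>\<omega>. (\<Sum>k=1..n. innovation q C k \<omega>)\<^sup>2)"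
    and "(\<integral>\<omega>. (\<Sum>k=1..n. innovation q C k \<omega>)\<^sup>2 \<partial>M) \<le> 2 * real q * (\<Sum>k=1..n. measure \<mu> (C k))"
proof -
  let ?Y = "innovation q C"
  define p where "p k = measure \<mu> (C k)" for k
  have sq: "(\<Sum>k=1..n. ?Y k \<omega>)\<^sup>2 = (\<Sum>k=1..n. \<Sum>l=1..n. ?Y k \<omega> * ?Y l \<omega>)" for \<omega>
    by (simp add: power2_eq_square sum_product)
  show "integrable M (\<lambda>\<omega>. (\<Sum>k=1..n. ?Y k \<omega>)\<^sup>2)"
    unfolding sq using C by (intro Bochner_Integration.integrable_sum integrable_innovation_mult) auto
  \<comment> \<open>This is |k - l| < q, written with sums to avoid truncated subtraction.\<close>
  define near where "near k l \<longleftrightarrow> k < l + q \<and> l < k + q" for k l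
  have cov: "(\<integral>\<omega>. ?Y k \<omega> * ?Y l \<omega> \<partial>M) \<le> of_bool (near k l) * (p k / 2) + of_bool (near k l) * (p l / 2)"
    if "k \<in> {1..n}" "l \<in> {1..n}" for k l
  proof (cases "near k l")
    case True
    have "(\<integral>\<omega>. ?Y k \<omega> * ?Y l \<omega> \<partial>M) \<le> (\<integral>\<omega>. (?Y k \<omega>)\<^sup>2 / 2 + (?Y l \<omega>)\<^sup>2 / 2 \<partial>M)"
    proof (rule integral_mono)
      have "0 \<le> (?Y k \<omega> - ?Y l \<omega>)\<^sup>2" for \<omega> by simp
      then show "?Y k \<omega> * ?Y l \<omega> \<le> (?Y k \<omega>)\<^sup>2 / 2 + (?Y l \<omega>)\<^sup>2 / 2" for \<omega>
        unfolding power2_diff by (simp add: field_simps)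
    qed (use C that integrable_innovation_mult[of C k l] integrable_innovation_mult[of C k k]
        integrable_innovation_mult[of C l l] in \<open>auto simp: power2_eq_square\<close>)
    also have "\<dots> = (\<integral>\<omega>. (?Y k \<omega>)\<^sup>2 \<partial>M) / 2 + (\<integral>\<omega>. (?Y l \<omega>)\<^sup>2 \<partial>M) / 2"
      using C that integrable_innovation_mult[of C k k] integrable_innovation_mult[of C l l]
      by (simp add: power2_eq_square)
    also have "\<dots> \<le> p k / 2 + p l / 2"
      using C that innovation_variance_le[of C k q] innovation_variance_le[of C l q] by (simp add: p_def)
    finally show ?thesis using True by simp
  next
    case False
    then have "(\<integral>\<omega>. ?Y k \<omega> * ?Y l \<omega> \<partial>M) = 0"
      using innovation_orthogonal[of C k l q] innovation_orthogonal[of C l k q] C that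
      by (auto simp: near_def not_less mult.commute)
    with False show ?thesis by simp
  qed
  have near_count: "(\<Sum>l=1..n. of_bool (near k l) :: real) \<le> 2 * real q" for k
  proof -
    have "(\<Sum>l=1..n. of_bool (near k l) :: real) = card {l\<in>{1..n}. k < l + q \<and> l < k + q}"
      by (simp add: near_def Int_def flip: of_nat_sum)
    also have "\<dots> \<le> real (2 * q)" by (rule of_nat_mono[OF card_near_le])
    finally show ?thesis by simp
  qed
  have half: "(\<Sum>k=1..n. \<Sum>l=1..n. of_bool (near k l) * (p k / 2)) \<le> real q * (\<Sum>k=1..n. p k)"
  proof -
    have "(\<Sum>k=1..n. \<Sum>l=1..n. of_bool (near k l) * (p k / 2)) = (\<Sum>k=1..n. (\<Sum>l=1..n. of_bool (near k l)) * (p k / 2))"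
      by (simp only: sum_distrib_right)
    also have "\<dots> \<le> (\<Sum>k=1..n. (2 * real q) * (p k / 2))"
      by (intro sum_mono mult_right_mono near_count) (simp add: p_def)
    also have "\<dots> = real q * (\<Sum>k=1..n. p k)" by (simp add: sum_distrib_left)
    finally show ?thesis .
  qed
  have "(\<integral>\<omega>. (\<Sum>k=1..n. ?Y k \<omega>)\<^sup>2 \<partial>M) = (\<Sum>k=1..n. \<Sum>l=1..n. \<integral>\<omega>. ?Y k \<omega> * ?Y l \<omega> \<partial>M)"
    unfolding sq using C
    by (subst Bochner_Integration.integral_sum Bochner_Integration.integral_sum,
        auto intro!: Bochner_Integration.integrable_sum integrable_innovation_mult sum.cong
          Bochner_Integration.integral_sum)
  also have "\<dots> \<le> (\<Sum>k=1..n. \<Sum>l=1..n. of_bool (near k l) * (p k / 2) + of_bool (near k l) * (p l / 2))"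
    by (intro sum_mono cov)
  also have "\<dots> = (\<Sum>k=1..n. \<Sum>l=1..n. of_bool (near k l) * (p k / 2)) + (\<Sum>k=1..n. \<Sum>l=1..n. of_bool (near l k) * (p l / 2))"
    by (simp add: sum.distrib near_def conj_commute)
  also have "(\<Sum>k=1..n. \<Sum>l=1..n. of_bool (near l k) * (p l / 2)) = (\<Sum>k=1..n. \<Sum>l=1..n. of_bool (near k l) * (p k / 2))"
    by (rule sum.swap)
  also have "(\<Sum>k=1..n. \<Sum>l=1..n. of_bool (near k l) * (p k / 2)) + (\<Sum>k=1..n. \<Sum>l=1..n. of_bool (near k l) * (p k / 2))
      \<le> 2 * real q * (\<Sum>k=1..n. p k)"
    using half by linarith
  finally show "(\<integral>\<omega>. (\<Sum>k=1..n. ?Y k \<omega>)\<^sup>2 \<partial>M) \<le> 2 * real q * (\<Sum>k=1..n. measure \<mu> (C k))"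
    by (simp add: p_def)
qed

text \<open>\<open>U\<close> is controlled in mean square and \<open>V\<close> in mean, and they are
  kept apart so that almost sure convergence can be proved for each. The threshold \<open>c\<close>
  stays free after \<open>V\<close> is fixed, because (i), (ii) and (iii) choose it
  differently.\<close>

lemma hits_decomposition:
  assumes C: "\<And>k. 1 \<le> k \<Longrightarrow> C k \<in> sets borel"
  obtains U V where "integrable M U" "integrable M (\<lambda>\<omega>. (U \<omega>)\<^sup>2)" "integrable M V"
    "\<And>\<omega>. \<omega> \<in> space M \<Longrightarrow> (\<Sum>k=1..n. indicator (C k) (X (int k) \<omega>)) - (\<Sum>k=1..n. measure \<mu> (C k)) = U \<omega> + V \<omega>"
    "(\<integral>\<omega>. (U \<omega>)\<^sup>2 \<partial>M) \<le> 2 * real q * (\<Sum>k=1..n. measure \<mu> (C k))"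
    "\<And>c. 0 \<le> c \<Longrightarrow> (\<integral>\<omega>. \<bar>V \<omega>\<bar> \<partial>M) \<le> 2 * c * beta_inf_1 M X q
       + 2 * (\<Sum>k=1..n. measure \<mu> (C k \<inter> {x. (\<Sum>k=1..n. indicator (C k) x) > c}))"
proof -
  define U where "U \<omega> = (\<Sum>k=1..n. innovation q C k \<omega>)" for \<omega>
  define v where "v k \<omega> = past_prob (int k) (int k - int q) (C k) \<omega> - measure \<mu> (C k)" for k \<omega>
  define V where "V \<omega> = (\<Sum>k=1..n. v k \<omega>)" for \<omega>
  have v_int: "integrable M (v k)" if "1 \<le> k" for k
    unfolding v_def using C that by auto
  show ?thesis
  proof
    show "integrable M U"
      unfolding U_def
    proof (intro Bochner_Integration.integrable_sum)
      fix k assume "k \<in> {1..n}"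
      then show "integrable M (innovation q C k)"
        using C unfolding innovation_def[abs_def] by auto
    qed
    show "integrable M V" unfolding V_def using v_int by auto
    show "integrable M (\<lambda>\<omega>. (U \<omega>)\<^sup>2)" "(\<integral>\<omega>. (U \<omega>)\<^sup>2 \<partial>M) \<le> 2 * real q * (\<Sum>k=1..n. measure \<mu> (C k))"
      unfolding U_def using sum_innovation_variance_le[of C] C by auto
    show "(\<Sum>k=1..n. indicator (C k) (X (int k) \<omega>)) - (\<Sum>k=1..n. measure \<mu> (C k)) = U \<omega> + V \<omega>"
      if "\<omega> \<in> space M" for \<omega>
    proof -
      have "(\<Sum>k=1..n. indicator (C k) (X (int k) \<omega>)) - (\<Sum>k=1..n. measure \<mu> (C k))
          = (\<Sum>k=1..n. indicator (C k) (X (int k) \<omega>) - measure \<mu> (C k))"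
        by (simp add: sum_subtractf)
      also have "\<dots> = (\<Sum>k=1..n. innovation q C k \<omega> + v k \<omega>)"
        using that by (intro sum.cong) (auto simp: innovation_def v_def indicator_def)
      finally show ?thesis by (simp add: U_def V_def sum.distrib)
    qed
    fix c :: real assume c: "0 \<le> c"
    have "(\<integral>\<omega>. \<bar>V \<omega>\<bar> \<partial>M) \<le> (\<integral>\<omega>. (\<Sum>k=1..n. \<bar>v k \<omega>\<bar>) \<partial>M)"
      using v_int by (intro integral_mono integrable_abs Bochner_Integration.integrable_sum)
        (auto simp: V_def intro!: sum_abs)
    also have "\<dots> = (\<Sum>k=1..n. \<integral>\<omega>. \<bar>v k \<omega>\<bar> \<partial>M)"
      using v_int by (intro Bochner_Integration.integral_sum) auto
    also have "\<dots> \<le> 2 * c * beta_inf_1 M X q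
       + 2 * (\<Sum>k=1..n. measure \<mu> (C k \<inter> {x. (\<Sum>k=1..n. indicator (C k) x) > c}))"
      unfolding v_def using C c by (intro sum_L1_past_prob_le) auto
    finally show "(\<integral>\<omega>. \<bar>V \<omega>\<bar> \<partial>M) \<le> 2 * c * beta_inf_1 M X q
       + 2 * (\<Sum>k=1..n. measure \<mu> (C k \<inter> {x. (\<Sum>k=1..n. indicator (C k) x) > c}))" .
  qed
qed

lemma L1_hits_diff_le:
  assumes C: "\<And>k. 1 \<le> k \<Longrightarrow> C k \<in> sets borel" and c: "0 \<le> c"
  shows "(\<integral>\<omega>. \<bar>(\<Sum>k=1..n. indicator (C k) (X (int k) \<omega>)) - (\<Sum>k=1..n. measure \<mu> (C k))\<bar> \<partial>M)
    \<le> sqrt (2 * real q * (\<Sum>k=1..n. measure \<mu> (C k))) + 2 * c * beta_inf_1 M X q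
       + 2 * (\<Sum>k=1..n. measure \<mu> (C k \<inter> {x. (\<Sum>k=1..n. indicator (C k) x) > c}))"
proof -
  obtain U V where UV: "integrable M U" "integrable M (\<lambda>\<omega>. (U \<omega>)\<^sup>2)" "integrable M V"
    "\<And>\<omega>. \<omega> \<in> space M \<Longrightarrow> (\<Sum>k=1..n. indicator (C k) (X (int k) \<omega>)) - (\<Sum>k=1..n. measure \<mu> (C k)) = U \<omega> + V \<omega>"
    "(\<integral>\<omega>. (U \<omega>)\<^sup>2 \<partial>M) \<le> 2 * real q * (\<Sum>k=1..n. measure \<mu> (C k))"
    "\<And>c. 0 \<le> c \<Longrightarrow> (\<integral>\<omega>. \<bar>V \<omega>\<bar> \<partial>M) \<le> 2 * c * beta_inf_1 M X q
       + 2 * (\<Sum>k=1..n. measure \<mu> (C k \<inter> {x. (\<Sum>k=1..n. indicator (C k) x) > c}))"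
    by (rule hits_decomposition[of C n q, OF C]) (assumption, rule that)
  have "(\<integral>\<omega>. \<bar>(\<Sum>k=1..n. indicator (C k) (X (int k) \<omega>)) - (\<Sum>k=1..n. measure \<mu> (C k))\<bar> \<partial>M) = (\<integral>\<omega>. \<bar>U \<omega> + V \<omega>\<bar> \<partial>M)"
    by (intro Bochner_Integration.integral_cong refl) (simp only: UV(4))
  also have "\<dots> \<le> (\<integral>\<omega>. \<bar>U \<omega>\<bar> + \<bar>V \<omega>\<bar> \<partial>M)"
    using UV(1,3) by (intro integral_mono) auto
  also have "\<dots> = (\<integral>\<omega>. \<bar>U \<omega>\<bar> \<partial>M) + (\<integral>\<omega>. \<bar>V \<omega>\<bar> \<partial>M)"
    using UV(1,3) by simp
  also have "(\<integral>\<omega>. \<bar>U \<omega>\<bar> \<partial>M) \<le> sqrt (2 * real q * (\<Sum>k=1..n. measure \<mu> (C k)))"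
    using L1_le_sqrt_L2[OF UV(1,2)] UV(5) by (meson order_trans real_sqrt_le_iff)
  finally show ?thesis using UV(6)[OF c] by linarith
qed

end

section \<open>The Borel-Cantelli property\<close>

lemma sum_indicator_disjoint_family_le_1:
  assumes "disjoint_family D"
  shows "(\<Sum>i<(m::nat). indicator (D i) x :: real) \<le> 1"
proof -
  have "(\<Sum>i<m. indicator (D i) x :: real) = indicator (\<Union>i<m. D i) x"
    using assms by (subst indicator_UN_disjoint) (auto simp: disjoint_family_on_def)
  then show ?thesis by (simp add: indicator_def)
qed

context stationary_process
begin

text \<open>
  Each block of indices contributes at least \<open>a\<close> to the mass, and making the sets disjoint inside a block
  keeps its contribution to the count at most \<open>1\<close>.
\<close>

lemma disjointed_blocks:
  assumes A: "\<And>k. 1 \<le> k \<Longrightarrow> A k \<in> sets borel" and N: "1 \<le> N"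
    and a: "a < measure \<mu> (limsup A)"
  shows "\<exists>n C. (\<forall>k\<ge>1. C k \<in> sets borel \<and> C k \<subseteq> A k) \<and> (\<forall>k<N. C k = {}) \<and> N \<le> Suc n \<and>
    (\<forall>x. (\<Sum>k=1..n. indicator (C k) x) \<le> real J) \<and> real J * a \<le> (\<Sum>k=1..n. measure \<mu> (C k))"
proof (induction J)
  case 0
  show ?case
    by (intro exI[of _ N] exI[of _ "\<lambda>_. {}"]) auto
next
  case (Suc J)
  interpret N: prob_space \<mu> by (rule prob_space_law)
  from Suc obtain n C where C: "\<And>k. 1 \<le> k \<Longrightarrow> C k \<in> sets borel" "\<And>k. 1 \<le> k \<Longrightarrow> C k \<subseteq> A k"
    "\<And>k. k < N \<Longrightarrow> C k = {}" "N \<le> Suc n" "\<And>x. (\<Sum>k=1..n. indicator (C k) x) \<le> real J"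
    "real J * a \<le> (\<Sum>k=1..n. measure \<mu> (C k))" by blast
  \<comment> \<open>The next block starts right after \<open>n\<close>. The union of the remaining
    sets contains \<open>limsup A\<close>, so by continuity from below a finite block already has
    mass above \<open>a\<close>.\<close>
  define A' where "A' i = A (Suc n + i)" for i
  have A': "A' i \<in> sets borel" for i using A by (auto simp: A'_def)
  define V where "V m = (\<Union>i<m. A' i)" for m
  have "(\<lambda>m. measure \<mu> (V m)) \<longlonglongrightarrow> measure \<mu> (\<Union>m. V m)"
    using A' by (intro N.finite_Lim_measure_incseq) (fastforce simp: V_def incseq_def)+
  moreover have "a < measure \<mu> (\<Union>m. V m)"
  proof -
    have "limsup A \<subseteq> (\<Union>m. V m)"
    proof
      fix x assume "x \<in> limsup A"
      then obtain k where "Suc n \<le> k" "x \<in> A k"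
        by (auto simp: mem_limsup_iff frequently_sequentially)
      then have "x \<in> V (Suc (k - Suc n))" by (force simp: V_def A'_def)
      then show "x \<in> (\<Union>m. V m)" by blast
    qed
    then have "measure \<mu> (limsup A) \<le> measure \<mu> (\<Union>m. V m)"
      using A' by (intro N.finite_measure_mono) (auto simp: V_def)
    with a show ?thesis by simp
  qed
  ultimately have "eventually (\<lambda>m. a < measure \<mu> (V m)) sequentially"
    by (rule order_tendstoD)
  then obtain m where m: "a < measure \<mu> (V m)" by (auto simp: eventually_sequentially)
  \<comment> \<open>Disjointing keeps the union, hence the mass of the block, while the block now
    adds at most 1 to the count.\<close>
  define D where "D = disjointed A'"
  have D: "disjoint_family D" "\<And>i. D i \<subseteq> A' i" "\<And>i. D i \<in> sets borel"
    unfolding D_def using A' sets.range_disjointed_sets[of A' borel]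
    by (auto intro: disjoint_family_disjointed disjointed_subset[THEN subsetD])
  define C' where "C' k = (if k \<le> n then C k else D (k - Suc n))" for k
  have split: "(\<Sum>k=1..n+m. f k) = (\<Sum>k=1..n. f k) + (\<Sum>i<m. f (Suc n + i))" for f :: "nat \<Rightarrow> real"
  proof -
    have "(\<Sum>k=1..n+m. f k) = (\<Sum>k=1..n. f k) + (\<Sum>k=Suc n..n+m. f k)"
      using sum.ub_add_nat[of 1 n f m] by simp
    also have "(\<Sum>k=Suc n..n+m. f k) = (\<Sum>i<m. f (Suc n + i))"
      by (rule sum.reindex_bij_witness[of _ "\<lambda>i. Suc n + i" "\<lambda>k. k - Suc n"]) auto
    finally show ?thesis .
  qed
  show ?case
  proof (intro exI[of _ "n + m"] exI[of _ C'] conjI allI impI)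
    fix k :: nat assume "1 \<le> k"
    show "C' k \<in> sets borel"
      using C(1)[OF \<open>1 \<le> k\<close>] D(3) by (simp add: C'_def)
    show "C' k \<subseteq> A k"
      using C(2)[OF \<open>1 \<le> k\<close>] D(2)[of "k - Suc n"] by (auto simp: C'_def A'_def not_le)
  next
    show "C' k = {}" if "k < N" for k using that C(3)[OF that] C(4) by (simp add: C'_def)
    show "N \<le> Suc (n + m)" using C(4) by simp
  next
    fix x
    have "(\<Sum>k=1..n+m. indicator (C' k) x :: real) = (\<Sum>k=1..n. indicator (C k) x) + (\<Sum>i<m. indicator (D i) x)"
      unfolding split by (simp add: C'_def)
    also have "\<dots> \<le> real J + 1"
      by (intro add_mono C(5) sum_indicator_disjoint_family_le_1 D(1))
    finally show "(\<Sum>k=1..n+m. indicator (C' k) x) \<le> real (Suc J)" by simp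
  next
    have "a \<le> measure \<mu> (\<Union>i<m. D i)"
      using m finite_UN_disjointed_eq[of A' m] by (simp add: V_def D_def lessThan_atLeast0)
    also have "\<dots> = (\<Sum>i<m. measure \<mu> (D i))"
      using D(1,3) by (intro N.finite_measure_finite_Union) (auto simp: disjoint_family_on_def)
    finally have "real J * a + a \<le> (\<Sum>k=1..n. measure \<mu> (C k)) + (\<Sum>i<m. measure \<mu> (D i))"
      using C(6) by linarith
    also have "\<dots> = (\<Sum>k=1..n+m. measure \<mu> (C' k))"
      unfolding split by (simp add: C'_def)
    finally show "real (Suc J) * a \<le> (\<Sum>k=1..n+m. measure \<mu> (C' k))" by (simp add: algebra_simps)
  qed
qed

text \<open>A Markov argument: without a hit from \<open>N\<close> on, the count \<open>S\<close> of
  the thinned sets is 0, so its deviation from its mean \<open>e\<close> equals \<open>e\<close>.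
  The threshold \<open>J\<close> is never exceeded, which removes the tail term, and
  \<open>e\<close> lies between \<open>J * a\<close> and \<open>J\<close>, so division by
  \<open>J * a\<close> gives the bound.\<close>

lemma prob_no_hit_le:
  assumes A: "\<And>k. 1 \<le> k \<Longrightarrow> A k \<in> sets borel" and N: "1 \<le> N"
    and a: "0 < a" "a < measure \<mu> (limsup A)" and J: "1 \<le> J"
  shows "measure M {\<omega>\<in>space M. \<forall>k\<ge>N. X (int k) \<omega> \<notin> A k} \<le> (sqrt (2 * real q / real J) + 2 * beta_inf_1 M X q) / a"
proof -
  obtain n C where C: "\<And>k. 1 \<le> k \<Longrightarrow> C k \<in> sets borel" "\<And>k. 1 \<le> k \<Longrightarrow> C k \<subseteq> A k"
    "\<And>k. k < N \<Longrightarrow> C k = {}" "\<And>x. (\<Sum>k=1..n. indicator (C k) x) \<le> real J"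
    "real J * a \<le> (\<Sum>k=1..n. measure \<mu> (C k))"
    using disjointed_blocks[OF A N a(2), of J] by blast
  interpret N: prob_space \<mu> by (rule prob_space_law)
  define e where "e = (\<Sum>k=1..n. measure \<mu> (C k))"
  define S where "S \<omega> = (\<Sum>k=1..n. indicator (C k) (X (int k) \<omega>) :: real)" for \<omega>
  have S_meas: "S \<in> borel_measurable M"
    unfolding S_def using C(1)
    by (intro borel_measurable_sum measurable_compose[OF X_measurable] borel_measurable_indicator) auto
  have S_int: "integrable M (\<lambda>\<omega>. \<bar>S \<omega> - e\<bar>)"
  proof (intro integrable_abs Bochner_Integration.integrable_diff)
    have "0 \<le> S \<omega> \<and> S \<omega> \<le> real n" for \<omega>
      unfolding S_def using sum_mono[of "{1..n}" "\<lambda>k. indicator (C k) (X (int k) \<omega>) :: real" "\<lambda>_. 1"]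
      by (auto intro!: sum_nonneg simp: indicator_def)
    then show "integrable M S" using S_meas by (intro integrable_const_bound[of _ "real n"]) auto
  qed auto
  have e_pos: "0 < real J * a" "real J * a \<le> e" using a J C(5) by (auto simp: e_def)
  have e_le: "e \<le> real J"
  proof -
    have "e = (\<integral>x. (\<Sum>k=1..n. indicator (C k) x) \<partial>\<mu>)"
      unfolding e_def using C(1)
      by (subst Bochner_Integration.integral_sum) (auto simp: N.emeasure_eq_measure intro!: integrable_real_indicator)
    also have "\<dots> \<le> (\<integral>x. real J \<partial>\<mu>)"
      using C(1,4) by (intro integral_mono) (auto simp: N.emeasure_eq_measure intro!: integrable_real_indicator)
    finally show ?thesis using N.prob_space by simp
  qed
  define G where "G = {\<omega>\<in>space M. \<forall>k\<ge>N. X (int k) \<omega> \<notin> A k}"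
  have XA: "{\<omega>\<in>space M. X (int k) \<omega> \<notin> A k} \<in> sets M" if "N \<le> k" for k
    using measurable_sets[OF X_measurable[of "int k"], of "- A k"] A[of k] N that
    by (auto simp: vimage_def Int_def conj_commute)
  have "G = (\<Inter>k\<in>{N..}. {\<omega>\<in>space M. X (int k) \<omega> \<notin> A k})" by (auto simp: G_def)
  also have "\<dots> \<in> sets M" by (intro sets.countable_INT') (use XA in auto)
  finally have G: "G \<in> sets M" .
  have no_hit: "S \<omega> = 0" if "\<omega> \<in> G" for \<omega>
    unfolding S_def
  proof (intro sum.neutral ballI)
    fix k assume "k \<in> {1..n}"
    then show "(indicator (C k) (X (int k) \<omega>) :: real) = 0"
      using that C(2)[of k] C(3)[of k] by (cases "k < N") (auto simp: G_def indicator_def)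
  qed
  have "e * measure M G = (\<integral>\<omega>. e * indicator G \<omega> \<partial>M)"
    using G sets.sets_into_space[OF G] by (simp add: Int_absorb2)
  also have "\<dots> \<le> (\<integral>\<omega>. \<bar>S \<omega> - e\<bar> \<partial>M)"
    using G S_int no_hit by (intro integral_mono integrable_mult_right integrable_real_indicator)
      (auto simp: indicator_def emeasure_eq_measure)
  also have "\<dots> \<le> sqrt (2 * real q * e) + 2 * real J * beta_inf_1 M X q + 2 * (\<Sum>k=1..n. measure \<mu> (C k \<inter> {x. (\<Sum>k=1..n. indicator (C k) x) > real J}))"
    unfolding S_def e_def using C(1) by (intro L1_hits_diff_le) auto
  also have "{x. (\<Sum>k=1..n. indicator (C k) x) > real J} = {}"
    using C(4) by (auto simp: not_less)
  finally have "e * measure M G \<le> sqrt (2 * real q * e) + 2 * real J * beta_inf_1 M X q" by simp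
  moreover have "sqrt (2 * real q * e) \<le> sqrt (2 * real q * real J)"
    using e_le by (simp add: mult_left_mono)
  moreover have "real J * a * measure M G \<le> e * measure M G"
    by (intro mult_right_mono e_pos measure_nonneg)
  ultimately have "real J * a * measure M G \<le> sqrt (2 * real q * real J) + 2 * real J * beta_inf_1 M X q"
    by linarith
  also have "sqrt (2 * real q * real J) = real J * sqrt (2 * real q / real J)"
    using J by (simp add: real_sqrt_mult real_sqrt_divide field_simps)
  also have "real J * sqrt (2 * real q / real J) + 2 * real J * beta_inf_1 M X q
      = real J * (sqrt (2 * real q / real J) + 2 * beta_inf_1 M X q)" by (simp add: algebra_simps)
  finally have "a * measure M G \<le> sqrt (2 * real q / real J) + 2 * beta_inf_1 M X q"
    using J by (simp add: mult.assoc)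
  then show ?thesis
    using a by (simp add: G_def pos_le_divide_eq mult.commute)
qed

text \<open>For a fixed lag, more and more blocks remove the variance term; then the lag tends to
  infinity and removes beta. Hence having no hit from \<open>N\<close> on is a null event for each
  \<open>N \<ge> 1\<close>.\<close>

lemma borel_cantelli_if_limsup_pos:
  assumes A: "\<And>k. 1 \<le> k \<Longrightarrow> A k \<in> sets borel" and B: "\<And>k. 1 \<le> k \<Longrightarrow> B k = {\<omega>\<in>space M. X (int k) \<omega> \<in> A k}"
    and pos: "0 < measure \<mu> (limsup A)" and beta: "(\<lambda>n. beta_inf_1 M X n) \<longlonglongrightarrow> 0"
  shows "borel_cantelli_seq M B"
proof -
  \<comment> \<open>Half the mass leaves the strict inequality that finite blocks need.\<close>
  define a where "a = measure \<mu> (limsup A) / 2"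
  have a: "0 < a" "a < measure \<mu> (limsup A)" using pos by (auto simp: a_def)
  define G where "G N = {\<omega>\<in>space M. \<forall>k\<ge>N. X (int k) \<omega> \<notin> A k}" for N :: nat
  have XA: "{\<omega>\<in>space M. X (int k) \<omega> \<notin> A k} \<in> sets M" if "1 \<le> k" for k
    using measurable_sets[OF X_measurable[of "int k"], of "- A k"] A[of k] that
    by (auto simp: vimage_def Int_def conj_commute)
  have G: "G N \<in> sets M" if "1 \<le> N" for N
  proof -
    have "G N = (\<Inter>k\<in>{N..}. {\<omega>\<in>space M. X (int k) \<omega> \<notin> A k})" by (auto simp: G_def)
    also have "\<dots> \<in> sets M" by (intro sets.countable_INT') (use XA that in auto)
    finally show ?thesis .
  qed
  have G_0: "measure M (G N) = 0" if N: "1 \<le> N" for N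
  proof -
    have 1: "measure M (G N) \<le> 2 * beta_inf_1 M X q / a" for q
    proof (rule LIMSEQ_le_const)
      have "(\<lambda>J. 2 * real q / real J) \<longlonglongrightarrow> 0"
        by (rule lim_const_over_n)
      from tendsto_real_sqrt[OF this]
      have "(\<lambda>J. (sqrt (2 * real q / real J) + 2 * beta_inf_1 M X q) / a) \<longlonglongrightarrow> (sqrt 0 + 2 * beta_inf_1 M X q) / a"
        using a(1) by (intro tendsto_intros) auto
      then show "(\<lambda>J. (sqrt (2 * real q / real J) + 2 * beta_inf_1 M X q) / a) \<longlonglongrightarrow> 2 * beta_inf_1 M X q / a"
        by simp
      show "\<exists>J0. \<forall>J\<ge>J0. measure M (G N) \<le> (sqrt (2 * real q / real J) + 2 * beta_inf_1 M X q) / a"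
        unfolding G_def using prob_no_hit_le[OF A N a, of _ q] by (intro exI[of _ 1]) auto
    qed
    have "measure M (G N) \<le> 0"
    proof (rule LIMSEQ_le_const)
      show "(\<lambda>q. 2 * beta_inf_1 M X q / a) \<longlonglongrightarrow> 0"
        using tendsto_divide[OF tendsto_mult_left[OF beta, of 2] tendsto_const[of a]] a(1) by simp
    qed (use 1 in auto)
    then show ?thesis by (simp add: measure_le_0_iff)
  qed
  \<comment> \<open>Indices start at \<open>Suc N\<close> because \<open>B 0\<close> is
    unconstrained.\<close>
  have eq: "limsup B = space M - (\<Union>N. G (Suc N))"
  proof (intro set_eqI iffI)
    fix \<omega> assume "\<omega> \<in> limsup B"
    then have *: "\<exists>k\<ge>N. \<omega> \<in> B k" for N by (simp add: mem_limsup_iff frequently_sequentially)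
    then show "\<omega> \<in> space M - (\<Union>N. G (Suc N))"
      using B *[of 1] by (auto simp: G_def) (metis (mono_tags, lifting) "*" B One_nat_def Suc_le_mono le0 mem_Collect_eq order_trans)
  next
    fix \<omega> assume \<omega>: "\<omega> \<in> space M - (\<Union>N. G (Suc N))"
    have "\<exists>k\<ge>N. \<omega> \<in> B k" for N
    proof -
      obtain k where "Suc N \<le> k" "X (int k) \<omega> \<in> A k"
        using \<omega> by (auto simp: G_def)
      then show ?thesis using B[of k] \<omega> by (intro exI[of _ k]) auto
    qed
    then show "\<omega> \<in> limsup B" by (simp add: mem_limsup_iff frequently_sequentially)
  qed
  have "emeasure M (\<Union>N. G (Suc N)) = 0"
    using G G_0 by (intro emeasure_UN_eq_0) (auto simp: emeasure_eq_measure)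
  then have "measure M (\<Union>N. G (Suc N)) = 0" by (simp add: measure_def)
  moreover have "(\<Union>N. G (Suc N)) \<in> sets M" using G by auto
  ultimately have "measure M (limsup B) = 1"
    unfolding eq by (simp add: prob_compl)
  then show ?thesis by (simp add: borel_cantelli_seq_def)
qed

end

section \<open>Quantile functions\<close>

lemma (in prob_space) tail_antimono:
  assumes "Z \<in> borel_measurable M" "s \<le> t"
  shows "measure M {x\<in>space M. Z x > t} \<le> measure M {x\<in>space M. Z x > (s::real)}"
  using assms by (intro finite_measure_mono) auto

text \<open>Guarantees that the infimum defining the quantile is over a nonempty set; at
  \<open>u = 0\<close> this can fail for unbounded \<open>Z\<close>.\<close>

lemma (in prob_space) tail_le_exists:
  fixes Z :: "'a \<Rightarrow> real"
  assumes Z[measurable]: "Z \<in> borel_measurable M" and u: "0 < u"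
  shows "\<exists>t\<ge>0. measure M {x\<in>space M. Z x > t} \<le> u"
proof -
  have "(\<lambda>n. measure M {x\<in>space M. Z x > real n}) \<longlonglongrightarrow> measure M (\<Inter>n. {x\<in>space M. Z x > real n})"
    by (intro finite_Lim_measure_decseq) (auto simp: decseq_def)
  also have "(\<Inter>n. {x\<in>space M. Z x > real n}) = {}"
    using real_arch_simple by (auto simp flip: not_le)
  finally have "eventually (\<lambda>n. measure M {x\<in>space M. Z x > real n} < u) sequentially"
    using u by (auto intro: order_tendstoD)
  then obtain n where "measure M {x\<in>space M. Z x > real n} < u" by (auto simp: eventually_sequentially)
  then show ?thesis by (intro exI[of _ "real n"]) auto
qed

text \<open>The second property says that the infimum is attained: the tail function is
  right-continuous, which is checked along the thresholds \<open>1 / real (Suc n)\<close> above the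
  quantile. The last property is its contrapositive combined with monotonicity.\<close>

lemma (in prob_space)
  fixes Z :: "'a \<Rightarrow> real"
  assumes Z[measurable]: "Z \<in> borel_measurable M" and u: "0 < u"
  shows tail_quantile_nonneg: "0 \<le> tail_quantile M Z u"
    and tail_tail_quantile_le: "measure M {x\<in>space M. Z x > tail_quantile M Z u} \<le> u"
    and tail_quantile_antimono: "u \<le> v \<Longrightarrow> tail_quantile M Z v \<le> tail_quantile M Z u"
    and tail_quantile_gt: "0 \<le> t \<Longrightarrow> u < measure M {x\<in>space M. Z x > t} \<Longrightarrow> t < tail_quantile M Z u"
proof -
  define S where "S u = {t. t \<ge> 0 \<and> measure M {x\<in>space M. Z x > t} \<le> u}" for u
  have Q: "tail_quantile M Z u = Inf (S u)" for u by (simp add: tail_quantile_def S_def)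
  have ne: "S u \<noteq> {}" using tail_le_exists[OF Z u] by (auto simp: S_def)
  have bdd: "bdd_below (S v)" for v by (rule bdd_belowI[of _ 0]) (auto simp: S_def)
  show nonneg: "0 \<le> tail_quantile M Z u"
    unfolding Q by (rule cInf_greatest[OF ne]) (auto simp: S_def)
  show "tail_quantile M Z v \<le> tail_quantile M Z u" if "u \<le> v"
    unfolding Q using that by (intro cInf_superset_mono ne bdd) (auto simp: S_def)
  let ?c = "tail_quantile M Z u"
  show tail: "measure M {x\<in>space M. Z x > ?c} \<le> u"
  proof (rule LIMSEQ_le_const2)
    have "(\<lambda>n. measure M {x\<in>space M. Z x > ?c + 1 / real (Suc n)}) \<longlonglongrightarrow> measure M (\<Union>n. {x\<in>space M. Z x > ?c + 1 / real (Suc n)})"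
    proof (intro finite_Lim_measure_incseq)
      show "incseq (\<lambda>n. {x\<in>space M. Z x > ?c + 1 / real (Suc n)})"
      proof (intro incseq_SucI Collect_mono impI, elim conjE, intro conjI)
        fix n x assume "?c + 1 / real (Suc n) < Z x"
        moreover have "1 / real (Suc (Suc n)) \<le> 1 / real (Suc n)" by (simp add: field_simps)
        ultimately show "?c + 1 / real (Suc (Suc n)) < Z x" by linarith
      qed
    qed auto
    also have "(\<Union>n. {x\<in>space M. Z x > ?c + 1 / real (Suc n)}) = {x\<in>space M. Z x > ?c}"
    proof (intro set_eqI iffI)
      fix x assume "x \<in> (\<Union>n. {x\<in>space M. Z x > ?c + 1 / real (Suc n)})"
      then obtain n where "x \<in> space M" "?c + 1 / real (Suc n) < Z x" by auto
      moreover have "0 < 1 / real (Suc n)" by simp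
      ultimately have "x \<in> space M" "?c < Z x" by linarith+
      then show "x \<in> {x\<in>space M. Z x > ?c}" by simp
    next
      fix x assume x: "x \<in> {x\<in>space M. Z x > ?c}"
      then obtain n where "inverse (real (Suc n)) < Z x - ?c" using reals_Archimedean[of "Z x - ?c"] by auto
      then show "x \<in> (\<Union>n. {x\<in>space M. Z x > ?c + 1 / real (Suc n)})"
        using x by (auto simp: inverse_eq_divide algebra_simps simp del: of_nat_Suc)
    qed
    finally show "(\<lambda>n. measure M {x\<in>space M. Z x > ?c + 1 / real (Suc n)}) \<longlonglongrightarrow> measure M {x\<in>space M. Z x > ?c}" .
    have "measure M {x\<in>space M. Z x > ?c + 1 / real (Suc n)} \<le> u" for n
    proof -
      have "Inf (S u) < ?c + 1 / real (Suc n)" unfolding Q by simp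
      then obtain t where t: "t \<in> S u" "t < ?c + 1 / real (Suc n)"
        using cInf_lessD[OF ne] by auto
      then show ?thesis
        using tail_antimono[OF Z, of t "?c + 1 / real (Suc n)"] by (simp add: S_def del: of_nat_Suc)
    qed
    then show "\<exists>N. \<forall>n\<ge>N. measure M {x\<in>space M. Z x > ?c + 1 / real (Suc n)} \<le> u" by blast
  qed
  show "t < ?c" if t: "0 \<le> t" "u < measure M {x\<in>space M. Z x > t}"
  proof (rule ccontr)
    assume "\<not> t < ?c"
    then have "measure M {x\<in>space M. Z x > t} \<le> u"
      using tail_antimono[OF Z, of ?c t] tail by simp
    with t show False by simp
  qed
qed

text \<open>Both sides are compared through their layer cake representations in the height \<open>t\<close>.\<close>

lemma (in prob_space) tail_integral_le_quantile_integral: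
  fixes Z :: "'a \<Rightarrow> real"
  assumes Z[measurable]: "Z \<in> borel_measurable M" and Z0: "\<And>x. 0 \<le> Z x" and u: "0 < u"
  defines "c \<equiv> tail_quantile M Z u"
  defines "I \<equiv> \<integral>\<^sup>+s\<in>{0..u}. ennreal (tail_quantile M Z s) \<partial>lborel"
  shows "(\<integral>\<^sup>+x. ennreal (Z x) * indicator {x. Z x > c} x \<partial>M) \<le> I" and "ennreal (c * u) \<le> I"
proof -
  define m where "m t = measure M {x\<in>space M. Z x > t}" for t
  \<comment> \<open>A region below the graph of the quantile function on (0,u]: there both
    \<open>t < c\<close> and \<open>s < m t\<close> force \<open>t\<close> below the quantile at
    \<open>s\<close>. The point \<open>s = 0\<close> is left out since the quantile may be
    unspecified there.\<close>
  define G where "G s t \<longleftrightarrow> 0 < s \<and> s \<le> u \<and> 0 \<le> t \<and> (t < c \<or> s < m t)" for s t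
  have c0: "0 \<le> c" unfolding c_def by (rule tail_quantile_nonneg[OF Z u])
  have mc: "m c \<le> u" unfolding m_def c_def by (rule tail_tail_quantile_le[OF Z u])
  have m_anti: "m t \<le> m s" if "s \<le> t" for s t unfolding m_def by (rule tail_antimono[OF Z that])
  have m_meas[measurable]: "m \<in> borel_measurable borel"
  proof -
    have "(\<lambda>t. - m t) \<in> borel_measurable borel"
      by (rule borel_measurable_mono) (auto simp: mono_def m_anti)
    then show ?thesis by simp
  qed
  have layer: "(\<integral>\<^sup>+t. indicator {0..<y} t \<partial>lborel) = ennreal y" if "0 \<le> y" for y :: real
    using that by simp
  \<comment> \<open>Lengths of the horizontal slices of \<open>G\<close>: at least \<open>u\<close>
    below height \<open>c\<close> and at least the tail \<open>m t\<close> above it. The first bound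
    yields \<open>c * u\<close>; both together yield the truncated mean.\<close>
  define w where "w t = (\<integral>\<^sup>+s. indicator {s. G s t} s \<partial>lborel)" for t
  have w1: "ennreal u \<le> w t" if "0 \<le> t" "t < c" for t
  proof -
    have "{s. G s t} = {0<..u}" using that by (auto simp: G_def)
    then show ?thesis using u by (simp add: w_def)
  qed
  have w2: "ennreal (m t) \<le> w t" if "0 \<le> t" "c \<le> t" for t
  proof -
    have "m t \<le> u" using m_anti[OF that(2)] mc by simp
    then have "{s. G s t} = {0<..<m t}" using that by (auto simp: G_def)
    then show ?thesis by (simp add: w_def m_def)
  qed
  interpret MB: pair_sigma_finite M "lborel :: real measure"
    by (intro pair_sigma_finite.intro sigma_finite_measure_axioms sigma_finite_lborel)
  have "(\<integral>\<^sup>+t. w t \<partial>lborel) = (\<integral>\<^sup>+t. \<integral>\<^sup>+s. indicator {z. G (fst z) (snd z)} (s, t) \<partial>lborel \<partial>lborel)"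
    unfolding w_def by (intro nn_integral_cong) (auto simp: indicator_def)
  also have "\<dots> = (\<integral>\<^sup>+s. \<integral>\<^sup>+t. indicator {z. G (fst z) (snd z)} (s, t) \<partial>lborel \<partial>lborel)"
  proof (rule lborel_pair.Fubini)
    have "{z\<in>space (lborel \<Otimes>\<^sub>M lborel). G (fst z) (snd z)} \<in> sets (lborel \<Otimes>\<^sub>M lborel)"
      unfolding G_def by measurable
    then show "indicator {z. G (fst z) (snd z)} \<in> borel_measurable (lborel \<Otimes>\<^sub>M lborel)"
      by (intro borel_measurable_indicator) (simp add: space_pair_measure)
  qed
  also have "\<dots> \<le> (\<integral>\<^sup>+s. ennreal (tail_quantile M Z s) * indicator {0..u} s \<partial>lborel)"
  proof (rule nn_integral_mono)
    fix s :: real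
    show "(\<integral>\<^sup>+t. indicator {z. G (fst z) (snd z)} (s, t) \<partial>lborel) \<le> ennreal (tail_quantile M Z s) * indicator {0..u} s"
    proof (cases "0 < s \<and> s \<le> u")
      case True
      then have s: "0 < s" "s \<le> u" by auto
      have "t < tail_quantile M Z s" if "G s t" for t
        using that tail_quantile_gt[OF Z s(1), of t] tail_quantile_antimono[OF Z s]
        by (auto simp: G_def m_def c_def)
      then have "(\<integral>\<^sup>+t. indicator {z. G (fst z) (snd z)} (s, t) \<partial>lborel) \<le> (\<integral>\<^sup>+t. indicator {0..<tail_quantile M Z s} t \<partial>lborel)"
        by (intro nn_integral_mono) (auto simp: indicator_def G_def)
      also have "\<dots> = ennreal (tail_quantile M Z s)" by (rule layer[OF tail_quantile_nonneg[OF Z s(1)]])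
      finally show ?thesis using s by simp
    next
      case False
      then have "\<not> G s t" for t by (auto simp: G_def)
      then show ?thesis by simp
    qed
  qed
  finally have w_le: "(\<integral>\<^sup>+t. w t \<partial>lborel) \<le> I" by (simp add: I_def)
  have "ennreal (c * u) = (\<integral>\<^sup>+t. ennreal u * indicator {0..<c} t \<partial>lborel)"
    using c0 u by (simp add: nn_integral_cmult layer ennreal_mult mult.commute)
  also have "\<dots> \<le> (\<integral>\<^sup>+t. w t \<partial>lborel)"
    using w1 by (intro nn_integral_mono) (auto simp: indicator_def)
  finally show "ennreal (c * u) \<le> I" using w_le by simp
  have "(\<integral>\<^sup>+x. ennreal (Z x) * indicator {x. Z x > c} x \<partial>M)
      = (\<integral>\<^sup>+x. \<integral>\<^sup>+t. indicator {z. 0 \<le> snd z \<and> snd z < Z (fst z) \<and> c < Z (fst z)} (x, t) \<partial>lborel \<partial>M)"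
  proof (rule nn_integral_cong)
    fix x assume "x \<in> space M"
    show "ennreal (Z x) * indicator {x. Z x > c} x = (\<integral>\<^sup>+t. indicator {z. 0 \<le> snd z \<and> snd z < Z (fst z) \<and> c < Z (fst z)} (x, t) \<partial>lborel)"
    proof (cases "c < Z x")
      case True
      have "(\<integral>\<^sup>+t. indicator {z. 0 \<le> snd z \<and> snd z < Z (fst z) \<and> c < Z (fst z)} (x, t) \<partial>lborel) = (\<integral>\<^sup>+t. indicator {0..<Z x} t \<partial>lborel)"
        using True by (intro nn_integral_cong) (auto simp: indicator_def)
      then show ?thesis using True layer[OF Z0] by simp
    qed simp
  qed
  also have "\<dots> = (\<integral>\<^sup>+t. \<integral>\<^sup>+x. indicator {z. 0 \<le> snd z \<and> snd z < Z (fst z) \<and> c < Z (fst z)} (x, t) \<partial>M \<partial>lborel)"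
  proof (rule MB.Fubini[symmetric])
    have "indicator {z\<in>space (M \<Otimes>\<^sub>M lborel). 0 \<le> snd z \<and> snd z < Z (fst z) \<and> c < Z (fst z)} \<in> borel_measurable (M \<Otimes>\<^sub>M (lborel :: real measure))"
      by measurable
    then show "indicator {z. 0 \<le> snd z \<and> snd z < Z (fst z) \<and> c < Z (fst z)} \<in> borel_measurable (M \<Otimes>\<^sub>M (lborel :: real measure))"
      by (rule measurable_cong[THEN iffD1, rotated]) (auto simp: indicator_def)
  qed
  also have "\<dots> \<le> (\<integral>\<^sup>+t. w t \<partial>lborel)"
  proof (rule nn_integral_mono)
    fix t :: real
    show "(\<integral>\<^sup>+x. indicator {z. 0 \<le> snd z \<and> snd z < Z (fst z) \<and> c < Z (fst z)} (x, t) \<partial>M) \<le> w t"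
    proof (cases "0 \<le> t")
      case True
      \<comment> \<open>The slice at height \<open>t\<close> of the truncated mean is the tail at
        \<open>max c t\<close>; below \<open>c\<close> this is the constant
        \<open>m c \<le> u\<close>.\<close>
      have "(\<integral>\<^sup>+x. indicator {z. 0 \<le> snd z \<and> snd z < Z (fst z) \<and> c < Z (fst z)} (x, t) \<partial>M)
          = (\<integral>\<^sup>+x. indicator {x\<in>space M. Z x > max c t} x \<partial>M)"
        using True by (intro nn_integral_cong) (auto simp: indicator_def)
      also have "\<dots> = ennreal (m (max c t))" by (simp add: m_def emeasure_eq_measure)
      also have "\<dots> \<le> w t"
      proof (cases "t < c")
        case tc: True
        have "ennreal (m (max c t)) \<le> ennreal u" using mc tc by (intro ennreal_leI) (simp add: max_def)
        also have "\<dots> \<le> w t" using True tc by (rule w1)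
        finally show ?thesis .
      next
        case False
        then show ?thesis using w2[OF True] by (simp add: max_def not_less)
      qed
      finally show ?thesis .
    qed simp
  qed
  finally show "(\<integral>\<^sup>+x. ennreal (Z x) * indicator {x. Z x > c} x \<partial>M) \<le> I" using w_le by simp
qed

section \<open>Convergence in mean\<close>

locale hit_process = stationary_process M X \<mu> for M :: "'a measure" and X :: "int \<Rightarrow> 'a \<Rightarrow> 'e::polish_space" and \<mu> +
  fixes A :: "nat \<Rightarrow> 'e set"
  assumes A_sets: "\<And>k. 1 \<le> k \<Longrightarrow> A k \<in> sets borel"
    and A1_pos: "0 < measure \<mu> (A 1)"
    and diverges: "(\<Sum>k. emeasure \<mu> (A (Suc k))) = \<infinity>"
begin

sublocale law: prob_space \<mu>
  by (rule prob_space_law)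

section \<open>Counts normalized by their expectation\<close>

definition S :: "nat \<Rightarrow> 'a \<Rightarrow> real" where "S n \<omega> = (\<Sum>k=1..n. indicator (A k) (X (int k) \<omega>))"
definition E :: "nat \<Rightarrow> real" where "E n = (\<Sum>k=1..n. measure \<mu> (A k))"
definition H :: "nat \<Rightarrow> 'e \<Rightarrow> real" where "H n x = (\<Sum>k=1..n. indicator (A k) x) / E n"

lemma E_mono: "m \<le> n \<Longrightarrow> E m \<le> E n"
  unfolding E_def by (intro sum_mono2) auto

lemma E_pos: "1 \<le> n \<Longrightarrow> 0 < E n"
  using E_mono[of 1 n] A1_pos by (simp add: E_def)

lemma E_unbounded: "\<exists>n. K < E n"
proof (rule ccontr)
  assume "\<nexists>n. K < E n"
  then have le: "E n \<le> K" for n by (simp add: not_less)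
  have "(\<Sum>k. emeasure \<mu> (A (Suc k))) = (SUP n. \<Sum>k<n. emeasure \<mu> (A (Suc k)))"
    by (rule suminf_eq_SUP)
  also have "\<dots> \<le> ennreal K"
  proof (rule SUP_least)
    fix n
    have "(\<Sum>k<n. emeasure \<mu> (A (Suc k))) = ennreal (\<Sum>k<n. measure \<mu> (A (Suc k)))"
      by (simp add: law.emeasure_eq_measure)
    also have "(\<Sum>k<n. measure \<mu> (A (Suc k))) = E n"
      unfolding E_def by (rule sum.reindex_bij_witness[of _ "\<lambda>k. k - 1" Suc]) auto
    finally show "(\<Sum>k<n. emeasure \<mu> (A (Suc k))) \<le> ennreal K" using le[of n] by (simp add: ennreal_leI)
  qed
  finally show False using diverges by (simp add: top_unique)
qed

lemma E_at_top: "filterlim E at_top sequentially"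
  unfolding filterlim_at_top_dense
proof
  fix K
  obtain n where "K < E n" using E_unbounded by blast
  then show "eventually (\<lambda>n. K < E n) sequentially"
    using E_mono[of n] by (intro eventually_sequentiallyI[of n]) (meson less_le_trans)
qed

lemma H_nonneg: "0 \<le> H n x"
  unfolding H_def E_def by (intro divide_nonneg_nonneg sum_nonneg) auto

lemma H_measurable: "H n \<in> borel_measurable \<mu>"
  unfolding H_def using A_sets
  by (intro borel_measurable_divide borel_measurable_sum borel_measurable_indicator borel_measurable_const) auto

definition tail :: "nat \<Rightarrow> real \<Rightarrow> ennreal" where
  "tail n c = (\<integral>\<^sup>+x. ennreal (H n x) * indicator {x. H n x > c} x \<partial>\<mu>)"

text \<open>Translates between the two thresholds: the count exceeds \<open>c * E n\<close> exactly
  where \<open>H n\<close> exceeds \<open>c\<close>. The value is an \<open>ennreal\<close> to match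
  the definition of uniform integrability.\<close>

lemma tail_eq:
  assumes n: "1 \<le> n"
  shows "ennreal ((\<Sum>k=1..n. measure \<mu> (A k \<inter> {x. (\<Sum>k=1..n. indicator (A k) x) > c * E n})) / E n) = tail n c"
proof -
  let ?T = "{x. (\<Sum>k=1..n. indicator (A k) x) > c * E n}"
  have T: "{x. H n x > c} = ?T"
    using E_pos[OF n] by (auto simp: H_def pos_less_divide_eq)
  have "{x\<in>space \<mu>. H n x > c} \<in> sets \<mu>"
    by (intro borel_measurable_less H_measurable) auto
  then have T_sets: "?T \<in> sets borel" by (simp add: T)
  have AT: "A k \<inter> ?T \<in> sets \<mu>" if "1 \<le> k" for k using A_sets[OF that] T_sets by simp
  have pt: "H n x * indicator ?T x = (\<Sum>k=1..n. indicator (A k \<inter> ?T) x) / E n" for x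
    by (simp add: H_def indicator_def)
  have "tail n c = (\<integral>\<^sup>+x. ennreal ((\<Sum>k=1..n. indicator (A k \<inter> ?T) x) / E n) \<partial>\<mu>)"
    unfolding tail_def T pt[symmetric] by (intro nn_integral_cong) (auto simp: indicator_def)
  also have "\<dots> = ennreal (\<integral>x. (\<Sum>k=1..n. indicator (A k \<inter> ?T) x) / E n \<partial>\<mu>)"
  proof (rule nn_integral_eq_integral)
    show "integrable \<mu> (\<lambda>x. (\<Sum>k=1..n. indicator (A k \<inter> ?T) x) / E n)"
      using AT by (intro integrable_divide Bochner_Integration.integrable_sum integrable_real_indicator)
        (auto simp: law.emeasure_eq_measure)
    show "AE x in \<mu>. 0 \<le> (\<Sum>k=1..n. indicator (A k \<inter> ?T) x) / E n"
      using E_pos[OF n] by (auto intro!: divide_nonneg_pos sum_nonneg)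
  qed
  also have "(\<integral>x. (\<Sum>k=1..n. indicator (A k \<inter> ?T) x) / E n \<partial>\<mu>) = (\<Sum>k=1..n. measure \<mu> (A k \<inter> ?T)) / E n"
    using AT by (subst integral_divide_zero, subst Bochner_Integration.integral_sum)
      (auto simp: law.emeasure_eq_measure intro!: integrable_real_indicator)
  finally show ?thesis ..
qed

text \<open>The mean deviation bound at threshold \<open>c * E n\<close>, divided by
  \<open>E n\<close>.\<close>

lemma L1_ratio_le:
  assumes n: "1 \<le> n" and c: "0 \<le> c" and t: "tail n c \<le> ennreal t" "0 \<le> t"
  shows "(\<integral>\<omega>. \<bar>S n \<omega> / E n - 1\<bar> \<partial>M) \<le> sqrt (2 * real q / E n) + 2 * c * beta_inf_1 M X q + 2 * t"
proof -
  have E: "0 < E n" by (rule E_pos[OF n])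
  define T where "T = {x. (\<Sum>k=1..n. indicator (A k) x) > c * E n}"
  have "(\<integral>\<omega>. \<bar>S n \<omega> - E n\<bar> \<partial>M) \<le> sqrt (2 * real q * E n) + 2 * (c * E n) * beta_inf_1 M X q
      + 2 * (\<Sum>k=1..n. measure \<mu> (A k \<inter> T))"
    unfolding S_def E_def T_def using c A_sets by (intro L1_hits_diff_le) (auto intro!: mult_nonneg_nonneg sum_nonneg)
  moreover have "(\<Sum>k=1..n. measure \<mu> (A k \<inter> T)) / E n \<le> t"
    using t tail_eq[OF n, of c] unfolding T_def by (metis ennreal_le_iff)
  then have "(\<Sum>k=1..n. measure \<mu> (A k \<inter> T)) \<le> t * E n" using E by (simp add: pos_divide_le_eq)
  moreover have "sqrt (2 * real q * E n) = E n * sqrt (2 * real q / E n)"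
    using E by (simp add: real_sqrt_mult real_sqrt_divide field_simps)
  ultimately have "(\<integral>\<omega>. \<bar>S n \<omega> - E n\<bar> \<partial>M) \<le> E n * (sqrt (2 * real q / E n) + 2 * c * beta_inf_1 M X q + 2 * t)"
    by (simp add: algebra_simps)
  moreover have "(\<integral>\<omega>. \<bar>S n \<omega> / E n - 1\<bar> \<partial>M) = (\<integral>\<omega>. \<bar>S n \<omega> - E n\<bar> / E n \<partial>M)"
  proof (intro Bochner_Integration.integral_cong refl)
    fix \<omega>
    have "S n \<omega> / E n - 1 = (S n \<omega> - E n) / E n" using E by (simp add: diff_divide_distrib)
    then show "\<bar>S n \<omega> / E n - 1\<bar> = \<bar>S n \<omega> - E n\<bar> / E n" using E by (simp only: abs_divide abs_of_pos)
  qed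
  ultimately show ?thesis using E by (simp add: pos_divide_le_eq mult.commute)
qed

text \<open>The order of choices matters: first the threshold from uniform integrability, uniformly
  in \<open>n\<close>, then the lag making beta small against that threshold, and only then
  \<open>n\<close>.\<close>

lemma L1_convergence:
  assumes beta: "(\<lambda>n. beta_inf_1 M X n) \<longlonglongrightarrow> 0" and ui: "uniformly_integrable \<mu> {0<..} H"
  shows "(\<lambda>n. \<integral>\<omega>. \<bar>S n \<omega> / E n - 1\<bar> \<partial>M) \<longlonglongrightarrow> 0"
proof (rule LIMSEQ_I)
  fix r :: real assume r: "0 < r"
  \<comment> \<open>One share each for variance and beta and two for the tail; the fifth makes the
    total strictly less than \<open>r\<close>.\<close>
  define e where "e = r / 5"
  have e: "0 < e" using r by (simp add: e_def)
  have "((\<lambda>c. SUP n\<in>{0<..}. tail n c) \<longlongrightarrow> 0) at_top"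
    using ui by (simp add: uniformly_integrable_def tail_def)
  then have "eventually (\<lambda>c. (SUP n\<in>{0<..}. tail n c) < ennreal e) at_top"
    using e by (auto intro: order_tendstoD)
  then have "eventually (\<lambda>c. (SUP n\<in>{0<..}. tail n c) < ennreal e \<and> 0 < c) at_top"
    using eventually_gt_at_top[of 0] by eventually_elim simp
  then obtain c where c: "(SUP n\<in>{0<..}. tail n c) < ennreal e" "0 < c"
    by (auto simp: eventually_at_top_linorder)
  have tail_le: "tail n c \<le> ennreal e" if "1 \<le> n" for n
    using that c(1) by (meson SUP_upper greaterThan_iff less_imp_le less_le_trans order_trans zero_less_one)
  have "(\<lambda>q. 2 * c * beta_inf_1 M X q) \<longlonglongrightarrow> 0"
    using tendsto_mult_left[OF beta, of "2 * c"] by simp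
  then have "eventually (\<lambda>q. 2 * c * beta_inf_1 M X q < e) sequentially"
    using e by (auto intro: order_tendstoD)
  then obtain q where q: "2 * c * beta_inf_1 M X q < e" by (auto simp: eventually_sequentially)
  have "((\<lambda>n. 2 * real q / E n) \<longlongrightarrow> 0) sequentially"
    by (rule real_tendsto_divide_at_top[OF tendsto_const E_at_top])
  from tendsto_real_sqrt[OF this] have "eventually (\<lambda>n. sqrt (2 * real q / E n) < e) sequentially"
    using e by (auto intro: order_tendstoD)
  then have "eventually (\<lambda>n. norm ((\<integral>\<omega>. \<bar>S n \<omega> / E n - 1\<bar> \<partial>M) - 0) < r) sequentially"
    using eventually_ge_at_top[of 1]
  proof eventually_elim
    case (elim n)
    have "(\<integral>\<omega>. \<bar>S n \<omega> / E n - 1\<bar> \<partial>M) \<le> sqrt (2 * real q / E n) + 2 * c * beta_inf_1 M X q + 2 * e"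
      using elim(2) c(2) e by (intro L1_ratio_le tail_le) auto
    also have "\<dots> < r" using elim(1) q r by (simp add: e_def)
    finally show ?case by simp
  qed
  then show "\<exists>n0. \<forall>n\<ge>n0. norm ((\<integral>\<omega>. \<bar>S n \<omega> / E n - 1\<bar> \<partial>M) - 0) < r"
    by (simp add: eventually_sequentially)
qed

section \<open>Bias bound by the quantile functions\<close>

text \<open>For \<open>u > 0\<close> this is the supremum over \<open>n\<close> of the integral of
  the quantile of \<open>H n\<close> over [0,u]; at 0 it vanishes.\<close>

definition phi :: "real \<Rightarrow> ennreal" where "phi u = ennreal u * Q_star \<mu> H u"

lemma phi_ge:
  assumes u: "0 < u" and n: "1 \<le> n"
  shows "(\<integral>\<^sup>+s\<in>{0..u}. ennreal (tail_quantile \<mu> (H n) s) \<partial>lborel) \<le> phi u"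
proof -
  have "phi u = (SUP n\<in>{0<..}. \<integral>\<^sup>+s\<in>{0..u}. ennreal (tail_quantile \<mu> (H n) s) \<partial>lborel)"
    using u unfolding phi_def Q_star_def
    by (simp add: ennreal_times_divide mult.commute[of "ennreal u"] ennreal_mult_divide_eq)
  then show ?thesis using n by (auto intro!: SUP_upper)
qed

text \<open>
  The threshold in the bias bound is the quantile at \<open>\<beta>\<close> when \<open>\<beta> > 0\<close>, and an upper bound of the count
  when \<open>\<beta> = 0\<close>.
\<close>

lemma normalized_decomposition:
  assumes n: "1 \<le> n"
  obtains U V where "integrable M U" "integrable M (\<lambda>\<omega>. (U \<omega>)\<^sup>2)" "integrable M V"
    "\<And>\<omega>. \<omega> \<in> space M \<Longrightarrow> S n \<omega> / E n - 1 = U \<omega> + V \<omega>"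
    "(\<integral>\<omega>. (U \<omega>)\<^sup>2 \<partial>M) \<le> 2 * real q / E n"
    "ennreal (\<integral>\<omega>. \<bar>V \<omega>\<bar> \<partial>M) \<le> 4 * phi (beta_inf_1 M X q)"
proof -
  have E: "0 < E n" by (rule E_pos[OF n])
  obtain U V where UV: "integrable M U" "integrable M (\<lambda>\<omega>. (U \<omega>)\<^sup>2)" "integrable M V"
    "\<And>\<omega>. \<omega> \<in> space M \<Longrightarrow> S n \<omega> - E n = U \<omega> + V \<omega>"
    "(\<integral>\<omega>. (U \<omega>)\<^sup>2 \<partial>M) \<le> 2 * real q * E n"
    "\<And>c. 0 \<le> c \<Longrightarrow> (\<integral>\<omega>. \<bar>V \<omega>\<bar> \<partial>M) \<le> 2 * c * beta_inf_1 M X q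
       + 2 * (\<Sum>k=1..n. measure \<mu> (A k \<inter> {x. (\<Sum>k=1..n. indicator (A k) x) > c}))"
    by (rule hits_decomposition[of A n q, OF A_sets, folded S_def E_def]) (assumption, rule that)
  have V_le: "ennreal (\<integral>\<omega>. \<bar>V \<omega> / E n\<bar> \<partial>M) \<le> 2 * ennreal (c * beta_inf_1 M X q) + 2 * tail n c" if c: "0 \<le> c" for c
  proof -
    let ?s = "\<Sum>k=1..n. measure \<mu> (A k \<inter> {x. (\<Sum>k=1..n. indicator (A k) x) > c * E n})"
    have "(\<integral>\<omega>. \<bar>V \<omega> / E n\<bar> \<partial>M) = (\<integral>\<omega>. \<bar>V \<omega>\<bar> \<partial>M) / E n" using E by simp
    also have "\<dots> \<le> (2 * (c * E n) * beta_inf_1 M X q + 2 * ?s) / E n"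
      using UV(6)[of "c * E n"] c E by (intro divide_right_mono) auto
    also have "\<dots> = 2 * (c * beta_inf_1 M X q) + 2 * (?s / E n)"
      using E by (simp add: add_divide_distrib)
    finally have "ennreal (\<integral>\<omega>. \<bar>V \<omega> / E n\<bar> \<partial>M) \<le> ennreal (2 * (c * beta_inf_1 M X q) + 2 * (?s / E n))"
      by (rule ennreal_leI)
    also have "\<dots> = 2 * ennreal (c * beta_inf_1 M X q) + 2 * ennreal (?s / E n)"
    proof -
      have *: "ennreal (2 * x + 2 * y) = 2 * ennreal x + 2 * ennreal y" if "0 \<le> x" "0 \<le> y" for x y :: real
        using that by (simp add: ennreal_mult)
      show ?thesis
        by (rule *) (use c E beta_nonneg[of q] in \<open>auto intro!: mult_nonneg_nonneg divide_nonneg_pos sum_nonneg\<close>)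
    qed
    finally show ?thesis unfolding tail_eq[OF n] .
  qed
  have "ennreal (\<integral>\<omega>. \<bar>V \<omega> / E n\<bar> \<partial>M) \<le> 4 * phi (beta_inf_1 M X q)"
  proof (cases "beta_inf_1 M X q = 0")
    case True
    have "\<not> real n / E n < H n x" for x
    proof -
      have "(\<Sum>k=1..n. indicator (A k) x :: real) \<le> (\<Sum>k=1..n. 1)"
        by (intro sum_mono) (simp add: indicator_def)
      then show ?thesis using E by (simp add: H_def not_less divide_right_mono)
    qed
    then have "tail n (real n / E n) = 0" by (simp add: tail_def)
    then show ?thesis using V_le[of "real n / E n"] E True by (simp add: less_imp_le)
  next
    case False
    then have u: "0 < beta_inf_1 M X q" using beta_nonneg[of q] by linarith
    define c where "c = tail_quantile \<mu> (H n) (beta_inf_1 M X q)"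
    have "0 \<le> c" unfolding c_def by (rule law.tail_quantile_nonneg[OF H_measurable u])
    note ineq = law.tail_integral_le_quantile_integral[OF H_measurable H_nonneg u, of n, folded c_def tail_def]
    have "ennreal (\<integral>\<omega>. \<bar>V \<omega> / E n\<bar> \<partial>M) \<le> 2 * ennreal (c * beta_inf_1 M X q) + 2 * tail n c"
      by (rule V_le[OF \<open>0 \<le> c\<close>])
    \<comment> \<open>One quantile integral dominates both the threshold part and the tail part;
      each costs \<open>2 * phi\<close>.\<close>
    also have "\<dots> \<le> 2 * phi (beta_inf_1 M X q) + 2 * phi (beta_inf_1 M X q)"
      using order_trans[OF ineq(1) phi_ge[OF u n]] order_trans[OF ineq(2) phi_ge[OF u n]]
      by (intro add_mono mult_left_mono) auto
    also have "\<dots> = 4 * phi (beta_inf_1 M X q)"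
      by (simp flip: distrib_right)
    finally show ?thesis .
  qed
  moreover have "(\<integral>\<omega>. (U \<omega> / E n)\<^sup>2 \<partial>M) \<le> 2 * real q / E n"
  proof -
    have "(\<integral>\<omega>. (U \<omega> / E n)\<^sup>2 \<partial>M) = (\<integral>\<omega>. (U \<omega>)\<^sup>2 \<partial>M) / (E n)\<^sup>2" by (simp add: power_divide)
    also have "\<dots> \<le> (2 * real q * E n) / (E n)\<^sup>2" by (intro divide_right_mono UV(5)) simp
    also have "\<dots> = 2 * real q / E n" using E by (simp add: power2_eq_square)
    finally show ?thesis .
  qed
  moreover have "S n \<omega> / E n - 1 = U \<omega> / E n + V \<omega> / E n" if "\<omega> \<in> space M" for \<omega>
    using UV(4)[OF that] E by (simp add: field_simps)
  ultimately show ?thesis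
    using UV(1-3) by (intro that[of "\<lambda>\<omega>. U \<omega> / E n" "\<lambda>\<omega>. V \<omega> / E n"]) (auto simp: power_divide)
qed

end

section \<open>Almost sure convergence\<close>

lemma sum_dyadic_blocks:
  fixes g :: "nat \<Rightarrow> 'b::comm_monoid_add"
  shows "(\<Sum>j<m. \<Sum>i\<in>{2^j..<2^Suc j}. g i) = (\<Sum>i\<in>{1..<2^m}. g i)"
proof (induction m)
  case (Suc m)
  have "(\<Sum>i\<in>{1..<2^Suc m}. g i) = (\<Sum>i\<in>{1..<2^m}. g i) + (\<Sum>i\<in>{2^m..<2^Suc m}. g i)"
    by (rule sum.atLeastLessThan_concat[symmetric]) auto
  with Suc show ?case by simp
qed simp

text \<open>The \<open>2 ^ j\<close> weights 1/i in a dyadic block are each at least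
  \<open>1 / 2 ^ Suc j\<close>, so they sum to at least 1/2. Taking \<open>q j\<close> to be a
  minimiser of \<open>f\<close> on the block, its value is at most twice the weighted sum there, for
  an arbitrary \<open>f\<close>.\<close>

lemma summable_dyadic_selection:
  fixes f :: "nat \<Rightarrow> ennreal"
  assumes fin: "(\<Sum>i. ennreal (inverse (real (Suc i))) * f (Suc i)) < \<infinity>"
  obtains q :: "nat \<Rightarrow> nat" where "\<And>j. q j < 2 ^ Suc j" "(\<Sum>j. f (q j)) < \<infinity>"
proof -
  define g where "g i = ennreal (inverse (real i)) * f i" for i
  have "\<exists>q\<in>{2^j..<2^Suc j}. \<forall>i\<in>{2^j..<2^Suc j}. f q \<le> f i" for j :: nat
  proof -
    let ?I = "{2^j..<2^Suc j} :: nat set"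
    have "?I \<noteq> {}" by simp
    then have "Min (f ` ?I) \<in> f ` ?I" by (intro Min_in) auto
    then obtain q where "q \<in> ?I" "f q = Min (f ` ?I)" by (metis imageE)
    then show ?thesis by (intro bexI[of _ q]) auto
  qed
  then obtain q where q: "\<And>j. q j \<in> {2^j..<2^Suc j}" "\<And>i j. i \<in> {2^j..<2^Suc j} \<Longrightarrow> f (q j) \<le> f i"
    by metis
  have block: "f (q j) \<le> 2 * (\<Sum>i\<in>{2^j..<2^Suc j}. g i)" for j
  proof -
    have "f (q j) = 2 * (ennreal (2 ^ j * inverse (2 ^ Suc j)) * f (q j))"
    proof -
      have "2 * ennreal (2 ^ j * inverse (2 ^ Suc j)) = ennreal 1"
        by (subst ennreal_numeral[symmetric], subst ennreal_mult[symmetric]) auto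
      then show ?thesis by (simp add: mult.assoc[symmetric])
    qed
    also have "ennreal (2 ^ j * inverse (2 ^ Suc j)) * f (q j) = (\<Sum>i\<in>{2^j..<2^Suc j::nat}. ennreal (inverse (2 ^ Suc j)) * f (q j))"
    proof -
      have "ennreal (2 ^ j * inverse (2 ^ Suc j)) = of_nat (2 ^ j) * ennreal (inverse (2 ^ Suc j))"
        by (subst ennreal_mult) (auto simp: ennreal_of_nat_eq_real_of_nat simp del: power_Suc)
      then show ?thesis by (simp add: mult.assoc)
    qed
    also have "\<dots> \<le> (\<Sum>i\<in>{2^j..<2^Suc j}. g i)"
    proof (rule sum_mono)
      fix i :: nat assume i: "i \<in> {2^j..<2^Suc j}"
      then have "0 < real i" "real i \<le> 2 ^ Suc j"
        by (auto simp: less_le_trans[of 0 "2 ^ j" i]) (metis less_imp_le of_nat_le_iff of_nat_numeral of_nat_power power_Suc of_nat_mult)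
      then have "inverse (2 ^ Suc j) \<le> inverse (real i)" by (rule le_imp_inverse_le[rotated])
      then show "ennreal (inverse (2 ^ Suc j)) * f (q j) \<le> g i"
        unfolding g_def using q(2)[OF i] by (intro mult_mono ennreal_leI) auto
    qed
    finally show ?thesis by (simp add: mult_left_mono)
  qed
  have "(\<Sum>j. f (q j)) = (SUP m. \<Sum>j<m. f (q j))" by (rule suminf_eq_SUP)
  also have "\<dots> \<le> 2 * (\<Sum>i. g (Suc i))"
  proof (rule SUP_least)
    fix m :: nat
    have "(\<Sum>j<m. f (q j)) \<le> (\<Sum>j<m. 2 * (\<Sum>i\<in>{2^j..<2^Suc j}. g i))" by (intro sum_mono block)
    also have "\<dots> = 2 * (\<Sum>i\<in>{1..<2^m}. g i)" by (simp only: sum_dyadic_blocks flip: sum_distrib_left)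
    also have "(\<Sum>i\<in>{1..<2^m}. g i) = (\<Sum>i<2^m - 1. g (Suc i))"
      by (rule sum.reindex_bij_witness[of _ Suc "\<lambda>i. i - 1"]) auto
    also have "\<dots> \<le> (\<Sum>i. g (Suc i))" by (rule sum_le_suminf) auto
    finally show "(\<Sum>j<m. f (q j)) \<le> 2 * (\<Sum>i. g (Suc i))" by (simp add: mult_left_mono)
  qed
  also have "\<dots> < \<infinity>" using fin unfolding g_def by (simp add: ennreal_mult_less_top)
  finally show ?thesis using q(1) by (intro that[of q]) auto
qed

text \<open>Each term is repeated \<open>L\<close> times. This serves the levels, of which
  \<open>L\<close> consecutive ones share a lag.\<close>

lemma suminf_div_less_top:
  fixes f :: "nat \<Rightarrow> ennreal"
  assumes L: "0 < L" and fin: "(\<Sum>j. f j) < \<infinity>"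
  shows "(\<Sum>i. f (i div L)) < \<infinity>"
proof -
  have eq: "(\<Sum>i<L * m. f (i div L)) = of_nat L * (\<Sum>j<m. f j)" for m
  proof (induction m)
    case (Suc m)
    have "(\<Sum>i<L * Suc m. f (i div L)) = (\<Sum>i<L * m. f (i div L)) + (\<Sum>i\<in>{L * m..<L * m + L}. f (i div L))"
      unfolding lessThan_atLeast0 mult_Suc_right add.commute[of L]
      by (rule sum.atLeastLessThan_concat[symmetric]) auto
    also have "(\<Sum>i\<in>{L * m..<L * m + L}. f (i div L)) = (\<Sum>i\<in>{L * m..<L * m + L}. f m)"
    proof (intro sum.cong refl)
      fix i assume i: "i \<in> {L * m..<L * m + L}"
      have "i div L = m" by (rule div_nat_eqI) (use i in \<open>auto simp: mult.commute\<close>)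
      then show "f (i div L) = f m" by simp
    qed
    finally show ?case using Suc by (simp add: distrib_left)
  qed simp
  have "(\<Sum>i. f (i div L)) = (SUP n. \<Sum>i<n. f (i div L))" by (rule suminf_eq_SUP)
  also have "\<dots> \<le> of_nat L * (\<Sum>j. f j)"
  proof (rule SUP_least)
    fix n
    have "(\<Sum>i<n. f (i div L)) \<le> (\<Sum>i<L * n. f (i div L))"
      using L by (intro sum_mono2) auto
    also have "\<dots> \<le> of_nat L * (\<Sum>j. f j)"
      unfolding eq by (intro mult_left_mono sum_le_suminf) auto
    finally show "(\<Sum>i<n. f (i div L)) \<le> of_nat L * (\<Sum>j. f j)" .
  qed
  also have "\<dots> < \<infinity>" using fin by (simp add: ennreal_mult_less_top of_nat_less_top)
  finally show ?thesis .
qed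

lemma AE_tendsto_zero_if_sum_integral_finite:
  fixes f :: "nat \<Rightarrow> 'a \<Rightarrow> real"
  assumes int: "\<And>i. integrable M (f i)" and pos: "\<And>i x. 0 \<le> f i x"
    and fin: "(\<Sum>i. ennreal (\<integral>x. f i x \<partial>M)) < \<infinity>"
  shows "AE x in M. (\<lambda>i. f i x) \<longlonglongrightarrow> 0"
proof -
  have [measurable]: "f i \<in> borel_measurable M" for i using int by auto
  have "(\<integral>\<^sup>+x. (\<Sum>i. ennreal (f i x)) \<partial>M) = (\<Sum>i. \<integral>\<^sup>+x. ennreal (f i x) \<partial>M)"
    by (rule nn_integral_suminf) simp
  also have "\<dots> = (\<Sum>i. ennreal (\<integral>x. f i x \<partial>M))"
    using int pos by (simp add: nn_integral_eq_integral)
  finally have "AE x in M. (\<Sum>i. ennreal (f i x)) \<noteq> \<infinity>"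
    using fin by (intro nn_integral_noteq_infinite) auto
  then show ?thesis
  proof eventually_elim
    case (elim x)
    then have "summable (\<lambda>i. f i x)"
      using pos by (intro summable_suminf_not_top) auto
    then show ?case by (rule summable_LIMSEQ_zero)
  qed
qed

text \<open>If \<open>E k\<close> lies between \<open>r ^ i\<close> and \<open>r ^ Suc i\<close>,
  then \<open>k\<close> lies between \<open>n i\<close> and \<open>n (Suc i)\<close>, and
  monotonicity traps the ratio. One factor \<open>r\<close> is the gap between levels; the second
  absorbs the error of the limit and the overshoot of \<open>E\<close>, which is at most 1.\<close>

lemma ratio_sandwich:
  fixes S E :: "nat \<Rightarrow> real" and n :: "nat \<Rightarrow> nat"
  assumes S_mono: "\<And>k l. k \<le> l \<Longrightarrow> S k \<le> S l" and S0: "\<And>k. 0 \<le> S k"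
    and E_mono: "\<And>k l. k \<le> l \<Longrightarrow> E k \<le> E l" and E_step: "\<And>k. E (Suc k) \<le> E k + 1"
    and E_top: "filterlim E at_top sequentially" and r: "1 < r"
    and n1: "\<And>i. 1 \<le> n i" and n_ge: "\<And>i. r ^ i \<le> E (n i)"
    and n_least: "\<And>i k. 1 \<le> k \<Longrightarrow> r ^ i \<le> E k \<Longrightarrow> n i \<le> k"
    and lim: "(\<lambda>i. S (n i) / E (n i)) \<longlonglongrightarrow> 1"
  shows "eventually (\<lambda>k. 1 / r\<^sup>2 \<le> S k / E k \<and> S k / E k \<le> r\<^sup>2) sequentially"
proof -
  define x where "x i = S (n i) / E (n i)" for i
  have x: "x \<longlonglongrightarrow> 1" using lim by (simp add: x_def[abs_def])
  have pow: "0 < r ^ i" for i using r by simp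
  have "eventually (\<lambda>i. 1 / r < x i) sequentially"
    using x r by (auto intro: order_tendstoD)
  moreover have "eventually (\<lambda>i. x (Suc i) * (r + inverse r ^ i) < r\<^sup>2) sequentially"
  proof (rule order_tendstoD(2))
    show "(\<lambda>i. x (Suc i) * (r + inverse r ^ i)) \<longlonglongrightarrow> 1 * (r + 0)"
      using r by (intro tendsto_intros LIMSEQ_Suc[OF x] LIMSEQ_realpow_zero) (auto simp: field_simps)
    show "1 * (r + 0) < r\<^sup>2" using r by (simp add: power2_eq_square)
  qed
  ultimately have "eventually (\<lambda>i. 1 / r < x i \<and> x (Suc i) * (r + inverse r ^ i) < r\<^sup>2) sequentially"
    by (rule eventually_conj)
  then obtain i0 where i0: "\<And>i. i0 \<le> i \<Longrightarrow> 1 / r < x i \<and> x (Suc i) * (r + inverse r ^ i) < r\<^sup>2"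
    by (auto simp: eventually_sequentially)
  have "eventually (\<lambda>k. r ^ i0 \<le> E k) sequentially"
    using E_top by (simp add: filterlim_at_top)
  then show ?thesis
    using eventually_ge_at_top[of 1]
  proof eventually_elim
    case (elim k)
    \<comment> \<open>The first power exceeding \<open>E k\<close>; its predecessor \<open>i\<close>
      satisfies \<open>r ^ i \<le> E k < r ^ Suc i\<close>.\<close>
    define j where "j = (LEAST j. E k < r ^ j)"
    have j: "E k < r ^ j" unfolding j_def by (rule LeastI_ex) (rule real_arch_pow[OF r])
    have "i0 < j"
    proof (rule ccontr)
      assume "\<not> i0 < j"
      then have "r ^ j \<le> r ^ i0" using r by (intro power_increasing) auto
      with j elim(1) show False by linarith
    qed
    then obtain i where i: "j = Suc i" "i0 \<le> i" by (cases j) auto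
    have ri: "r ^ i \<le> E k"
      using not_less_Least[of i "\<lambda>j. E k < r ^ j"] i by (simp add: j_def)
    have ri': "E k < r ^ Suc i" using j i by simp
    have Ek: "0 < E k" using ri pow[of i] by linarith
    have nk: "n i \<le> k" by (rule n_least[OF elim(2) ri])
    have kn: "k < n (Suc i)"
      using E_mono[of "n (Suc i)" k] n_ge[of "Suc i"] ri' by (meson linorder_not_less order_trans)
    have S_eq: "S (n l) = x l * E (n l)" for l
      using n_ge[of l] pow[of l] by (simp add: x_def)
    have x0: "0 \<le> x l" for l
      unfolding x_def using S0 n_ge[of l] pow[of l] by (intro divide_nonneg_nonneg) auto
    have "1 / r\<^sup>2 \<le> S k / E k"
    proof -
      have "(1 / r) * r ^ i \<le> x i * E (n i)"
        using i0[OF i(2)] n_ge[of i] pow[of i] x0[of i] r by (intro mult_mono) auto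
      also have "\<dots> \<le> S k" using S_mono[OF nk] by (simp add: S_eq)
      finally have "(1 / r) * r ^ i / r ^ Suc i \<le> S k / E k"
        using ri' Ek S0[of k] pow[of "Suc i"] r by (intro frac_le) auto
      then show ?thesis using r by (simp add: power2_eq_square)
    qed
    moreover have "S k / E k \<le> r\<^sup>2"
    proof -
      \<comment> \<open>The preceding index is still at least 1, because
        \<open>1 \<le> k < n (Suc i)\<close>, so minimality of \<open>n (Suc i)\<close> applies to
        it.\<close>
      have "\<not> r ^ Suc i \<le> E (n (Suc i) - 1)"
      proof
        assume *: "r ^ Suc i \<le> E (n (Suc i) - 1)"
        have "n (Suc i) \<le> n (Suc i) - 1" by (rule n_least[OF _ *]) (use kn elim(2) in linarith)
        with kn show False by linarith
      qed
      then have "E (n (Suc i)) \<le> r ^ Suc i + 1"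
        using E_step[of "n (Suc i) - 1"] n1[of "Suc i"] by simp
      then have "S k \<le> x (Suc i) * (r ^ Suc i + 1)"
        using S_mono[of k "n (Suc i)"] kn x0[of "Suc i"] mult_left_mono[of "E (n (Suc i))" "r ^ Suc i + 1" "x (Suc i)"]
        unfolding S_eq by linarith
      then have "S k / E k \<le> x (Suc i) * (r ^ Suc i + 1) / r ^ i"
        using ri pow[of i] S0[of k] x0[of "Suc i"] r by (intro frac_le) (auto intro!: mult_nonneg_nonneg add_nonneg_nonneg)
      also have "\<dots> = x (Suc i) * (r + inverse r ^ i)"
        using r by (simp add: field_simps)
      also have "\<dots> \<le> r\<^sup>2" using i0[OF i(2)] by simp
      finally show ?thesis .
    qed
    ultimately show ?case ..
  qed
qed

section \<open>Almost sure convergence along geometric levels\<close>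

context hit_process
begin

lemma S_mono: "k \<le> l \<Longrightarrow> S k \<omega> \<le> S l \<omega>"
  unfolding S_def by (intro sum_mono2) auto

lemma E_step: "E (Suc k) \<le> E k + 1"
  using law.prob_le_1[of "A (Suc k)"] by (simp add: E_def)

text \<open>
  At level \<open>i\<close>, where \<open>E\<close> has just passed \<open>r ^ i = 4 ^ (i / L)\<close>, conditioning goes back by a lag of
  order \<open>2 ^ (i / L)\<close>: the variances are then summable, and so are the biases for the lags chosen.
\<close>

lemma AE_eventually_ratio_bounds:
  assumes fin: "(\<Sum>j. ennreal (inverse (real (Suc j))) * phi (beta_inf_1 M X (Suc j))) < \<infinity>"
    and r: "1 < r" and L: "0 < L" "r ^ L = 4"
  shows "AE \<omega> in M. eventually (\<lambda>n. 1 / r\<^sup>2 \<le> S n \<omega> / E n \<and> S n \<omega> / E n \<le> r\<^sup>2) sequentially"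
proof -
  obtain q :: "nat \<Rightarrow> nat" where q: "\<And>j. q j < 2 ^ Suc j" "(\<Sum>j. phi (beta_inf_1 M X (q j))) < \<infinity>"
    using summable_dyadic_selection[OF fin] by blast
  define n where "n i = (LEAST n. 1 \<le> n \<and> r ^ i \<le> E n)" for i
  have "\<exists>n. 1 \<le> n \<and> r ^ i \<le> E n" for i
  proof -
    obtain n where "r ^ i < E n" using E_unbounded by blast
    then show ?thesis using E_mono[of n "Suc n"] by (intro exI[of _ "Suc n"]) auto
  qed
  from LeastI_ex[OF this] have n: "1 \<le> n i" "r ^ i \<le> E (n i)" for i
    by (auto simp: n_def)
  have n_least: "n i \<le> k" if "1 \<le> k" "r ^ i \<le> E k" for i k
    unfolding n_def using that by (intro Least_le) auto
  have "\<forall>i. \<exists>U V. integrable M U \<and> integrable M (\<lambda>\<omega>. (U \<omega>)\<^sup>2) \<and> integrable M V \<and>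
    (\<forall>\<omega>\<in>space M. S (n i) \<omega> / E (n i) - 1 = U \<omega> + V \<omega>) \<and>
    (\<integral>\<omega>. (U \<omega>)\<^sup>2 \<partial>M) \<le> 2 * real (q (i div L)) / E (n i) \<and>
    ennreal (\<integral>\<omega>. \<bar>V \<omega>\<bar> \<partial>M) \<le> 4 * phi (beta_inf_1 M X (q (i div L)))"
  proof
    fix i
    show "\<exists>U V. integrable M U \<and> integrable M (\<lambda>\<omega>. (U \<omega>)\<^sup>2) \<and> integrable M V \<and>
    (\<forall>\<omega>\<in>space M. S (n i) \<omega> / E (n i) - 1 = U \<omega> + V \<omega>) \<and>
    (\<integral>\<omega>. (U \<omega>)\<^sup>2 \<partial>M) \<le> 2 * real (q (i div L)) / E (n i) \<and>
    ennreal (\<integral>\<omega>. \<bar>V \<omega>\<bar> \<partial>M) \<le> 4 * phi (beta_inf_1 M X (q (i div L)))"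
      by (rule normalized_decomposition[OF n(1)[of i], of "q (i div L)"]) blast
  qed
  then obtain U V where UV: "\<And>i. integrable M (\<lambda>\<omega>. (U i \<omega>)\<^sup>2)" "\<And>i. integrable M (V i)"
    "\<And>i \<omega>. \<omega> \<in> space M \<Longrightarrow> S (n i) \<omega> / E (n i) - 1 = U i \<omega> + V i \<omega>"
    "\<And>i. (\<integral>\<omega>. (U i \<omega>)\<^sup>2 \<partial>M) \<le> 2 * real (q (i div L)) / E (n i)"
    "\<And>i. ennreal (\<integral>\<omega>. \<bar>V i \<omega>\<bar> \<partial>M) \<le> 4 * phi (beta_inf_1 M X (q (i div L)))"
    by metis
  have "AE \<omega> in M. (\<lambda>i. (U i \<omega>)\<^sup>2) \<longlonglongrightarrow> 0"
  proof (rule AE_tendsto_zero_if_sum_integral_finite[OF UV(1)])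
    have "ennreal (\<integral>\<omega>. (U i \<omega>)\<^sup>2 \<partial>M) \<le> ennreal (4 * (1/2) ^ (i div L))" for i
    proof (rule ennreal_leI)
      have "(4::real) ^ (i div L) = r ^ (L * (i div L))" by (simp add: power_mult L(2))
      also have "\<dots> \<le> r ^ i" using r by (intro power_increasing) auto
      also have "\<dots> \<le> E (n i)" by (rule n(2))
      finally have E4: "(4::real) ^ (i div L) \<le> E (n i)" .
      have "real (q (i div L)) \<le> 2 ^ Suc (i div L)"
        using q(1)[of "i div L"] by (metis less_imp_le of_nat_le_iff of_nat_numeral of_nat_power)
      \<comment> \<open>With j = \<open>i div L\<close>, the lag is below 2^(j+1) and
        \<open>E (n i)\<close> is at least 4^j, leaving geometric decay 2^-j.\<close>
      then have "2 * real (q (i div L)) / E (n i) \<le> 2 * 2 ^ Suc (i div L) / 4 ^ (i div L)"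
        using E4 by (intro frac_le) auto
      also have "\<dots> = 4 * (1/2) ^ (i div L)"
      proof -
        have "(4::real) ^ (i div L) = 2 ^ (i div L) * 2 ^ (i div L)" by (simp flip: power_mult_distrib)
        then show ?thesis by (simp add: power_one_over field_simps)
      qed
      finally show "(\<integral>\<omega>. (U i \<omega>)\<^sup>2 \<partial>M) \<le> 4 * (1/2) ^ (i div L)" using UV(4)[of i] by linarith
    qed
    then have "(\<Sum>i. ennreal (\<integral>\<omega>. (U i \<omega>)\<^sup>2 \<partial>M)) \<le> (\<Sum>i. ennreal (4 * (1/2) ^ (i div L)))"
      by (intro suminf_le) auto
    also have "\<dots> < \<infinity>"
    proof (rule suminf_div_less_top[OF L(1), where f = "\<lambda>j. ennreal (4 * (1/2) ^ j)"])
      have "summable (\<lambda>j. 4 * (1/2::real) ^ j)" by (intro summable_mult summable_geometric) simp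
      then show "(\<Sum>j. ennreal (4 * (1/2) ^ j)) < \<infinity>" by (subst suminf_ennreal2) auto
    qed
    finally show "(\<Sum>i. ennreal (\<integral>\<omega>. (U i \<omega>)\<^sup>2 \<partial>M)) < \<infinity>" .
  qed auto
  moreover have "AE \<omega> in M. (\<lambda>i. \<bar>V i \<omega>\<bar>) \<longlonglongrightarrow> 0"
  proof (rule AE_tendsto_zero_if_sum_integral_finite)
    have "(\<Sum>i. ennreal (\<integral>\<omega>. \<bar>V i \<omega>\<bar> \<partial>M)) \<le> (\<Sum>i. 4 * phi (beta_inf_1 M X (q (i div L))))"
      by (intro suminf_le UV(5)) auto
    also have "\<dots> < \<infinity>"
      using q(2) by (intro suminf_div_less_top[OF L(1), where f = "\<lambda>j. 4 * phi (beta_inf_1 M X (q j))"])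
        (simp add: ennreal_mult_less_top)
    finally show "(\<Sum>i. ennreal (\<integral>\<omega>. \<bar>V i \<omega>\<bar> \<partial>M)) < \<infinity>" .
  qed (use UV(2) in auto)
  ultimately show ?thesis
    using AE_space
  proof eventually_elim
    case (elim \<omega>)
    have "(\<lambda>i. \<bar>U i \<omega>\<bar>) \<longlonglongrightarrow> 0"
      using tendsto_real_sqrt[OF elim(1)] by simp
    then have "(\<lambda>i. U i \<omega> + V i \<omega> + 1) \<longlonglongrightarrow> 0 + 0 + 1"
      using elim(2) by (intro tendsto_add tendsto_const) (simp_all add: tendsto_rabs_zero_iff)
    moreover have "U i \<omega> + V i \<omega> + 1 = S (n i) \<omega> / E (n i)" for i
      using UV(3)[OF elim(3), of i] by simp
    ultimately have "(\<lambda>i. S (n i) \<omega> / E (n i)) \<longlonglongrightarrow> 1" by simp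
    then show ?case
      by (intro ratio_sandwich[of "\<lambda>n. S n \<omega>" E r n] S_mono E_mono E_step E_at_top r n n_least)
        (auto simp: S_def intro!: sum_nonneg)
  qed
qed

lemma strong_convergence:
  assumes fin: "(\<Sum>j. ennreal (inverse (real (Suc j))) * phi (beta_inf_1 M X (Suc j))) < \<infinity>"
  shows "AE \<omega> in M. (\<lambda>n. S n \<omega> / E n) \<longlonglongrightarrow> 1"
proof -
  \<comment> \<open>Ratios tending to 1 with an integral power equal to 4, so that
    \<open>Suc L\<close> consecutive levels share a lag. Countably many ratios cost one null
    set.\<close>
  define r where "r L = root (Suc L) 4" for L
  have r: "1 < r L" "r L ^ Suc L = 4" for L
    by (simp_all add: r_def del: power_Suc)
  have "(\<lambda>L. root L 4) \<longlonglongrightarrow> 1" by (rule LIMSEQ_root_const) simp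
  from LIMSEQ_Suc[OF this] have r_lim: "r \<longlonglongrightarrow> 1" by (simp add: r_def[abs_def])
  have "AE \<omega> in M. \<forall>L. eventually (\<lambda>n. 1 / (r L)\<^sup>2 \<le> S n \<omega> / E n \<and> S n \<omega> / E n \<le> (r L)\<^sup>2) sequentially"
    using AE_eventually_ratio_bounds[OF fin r(1) _ r(2)] by (simp add: AE_all_countable)
  then show ?thesis
  proof eventually_elim
    case (elim \<omega>)
    show ?case
    proof (rule order_tendstoI)
      fix a :: real assume "a < 1"
      moreover have "(\<lambda>L. 1 / (r L)\<^sup>2) \<longlonglongrightarrow> 1 / 1\<^sup>2" by (intro tendsto_intros r_lim) simp
      ultimately have "eventually (\<lambda>L. a < 1 / (r L)\<^sup>2) sequentially" by (auto intro: order_tendstoD)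
      then obtain L where "a < 1 / (r L)\<^sup>2" by (auto simp: eventually_sequentially)
      with elim show "eventually (\<lambda>n. a < S n \<omega> / E n) sequentially"
        by (auto elim!: allE[of _ L] eventually_mono)
    next
      fix a :: real assume "1 < a"
      moreover have "(\<lambda>L. (r L)\<^sup>2) \<longlonglongrightarrow> 1\<^sup>2" by (intro tendsto_intros r_lim)
      ultimately have "eventually (\<lambda>L. (r L)\<^sup>2 < a) sequentially" by (auto intro: order_tendstoD)
      then obtain L where "(r L)\<^sup>2 < a" by (auto simp: eventually_sequentially)
      with elim show "eventually (\<lambda>n. S n \<omega> / E n < a) sequentially"
        by (auto elim!: allE[of _ L] eventually_mono)
    qed
  qed
qed

end

theorem theorem3p1:
  fixes M :: "'a measure"
    and X :: "int \<Rightarrow> 'a \<Rightarrow> 'e::polish_space"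
    and \<mu> :: "'e measure"
    and A :: "nat \<Rightarrow> 'e set"
    and B :: "nat \<Rightarrow> 'a set"
    and E :: "nat \<Rightarrow> real"
    and H :: "nat \<Rightarrow> 'e \<Rightarrow> real"
  assumes "prob_space M"
    and "\<And>i. X i \<in> M \<rightarrow>\<^sub>M borel"
    and "strictly_stationary M borel X"
    and "\<And>i. distr M borel (X i) = \<mu>"
    and "(\<lambda>n. beta_inf_1 M X n) \<longlonglongrightarrow> 0"
    and "\<And>k. k > 0 \<Longrightarrow> A k \<in> sets borel"
    and "measure \<mu> (A 1) > 0"
    and "(\<Sum>k. emeasure \<mu> (A (Suc k))) = \<infinity>"
    and "\<And>k. k > 0 \<Longrightarrow> B k = {\<omega> \<in> space M. X (int k) \<omega> \<in> A k}"
    and "\<And>n. E n = (\<Sum>k=1..n. measure \<mu> (A k))"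
    and "\<And>n x. H n x = (\<Sum>k=1..n. indicator (A k) x) / E n"
  shows "(measure \<mu> (limsup A) > 0 \<longrightarrow> borel_cantelli_seq M B)
    \<and> (uniformly_integrable \<mu> {0<..} H \<longrightarrow> L1_borel_cantelli_seq M B)
    \<and> ((\<Sum>j. ennreal (inverse (real (Suc j)) * beta_inf_1 M X (Suc j))
              * Q_star \<mu> H (beta_inf_1 M X (Suc j))) < \<infinity>
        \<longrightarrow> strongly_borel_cantelli_seq M B)"
proof -
  interpret prob_space M by fact
  interpret hit_process M X \<mu> A
    using assms by unfold_locales auto
  \<comment> \<open>The variables \<open>E\<close> and \<open>H\<close> of the theorem hide the
    locale constants, which therefore appear in qualified form.\<close>
  have E_eq: "E = hit_process.E \<mu> A"
    using assms(10) by (simp add: fun_eq_iff E_def)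
  have H_eq: "H = hit_process.H \<mu> A"
    using assms(11) by (simp add: fun_eq_iff H_def E_eq)
  have B_eq: "B k = X (int k) -` A k \<inter> space M" if "1 \<le> k" for k
    using assms(9)[of k] that by auto
  have hits_eq: "hits B n \<omega> = S n \<omega>" if "\<omega> \<in> space M" for n \<omega>
    unfolding hits_def S_def using that by (intro sum.cong) (auto simp: B_eq indicator_def)
  have expected_eq: "expected_hits M B n = hit_process.E \<mu> A n" for n
  proof -
    have "expected_hits M B n = (\<integral>\<omega>. (\<Sum>k=1..n. indicator (X (int k) -` A k \<inter> space M) \<omega>) \<partial>M)"
      unfolding expected_hits_def hits_def
      by (intro Bochner_Integration.integral_cong refl sum.cong) (auto simp: B_eq)
    also have "\<dots> = (\<Sum>k=1..n. measure \<mu> (A k))"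
      using A_sets by (subst Bochner_Integration.integral_sum) (auto simp: measure_vimage Int_assoc)
    finally show ?thesis by (simp add: E_def)
  qed
  have "emeasure M (B (Suc k)) = emeasure \<mu> (A (Suc k))" for k
    using A_sets[of "Suc k"] by (simp add: B_eq emeasure_eq_measure law.emeasure_eq_measure measure_vimage del: of_nat_Suc)
  then have div: "(\<Sum>k. emeasure M (B (Suc k))) = \<infinity>"
    using diverges by simp
  have ratio_eq: "hits B n \<omega> / expected_hits M B n = S n \<omega> / hit_process.E \<mu> A n" if "\<omega> \<in> space M" for n \<omega>
    using that by (simp add: hits_eq expected_eq)
  show ?thesis
  proof (intro conjI impI)
    assume "0 < measure \<mu> (limsup A)"
    then show "borel_cantelli_seq M B"
      using A_sets assms(5,9) by (intro borel_cantelli_if_limsup_pos) auto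
  next
    assume "uniformly_integrable \<mu> {0<..} H"
    then have "(\<lambda>n. \<integral>\<omega>. \<bar>S n \<omega> / hit_process.E \<mu> A n - 1\<bar> \<partial>M) \<longlonglongrightarrow> 0"
      using L1_convergence[OF assms(5)] by (simp add: H_eq)
    moreover have "(\<integral>\<omega>. \<bar>hits B n \<omega> / expected_hits M B n - 1\<bar> \<partial>M) = (\<integral>\<omega>. \<bar>S n \<omega> / hit_process.E \<mu> A n - 1\<bar> \<partial>M)" for n
      by (intro Bochner_Integration.integral_cong refl) (simp add: ratio_eq)
    ultimately show "L1_borel_cantelli_seq M B"
      using div by (simp add: L1_borel_cantelli_seq_def)
  next
    assume fin: "(\<Sum>j. ennreal (inverse (real (Suc j)) * beta_inf_1 M X (Suc j))
              * Q_star \<mu> H (beta_inf_1 M X (Suc j))) < \<infinity>"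
    \<comment> \<open>The factor beta moves from the weight into \<open>phi\<close>, which gives the
      form required by the dyadic selection.\<close>
    have "ennreal (inverse (real (Suc j)) * beta_inf_1 M X (Suc j)) * Q_star \<mu> H (beta_inf_1 M X (Suc j))
        = ennreal (inverse (real (Suc j))) * phi (beta_inf_1 M X (Suc j))" for j
      by (subst ennreal_mult) (auto simp: phi_def H_eq beta_nonneg mult.assoc simp del: of_nat_Suc)
    then have "AE \<omega> in M. (\<lambda>n. S n \<omega> / hit_process.E \<mu> A n) \<longlonglongrightarrow> 1"
      using fin by (intro strong_convergence) simp
    then have "AE \<omega> in M. (\<lambda>n. hits B n \<omega> / expected_hits M B n) \<longlonglongrightarrow> 1"
      using AE_space by eventually_elim (simp add: ratio_eq)
    then show "strongly_borel_cantelli_seq M B"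
      using div by (simp add: strongly_borel_cantelli_seq_def)
  qed
qed

end
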